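(* Every basis-positive character of the Grossman--Larson algebra $\mathcal G$ vanishes on $\mathcal I_{\mathrm{pf}}$. The normalized basis-positive characters of $\mathcal G$ are exactly the maps $\psi_p=\chi_p\circ\mathsf Q$, $p\in\nabla_\infty$, that is, $$\psi_p(F_{P_\lambda})=\chi_p(\widetilde m_\lambda)\ \text{ for every integer partition }\lambda,\qquad \psi_p(F_t)=0\ \text{ if } t \text{ is not path-forest},$$ and the parameter $p\in\nabla_\infty$ is uniquely determined by the character. The parametrization $p\mapsto\psi_p$ is a homeomorphism from $\nabla_\infty$ onto the set of normalized basis-positive characters equipped with pointwise convergence on the tree basis $(F_t)$. More generally, apart from the zero map and the counit $\varepsilon$, every basis-positive character $\psi$ of $\mathcal G$ has the unique form $$\psi(F_t)=c^{|t|-1}\psi_p(F_t)\quad(t\in\mathcal T),\qquad c=\psi(F_\tau)>0,\quad p\in\nabla_\infty .$$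
   Context: Rooted trees are finite, unlabelled and non-plane (considered up to root-preserving isomorphism). $\mathcal T_n$ is the set of those with $n$ vertices, $\mathcal T=\bigsqcup_{n\ge1}\mathcal T_n$; $|t|$ is the number of vertices of $t$ and $V(t)$ its vertex set (for a fixed representative). $\bullet$ is the one-vertex tree, $C_m$ is the chain (path rooted at an end) with $m$ vertices, and $\tau=C_2$. The real Grossman--Larson algebra $\mathcal G$ has basis $(F_t)_{t\in\mathcal T}$ and product $F_sF_t=\sum_{f:\{1,\dots,k\}\to V(t)}F_{t\circ_f(s_1,\dots,s_k)}$, where $s_1,\dots,s_k$ are the root branches of $s$ (the trees left after deleting the root of $s$, rooted at the children of that root, treated as distinct occurrences) and $t\circ_f(s_1,\dots,s_k)$ is the tree, with the root of $t$ as root, obtained by joining the root of each $s_i$ by an edge to $f(i)$. It is associative with unit $F_\bullet$ and graded by $\deg F_t=|t|-1$. The counit is $\varepsilon(F_t)=\mathbf 1_{\{t=\bullet\}}$. A character is a multiplicative real linear functional $\psi:\mathcal G\to\mathbb R$ (the zero map is allowed). It is normalized if $\psi(F_\tau)=1$. A linear functional is basis-positive if it is nonnegative on every $F_t$. A tree is path-forest if every non-root vertex has at most one child. For an integer partition $\lambda=(\lambda_1,\dots,\lambda_k)$, $P_\lambda$ is the path-forest tree whose root branches are chains with $\lambda_1,\dots,\lambda_k$ vertices ($P_\varnothing=\bullet$). $\mathcal I_{\mathrm{pf}}$ is the linear span of the $F_t$ with $t$ not path-forest. $\Lambda=\mathbb R[\mathsf p_1,\mathsf p_2,\dots]$ is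 the algebra of symmetric functions, $\mathsf p_k=\sum_i x_i^k$; $m_\lambda$ is the monomial symmetric function, $r_j(\lambda)$ is the multiplicity of the part $j$ in $\lambda$, $a_\lambda=\prod_{j\ge1}r_j(\lambda)!$ and $\widetilde m_\lambda=a_\lambda m_\lambda$ ($\widetilde m_\varnothing=1$). $\mathsf Q:\mathcal G\to\Lambda$ is the linear map with $\mathsf Q(F_{P_\lambda})=\widetilde m_\lambda$ and $\mathsf Q(F_t)=0$ for $t$ not path-forest (it is an algebra morphism). $\nabla_\infty=\{p=(p_i)_{i\ge1}:p_1\ge p_2\ge\cdots\ge0,\ \sum_ip_i\le1\}$ with the product topology. For $p\in\nabla_\infty$, $\chi_p:\Lambda\to\mathbb R$ is the unital algebra homomorphism with $\chi_p(\mathsf p_1)=1$ and $\chi_p(\mathsf p_k)=\sum_ip_i^k$ for $k\ge2$. *)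

theory Defs
  imports "HOL-Analysis.Analysis" "HOL-Analysis.Finite_Function_Topology"
    "HOL-Library.Multiset" "HOL-Library.FuncSet" "HOL-Library.Poly_Mapping"
begin

text \<open>A finite unlabelled non-plane rooted tree is determined by the finite multiset of its root
  branches, so isomorphism classes of rooted trees are the elements of the following datatype.\<close>

datatype rtree = Node (branches: "rtree multiset")

primrec nverts :: "rtree \<Rightarrow> nat" where
  "nverts (Node M) = Suc (\<Sum>\<^sub># (image_mset nverts M))"

definition bullet :: rtree where
  "bullet = Node {#}"

text \<open>\<^term>\<open>chain m\<close> is the path with \<open>m\<close> vertices rooted at an end, for \<open>m \<ge> 1\<close>; the value at
  \<open>0\<close> is a dummy.\<close>

fun chain :: "nat \<Rightarrow> rtree" where
  "chain 0 = bullet"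
| "chain (Suc 0) = bullet"
| "chain (Suc (Suc m)) = Node {#chain (Suc m)#}"

abbreviation tau :: rtree where
  "tau \<equiv> chain 2"

text \<open>The vertices of \<open>t\<close> correspond to the subtrees hanging from them (several vertices may give the
  same unlabelled subtree); the children of a vertex are the branches of its subtree, and the
  non-root vertices of \<open>t\<close> are the vertices of the root branches of \<open>t\<close>.\<close>

inductive subtree :: "rtree \<Rightarrow> rtree \<Rightarrow> bool" where
  subtree_refl: "subtree t t"
| subtree_branch: "b \<in># branches t \<Longrightarrow> subtree u b \<Longrightarrow> subtree u t"

definition path_forest :: "rtree \<Rightarrow> bool" where
  "path_forest t \<longleftrightarrow> (\<forall>b u. b \<in># branches t \<longrightarrow> subtree u b \<longrightarrow> size (branches u) \<le> 1)"

text \<open>An integer partition is the multiset of its (positive) parts.\<close>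

definition int_partition :: "nat multiset \<Rightarrow> bool" where
  "int_partition \<mu> \<longleftrightarrow> 0 \<notin># \<mu>"

definition path_tree :: "nat multiset \<Rightarrow> rtree" where
  "path_tree \<mu> = Node (image_mset chain \<mu>)"

lemma subtree_chain: "subtree u b \<Longrightarrow> b = chain m \<Longrightarrow> size (branches u) \<le> 1"
proof (induction arbitrary: m rule: subtree.induct)
  case (subtree_refl t)
  then show ?case
    by (cases m rule: chain.cases) (auto simp: bullet_def)
next
  case (subtree_branch b t u)
  then obtain n where "b = chain n"
    by (cases m rule: chain.cases) (auto simp: bullet_def)
  then show ?case
    by (rule subtree_branch.IH)
qed

lemma path_forest_path_tree: "path_forest (path_tree \<mu>)"
  unfolding path_forest_def path_tree_def using subtree_chain by auto

lemma nverts_chain: "0 < m \<Longrightarrow> nverts (chain m) = m"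
  by (induction m rule: chain.induct) (auto simp: bullet_def)

lemma chain_if_subtrees:
  "(\<And>u. subtree u b \<Longrightarrow> size (branches u) \<le> 1) \<Longrightarrow> b = chain (nverts b)"
proof (induction b)
  case (Node M)
  have "size M \<le> 1"
    using Node.prems[of "Node M"] subtree_refl by auto
  then consider "M = {#}" | b where "M = {#b#}"
    by (metis One_nat_def le_Suc_eq le_zero_eq size_1_singleton_mset size_eq_0_iff_empty)
  then show ?case
  proof cases
    case (2 b)
    have "b = chain (nverts b)"
      using Node.IH[of b] Node.prems subtree_branch 2
      by (metis rtree.sel union_single_eq_member add_mset_add_single)
    moreover have "nverts b = Suc (nverts b - 1)"
      by (cases b) auto
    ultimately have *: "Node {#b#} = chain (Suc (nverts b))"
      by (metis chain.simps(3))
    have "nverts (Node {#b#}) = Suc (nverts b)"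
      by simp
    with * 2 show ?thesis
      by argo
  qed (simp add: bullet_def)
qed

lemma path_forest_iff: "path_forest t \<longleftrightarrow> (\<exists>\<mu>. int_partition \<mu> \<and> t = path_tree \<mu>)"
proof
  assume t: "path_forest t"
  obtain M where M: "t = Node M"
    by (cases t)
  have "b = chain (nverts b)" if "b \<in># M" for b
    using t M that chain_if_subtrees unfolding path_forest_def by (metis rtree.sel)
  then have "image_mset chain (image_mset nverts M) = image_mset (\<lambda>x. x) M"
    unfolding multiset.map_comp by (intro image_mset_cong) simp
  moreover have "nverts b \<noteq> 0" for b
    by (cases b) simp
  then have "int_partition (image_mset nverts M)"
    unfolding int_partition_def by (metis imageE set_image_mset)
  ultimately show "\<exists>\<mu>. int_partition \<mu> \<and> t = path_tree \<mu>"
    using M unfolding path_tree_def by (metis multiset.map_ident)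
qed (use path_forest_path_tree in blast)

text \<open>To speak of the vertex set of an unlabelled tree, fix a plane representative and name each
  vertex by its address: the list of the positions taken on the path from the root.\<close>

datatype ptree = PNode "ptree list"

primrec shape :: "ptree \<Rightarrow> rtree" where
  "shape (PNode ts) = Node (mset (map shape ts))"

lemma shape_surj: "\<exists>T. shape T = t"
proof (induction t)
  case (Node M)
  then obtain g where g: "\<And>b. b \<in># M \<Longrightarrow> shape (g b) = b"
    by metis
  obtain xs where xs: "mset xs = M"
    using ex_mset by blast
  have "map shape (map g xs) = xs"
    using g xs by (auto intro!: map_idI)
  then show ?case
    using xs by (metis shape.simps)
qed

definition plane :: "rtree \<Rightarrow> ptree" where
  "plane t = (SOME T. shape T = t)"

lemma shape_plane: "shape (plane t) = t"
  unfolding plane_def using someI_ex[OF shape_surj] .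

lemma size_nth_less [termination_simp]: "i < length ts \<Longrightarrow> size (ts ! i) < Suc (size_list size ts)"
  by (meson less_Suc_eq_le nth_mem order_refl size_list_estimation')

fun vertices :: "ptree \<Rightarrow> nat list set" where
  "vertices (PNode ts) = insert [] (\<Union>i\<in>{..<length ts}. (\<lambda>v. i # v) ` vertices (ts ! i))"

text \<open>\<^term>\<open>graft T g\<close> joins, for every vertex \<open>v\<close> of \<open>T\<close>, the roots of all trees in the multiset
  \<open>g v\<close> to \<open>v\<close>.\<close>

fun graft :: "ptree \<Rightarrow> (nat list \<Rightarrow> rtree multiset) \<Rightarrow> rtree" where
  "graft (PNode ts) g =
     Node (mset (map (\<lambda>i. graft (ts ! i) (\<lambda>v. g (i # v))) [0..<length ts]) + g [])"

definition branch_list :: "rtree \<Rightarrow> rtree list" where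
  "branch_list s = (SOME ss. mset ss = branches s)"

lemma mset_branch_list: "mset (branch_list s) = branches s"
  unfolding branch_list_def by (rule someI_ex) (rule ex_mset)

type_synonym gl = "rtree \<Rightarrow>\<^sub>0 real"

definition F :: "rtree \<Rightarrow> gl" where
  "F t = Poly_Mapping.single t 1"

definition gl_tree_mult :: "rtree \<Rightarrow> rtree \<Rightarrow> gl" where
  "gl_tree_mult s t =
     (let ss = branch_list s; T = plane t in
      \<Sum>f \<in> {..<length ss} \<rightarrow>\<^sub>E vertices T.
        F (graft T (\<lambda>v. {# ss ! i. i \<in># mset_set {i. i < length ss \<and> f i = v} #})))"

definition gl_mult :: "gl \<Rightarrow> gl \<Rightarrow> gl" (infixl \<open>\<star>\<close> 70) where
  "x \<star> y = (\<Sum>s \<in> Poly_Mapping.keys x. \<Sum>t \<in> Poly_Mapping.keys y.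
     (Poly_Mapping.lookup x s * Poly_Mapping.lookup y t) *\<^sub>R gl_tree_mult s t)"

definition counit :: "gl \<Rightarrow> real" where
  "counit x = Poly_Mapping.lookup x bullet"

text \<open>No unitality is required of a character: the zero map is one.\<close>

definition character :: "(gl \<Rightarrow> real) \<Rightarrow> bool" where
  "character \<psi> \<longleftrightarrow> linear \<psi> \<and> (\<forall>x y. \<psi> (x \<star> y) = \<psi> x * \<psi> y)"

definition normalized :: "(gl \<Rightarrow> real) \<Rightarrow> bool" where
  "normalized \<psi> \<longleftrightarrow> \<psi> (F tau) = 1"

definition basis_positive :: "(gl \<Rightarrow> real) \<Rightarrow> bool" where
  "basis_positive \<psi> \<longleftrightarrow> (\<forall>t. 0 \<le> \<psi> (F t))"

definition I_pf :: "gl set" where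
  "I_pf = span {F t |t. \<not> path_forest t}"

text \<open>Formal power series in \<open>x\<^sub>0, x\<^sub>1, \<dots>\<close> are coefficient functions on exponent vectors.\<close>

type_synonym series = "(nat \<Rightarrow>\<^sub>0 nat) \<Rightarrow> real"

definition s_one :: series where
  "s_one = (\<lambda>\<alpha>. if \<alpha> = 0 then 1 else 0)"

definition s_add :: "series \<Rightarrow> series \<Rightarrow> series" where
  "s_add f g = (\<lambda>\<alpha>. f \<alpha> + g \<alpha>)"

definition s_scale :: "real \<Rightarrow> series \<Rightarrow> series" where
  "s_scale c f = (\<lambda>\<alpha>. c * f \<alpha>)"

definition s_mult :: "series \<Rightarrow> series \<Rightarrow> series" where
  "s_mult f g = (\<lambda>\<alpha>. \<Sum>(\<beta>, \<gamma>) \<in> {(\<beta>, \<gamma>). \<beta> + \<gamma> = \<alpha>}. f \<beta> * g \<gamma>)"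

definition power_sum :: "nat \<Rightarrow> series" where
  "power_sum k = (\<lambda>\<alpha>. if \<exists>i. \<alpha> = Poly_Mapping.single i k then 1 else 0)"

text \<open>The algebra \<open>\<Lambda> = \<real>[p\<^sub>1, p\<^sub>2, \<dots>]\<close>, realized inside the formal power series.\<close>

inductive_set Sym :: "series set" where
  Sym_one: "s_one \<in> Sym"
| Sym_power_sum: "1 \<le> k \<Longrightarrow> power_sum k \<in> Sym"
| Sym_add: "f \<in> Sym \<Longrightarrow> g \<in> Sym \<Longrightarrow> s_add f g \<in> Sym"
| Sym_scale: "f \<in> Sym \<Longrightarrow> s_scale c f \<in> Sym"
| Sym_mult: "f \<in> Sym \<Longrightarrow> g \<in> Sym \<Longrightarrow> s_mult f g \<in> Sym"

text \<open>The sum of all distinct monomials whose multiset of nonzero exponents is \<open>\<mu>\<close>.\<close>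

definition monomial_sym :: "nat multiset \<Rightarrow> series" where
  "monomial_sym \<mu> = (\<lambda>\<alpha>.
     if image_mset (Poly_Mapping.lookup \<alpha>) (mset_set (Poly_Mapping.keys \<alpha>)) = \<mu> then 1 else 0)"

definition aug_monomial_sym :: "nat multiset \<Rightarrow> series" where
  "aug_monomial_sym \<mu> =
     s_scale (\<Prod>j \<in> set_mset \<mu>. fact (count \<mu> j)) (monomial_sym \<mu>)"

text \<open>A path-forest tree is \<^term>\<open>path_tree \<mu>\<close> for the multiset \<open>\<mu>\<close> of sizes of its branches.\<close>

definition Q_tree :: "rtree \<Rightarrow> series" where
  "Q_tree t = (if path_forest t then aug_monomial_sym (image_mset nverts (branches t))
     else (\<lambda>\<alpha>. 0))"

definition Q :: "gl \<Rightarrow> series" where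
  "Q x = (\<lambda>\<alpha>. \<Sum>t \<in> Poly_Mapping.keys x. Poly_Mapping.lookup x t * Q_tree t \<alpha>)"

lemma Q_path_tree:
  assumes "int_partition \<mu>"
  shows "Q (F (path_tree \<mu>)) = aug_monomial_sym \<mu>"
proof -
  have "image_mset (nverts \<circ> chain) \<mu> = image_mset id \<mu>"
    using assms by (intro image_mset_cong) (auto simp: int_partition_def intro!: nverts_chain gr0I)
  then have "image_mset nverts (branches (path_tree \<mu>)) = \<mu>"
    by (simp add: path_tree_def multiset.map_comp)
  then show ?thesis
    by (simp add: Q_def F_def Q_tree_def path_forest_path_tree)
qed

lemma Q_not_path_forest: "\<not> path_forest t \<Longrightarrow> Q (F t) = (\<lambda>\<alpha>. 0)"
  by (simp add: Q_def F_def Q_tree_def)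

text \<open>Sequences are indexed from \<open>0\<close>.\<close>

definition Nabla :: "(nat \<Rightarrow> real) set" where
  "Nabla = {p. antimono p \<and> (\<forall>i. 0 \<le> p i) \<and> summable p \<and> suminf p \<le> 1}"

text \<open>The unital algebra homomorphism with prescribed values on the power sums; extensionality only
  fixes the irrelevant values outside \<^const>\<open>Sym\<close>.\<close>

definition chi :: "(nat \<Rightarrow> real) \<Rightarrow> series \<Rightarrow> real" where
  "chi p = (THE h. h \<in> extensional Sym
     \<and> h s_one = 1
     \<and> (\<forall>f\<in>Sym. \<forall>g\<in>Sym. h (s_add f g) = h f + h g)
     \<and> (\<forall>c. \<forall>f\<in>Sym. h (s_scale c f) = c * h f)
     \<and> (\<forall>f\<in>Sym. \<forall>g\<in>Sym. h (s_mult f g) = h f * h g)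
     \<and> h (power_sum 1) = 1
     \<and> (\<forall>k\<ge>2. h (power_sum k) = suminf (\<lambda>i. p i ^ k)))"

definition psi :: "(nat \<Rightarrow> real) \<Rightarrow> gl \<Rightarrow> real" where
  "psi p = chi p \<circ> Q"

definition normalized_characters :: "(gl \<Rightarrow> real) set" where
  "normalized_characters = {\<psi>. character \<psi> \<and> normalized \<psi> \<and> basis_positive \<psi>}"

text \<open>The coarsest topology making all evaluations \<open>\<psi> \<mapsto> \<psi> (F t)\<close> continuous
  (the type \<^typ>\<open>rtree \<Rightarrow> real\<close> carries the product topology).\<close>

definition characters_topology :: "(gl \<Rightarrow> real) topology" where
  "characters_topology =
     pullback_topology normalized_characters (\<lambda>\<psi> t. \<psi> (F t)) (euclidean :: (rtree \<Rightarrow> real) topology)"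

end

theory Submission
  imports Defs
begin

text \<open>Comparing \<open>F cherry \<star> F tau\<close> with \<open>F tau \<star> F cherry\<close> shows that a character kills the tree
  obtained by planting a cherry on a new root. For a basis-positive character, all trees occurring in a
  product with a killed factor are killed too, and so every tree that is not a path forest is killed. On
  path forests, multiplicativity says that \<open>\<mu> \<mapsto> \<psi> (F (path_tree \<mu>))\<close> obeys the rule for multiplying an
  augmented monomial symmetric function by a power sum; hence \<open>\<psi>\<close> is determined by its values on the
  trees with one branch.

  Kingman's theorem for such functions \<open>h\<close> is proved by moments. The numbers \<open>h \<mu>\<close> weight the paths in the
  graph of partitions, which gives a random partition of \<open>n\<close> for every \<open>n\<close>. The mean of its factorial
  power sum is a falling factorial times \<open>h {#k#}\<close>, and multiplicativity makes its variance negligible, so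
  that some partitions \<open>\<nu>\<close> of \<open>n\<close> have power sums \<open>\<Sum>\<^sub>j (\<nu>\<^sub>j / n)\<^sup>k\<close> close to \<open>h {#k#}\<close>. A limit point in the compact
  space \<open>Nabla\<close> is the parameter.

  Conversely, \<open>chi p\<close> is a limit of evaluations at finitely many nonnegative variables, and on trees such an
  evaluation is a convolution of nonnegative characters supported on chains, one for each variable.\<close>

section \<open>Grafting sums and finitely many variables\<close>

text \<open>The stuffle rule settles everything on path forests, but it concerns left factors with a
  single branch, while \<open>psi p\<close> must be shown multiplicative on all pairs of trees. This
  is done on the tree side: a functional of the multiset of root branches is tested against all
  grafting sums at once, a property that survives the adjunction of one variable and passes to
  limits. Evaluations at finitely many variables also settle the existence of \<open>chi p\<close>:
  \<open>Sym\<close> consists of formal power series, and a limit of evaluations is a well-defined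
  homomorphism on it.

  In the moment argument, falling factorials replace powers because marking distinct elements of a
  block interacts exactly with adding an element to a partition; after division by
  \<open>n ^ k\<close> the difference from ordinary power sums is of order \<open>1 / n\<close>.
  Only exponents \<open>k \<ge> 2\<close> pass to a limit point, since for \<open>k = 1\<close> mass
  can escape into many small parts. This is why the first power sum is sent to 1 and not to the sum
  of the entries.\<close>

definition chainlike :: "rtree \<Rightarrow> bool" where
  "chainlike b \<longleftrightarrow> (\<forall>u. subtree u b \<longrightarrow> size (branches u) \<le> 1)"

lemma path_forest_Node: "path_forest (Node M) \<longleftrightarrow> (\<forall>b\<in>#M. chainlike b)"
  by (auto simp: path_forest_def chainlike_def)

lemma subtree_Node_iff: "subtree u (Node M) \<longleftrightarrow> u = Node M \<or> (\<exists>b\<in>#M. subtree u b)"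
  by (subst subtree.simps) auto

lemma chainlike_Node_iff: "chainlike (Node M) \<longleftrightarrow> size M \<le> 1 \<and> (\<forall>c\<in>#M. chainlike c)"
  by (auto simp: chainlike_def subtree_Node_iff)

lemma chainlike_Node [simp]:
  "chainlike (Node {#})"
  "chainlike (Node {#c#}) \<longleftrightarrow> chainlike c"
  "\<not> chainlike (Node (add_mset c (add_mset d M)))"
  by (auto simp: chainlike_Node_iff)

lemma chainlike_chain [simp]: "chainlike (chain m)"
  by (induction m rule: chain.induct) (auto simp: bullet_def)

lemma nverts_pos [simp]: "0 < nverts t"
  by (cases t) auto

lemma chainlike_eq_chain: "chainlike b \<Longrightarrow> b = chain (nverts b)"
  using chain_if_subtrees by (auto simp: chainlike_def)

lemma Node_chain: "0 < m \<Longrightarrow> Node {#chain m#} = chain (Suc m)"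
  by (cases m) auto

text \<open>The root branches of the left factor are indexed by a finite set \<open>J\<close> through \<open>b\<close>, so that the sum over
  all graftings can be split according to the subset of \<open>J\<close> that goes to the first branch of the right factor.\<close>

definition fibre :: "(nat \<Rightarrow> rtree) \<Rightarrow> nat set \<Rightarrow> (nat \<Rightarrow> nat list) \<Rightarrow> nat list \<Rightarrow> rtree multiset" where
  "fibre b J f v = image_mset b (mset_set {i \<in> J. f i = v})"

definition graft_sum :: "(rtree multiset \<Rightarrow> real) \<Rightarrow> ptree list \<Rightarrow> nat set \<Rightarrow> (nat \<Rightarrow> rtree) \<Rightarrow> real" where
  "graft_sum \<phi> ts J b =
     (\<Sum>f \<in> J \<rightarrow>\<^sub>E vertices (PNode ts). \<phi> (branches (graft (PNode ts) (fibre b J f))))"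

abbreviation labels :: "(nat \<Rightarrow> rtree) \<Rightarrow> nat set \<Rightarrow> rtree multiset" where
  "labels b J \<equiv> image_mset b (mset_set J)"

abbreviation shapes :: "ptree list \<Rightarrow> rtree multiset" where
  "shapes ts \<equiv> mset (map shape ts)"

lemma finite_vertices [simp]: "finite (vertices T)"
  by (induction T rule: vertices.induct) auto

text \<open>A map into a disjoint union is a subset \<open>A\<close> of its domain, the part sent to
  the first piece, with one map on \<open>A\<close> and one on \<open>J - A\<close>. The injections
  \<open>k\<close> and \<open>l\<close> later renumber the vertices of a first branch and of the
  rest of a tree.\<close>

lemma sum_PiE_disjoint_images:
  fixes G :: "('i \<Rightarrow> 'v) \<Rightarrow> 'c::comm_monoid_add"
  assumes fin: "finite J" "finite X" "finite Y"
    and inj: "inj_on k X" "inj_on l Y" and disj: "k ` X \<inter> l ` Y = {}"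
  shows "(\<Sum>f \<in> J \<rightarrow>\<^sub>E (k ` X \<union> l ` Y). G f) =
    (\<Sum>A \<in> Pow J. \<Sum>f \<in> A \<rightarrow>\<^sub>E X. \<Sum>g \<in> (J - A) \<rightarrow>\<^sub>E Y.
       G (\<lambda>i. if i \<in> A then k (f i) else if i \<in> J then l (g i) else undefined))"
proof -
  let ?S = "SIGMA A : Pow J. (A \<rightarrow>\<^sub>E X) \<times> ((J - A) \<rightarrow>\<^sub>E Y)"
  let ?m = "\<lambda>(A, f, g) i. if i \<in> A then k (f i) else if i \<in> J then l (g i) else undefined"
  have "(\<Sum>f \<in> J \<rightarrow>\<^sub>E (k ` X \<union> l ` Y). G f) = (\<Sum>z \<in> ?S. G (?m z))"
  proof (rule sum.reindex_bij_witness[where j = "\<lambda>f. let A = {i \<in> J. f i \<in> k ` X} in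
        (A, restrict (inv_into X k \<circ> f) A, restrict (inv_into Y l \<circ> f) (J - A))" and i = ?m])
    fix f assume f: "f \<in> J \<rightarrow>\<^sub>E (k ` X \<union> l ` Y)"
    define A where "A = {i \<in> J. f i \<in> k ` X}"
    have *: "k (inv_into X k (f i)) = f i" if "i \<in> A" for i
      using that f_inv_into_f[of "f i" k X] by (auto simp: A_def)
    have **: "l (inv_into Y l (f i)) = f i" if "i \<in> J" "i \<notin> A" for i
      using that f f_inv_into_f[of "f i" l Y] by (auto simp: A_def)
    show eq: "?m (let A = {i \<in> J. f i \<in> k ` X} in
        (A, restrict (inv_into X k \<circ> f) A, restrict (inv_into Y l \<circ> f) (J - A))) = f"
      unfolding Let_def A_def[symmetric]
      using f * ** by (auto simp: fun_eq_iff A_def PiE_def extensional_def)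
    show "G (?m (let A = {i \<in> J. f i \<in> k ` X} in
        (A, restrict (inv_into X k \<circ> f) A, restrict (inv_into Y l \<circ> f) (J - A)))) = G f"
      unfolding eq ..
    have "f i \<in> l ` Y" if "i \<in> J" "i \<notin> A" for i
      using that f by (auto simp: A_def)
    then show "(let A = {i \<in> J. f i \<in> k ` X} in
        (A, restrict (inv_into X k \<circ> f) A, restrict (inv_into Y l \<circ> f) (J - A))) \<in> ?S"
      unfolding Let_def A_def[symmetric]
      by (auto simp: A_def intro!: inv_into_into)
  next
    fix z assume z: "z \<in> ?S"
    obtain A f g where zz: "z = (A, f, g)"
      by (cases z) auto
    have A: "A \<subseteq> J" and f: "f \<in> A \<rightarrow>\<^sub>E X" and g: "g \<in> (J - A) \<rightarrow>\<^sub>E Y"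
      using z zz by auto
    have gY: "l (g i) \<notin> k ` X" if "i \<in> J" "i \<notin> A" for i
      using that g disj by fastforce
    have fX: "k (f i) \<in> k ` X" if "i \<in> A" for i
      using that f by auto
    have AA: "{i \<in> J. ?m z i \<in> k ` X} = A"
      using A gY fX unfolding zz by auto
    have "restrict (inv_into X k \<circ> ?m z) A = f"
      using f inj(1) unfolding zz by (auto simp: fun_eq_iff PiE_def extensional_def inv_into_f_f Pi_def)
    moreover have "restrict (inv_into Y l \<circ> ?m z) (J - A) = g"
      using g inj(2) unfolding zz by (auto simp: fun_eq_iff PiE_def extensional_def inv_into_f_f Pi_def)
    ultimately show "(let A = {i \<in> J. ?m z i \<in> k ` X} in
        (A, restrict (inv_into X k \<circ> ?m z) A, restrict (inv_into Y l \<circ> ?m z) (J - A))) = z"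
      unfolding Let_def AA by (simp add: zz)
    show "?m z \<in> J \<rightarrow>\<^sub>E (k ` X \<union> l ` Y)"
      using A f g unfolding zz by (fastforce simp: PiE_def extensional_def Pi_def)
  qed
  also have "\<dots> = (\<Sum>A \<in> Pow J. \<Sum>(f, g) \<in> (A \<rightarrow>\<^sub>E X) \<times> ((J - A) \<rightarrow>\<^sub>E Y). G (?m (A, f, g)))"
    using fin by (subst sum.Sigma) (auto intro!: finite_PiE finite_cartesian_product sum.cong
        intro: finite_subset)
  finally show ?thesis
    by (simp add: sum.cartesian_product)
qed

lemma graft_empty: "(\<And>v. v \<in> vertices T \<Longrightarrow> g v = {#}) \<Longrightarrow> graft T g = shape T"
proof (induction T arbitrary: g)
  case (PNode ts)
  have "graft (ts ! i) (\<lambda>v. g (i # v)) = shape (ts ! i)" if "i < length ts" for i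
    using that PNode.prems by (intro PNode.IH) auto
  then have "map (\<lambda>i. graft (ts ! i) (\<lambda>v. g (i # v))) [0..<length ts] = map shape ts"
    by (intro nth_equalityI) auto
  moreover have "g [] = {#}"
    using PNode.prems by simp
  ultimately show ?case
    by simp
qed

lemma graft_sum_Nil [simp]: "graft_sum \<phi> [] J b = \<phi> (labels b J)"
proof -
  have "{i \<in> J. f i = []} = J" if "f \<in> J \<rightarrow>\<^sub>E {[]}" for f :: "nat \<Rightarrow> nat list"
    using that by auto
  then have "(\<Sum>f \<in> J \<rightarrow>\<^sub>E {[]}. \<phi> (fibre b J f [])) = (\<Sum>f \<in> J \<rightarrow>\<^sub>E {[]::nat list}. \<phi> (labels b J))"
    by (intro sum.cong) (auto simp: fibre_def)
  then show ?thesis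
    by (simp add: graft_sum_def PiE_singleton card_PiE)
qed

lemma graft_Cons:
  "graft (PNode (T # ts)) g =
     Node (add_mset (graft T (\<lambda>v. g (0 # v)))
       (branches (graft (PNode ts) (\<lambda>v. g (case v of [] \<Rightarrow> [] | j # u \<Rightarrow> Suc j # u)))))"
  by (simp add: upt_conv_Cons comp_def map_Suc_upt[symmetric] del: upt_Suc map_Suc_upt)

lemma Cons_in_vertices: "j # u \<in> vertices (PNode ts) \<longleftrightarrow> j < length ts \<and> u \<in> vertices (ts ! j)"
  by auto

text \<open>The root is assigned to the second piece: deleting the first branch leaves a tree with
  the same root, in which position \<open>j\<close> stands for the old position
  \<open>Suc j\<close>.\<close>

lemma vertices_Cons:
  "vertices (PNode (T # ts)) = (\<lambda>v. 0 # v) ` vertices T \<union>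
     (\<lambda>v. case v of [] \<Rightarrow> [] | j # u \<Rightarrow> Suc j # u) ` vertices (PNode ts)"
  (is "?V = ?A \<union> ?l ` ?B")
proof (intro set_eqI)
  fix x
  have l: "x \<in> ?l ` X \<longleftrightarrow> (x = [] \<and> [] \<in> X) \<or> (\<exists>j u. x = Suc j # u \<and> j # u \<in> X)" for X
    by (auto simp: image_iff split: list.splits) (metis list.exhaust)+
  show "x \<in> ?V \<longleftrightarrow> x \<in> ?A \<union> ?l ` ?B"
  proof (cases x)
    case Nil
    then show ?thesis
      unfolding Un_iff l by auto
  next
    case (Cons j u)
    then show ?thesis
      unfolding Un_iff l unfolding Cons Cons_in_vertices by (cases j) auto
  qed
qed

lemma graft_sum_Cons:
  assumes "finite J"
  shows "graft_sum \<phi> (T # ts) J b =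
    (\<Sum>A \<in> Pow J. \<Sum>f \<in> A \<rightarrow>\<^sub>E vertices T.
       graft_sum (\<lambda>M. \<phi> (add_mset (graft T (fibre b A f)) M)) ts (J - A) b)"
proof -
  define l where "l = (\<lambda>v. case v of [] \<Rightarrow> [] | j # u \<Rightarrow> Suc j # (u :: nat list))"
  have l_eq [simp]: "l u = l v \<longleftrightarrow> u = v" "l u \<noteq> 0 # v" "0 # v \<noteq> l u" for u v
    by (auto simp: l_def split: list.splits)
  have "graft (PNode (T # ts)) (fibre b J (\<lambda>i. if i \<in> A then 0 # f i else if i \<in> J then l (g i) else undefined))
      = Node (add_mset (graft T (fibre b A f)) (branches (graft (PNode ts) (fibre b (J - A) g))))"
    (is "graft _ (fibre b J ?h) = _")
    if "A \<subseteq> J" for A f g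
  proof -
    have "{i \<in> J. ?h i = 0 # v} = {i \<in> A. f i = v}" for v
      using that by auto
    moreover have "{i \<in> J. ?h i = l v} = {i \<in> J - A. g i = v}" for v
      using that by auto
    ultimately show ?thesis
      unfolding graft_Cons fibre_def l_def[symmetric] by presburger
  qed
  then show ?thesis
    unfolding graft_sum_def vertices_Cons l_def[symmetric] using assms
    by (subst sum_PiE_disjoint_images)
      (auto intro!: sum.cong inj_onI simp del: graft.simps vertices.simps)
qed

lemma graft_sum_empty: "graft_sum \<phi> ts {} b = \<phi> (shapes ts)"
proof -
  have "graft (PNode ts) (fibre b {} f) = Node (shapes ts)" for f
    using graft_empty[of "PNode ts" "fibre b {} f"] by (simp add: fibre_def)
  then show ?thesis
    by (simp add: graft_sum_def del: graft.simps)
qed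

lemma graft_sum_add: "graft_sum (\<lambda>M. \<phi> M + \<phi>' M) ts J b = graft_sum \<phi> ts J b + graft_sum \<phi>' ts J b"
  by (simp add: graft_sum_def sum.distrib)

lemma graft_sum_scale: "graft_sum (\<lambda>M. c * \<phi> M) ts J b = c * graft_sum \<phi> ts J b"
  by (simp add: graft_sum_def sum_distrib_left)

section \<open>Functionals multiplicative on grafting sums\<close>

text \<open>A multiset \<open>M\<close> stands for the tree \<open>Node M\<close>. The plane
  representative, the index set and the labels are all quantified, so that the property can be
  applied to subsets of \<open>J\<close> and to lists with a branch left out.\<close>

definition graft_multiplicative :: "(rtree multiset \<Rightarrow> real) \<Rightarrow> bool" where
  "graft_multiplicative \<phi> \<longleftrightarrow>
     (\<forall>ts J b. finite J \<longrightarrow> graft_sum \<phi> ts J b = \<phi> (labels b J) * \<phi> (shapes ts))"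

text \<open>The character belonging to one variable \<open>y\<close> is \<open>y ^ m\<close> on the
  chain with \<open>m + 1\<close> vertices and 0 elsewhere; \<open>weight y c\<close> is its value
  at \<open>Node {#c#}\<close>, and \<open>small_weight y M\<close> its value at
  \<open>Node M\<close>.\<close>

definition weight :: "real \<Rightarrow> rtree \<Rightarrow> real" where
  "weight y c = (if chainlike c then y ^ nverts c else 0)"

definition small_weight :: "real \<Rightarrow> rtree multiset \<Rightarrow> real" where
  "small_weight y M = (if M = {#} then 1 else if size M = 1 then \<Sum>\<^sub># (image_mset (weight y) M) else 0)"

lemma small_weight_simps [simp]:
  "small_weight y {#} = 1"
  "small_weight y {#c#} = weight y c"
  "small_weight y (add_mset c (add_mset d M)) = 0"
  by (simp_all add: small_weight_def)

lemma weight_Node: "weight y (Node M) = y * small_weight y M"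
proof (cases "size M \<le> 1")
  case True
  then consider "M = {#}" | c where "M = {#c#}"
    by (metis One_nat_def le_Suc_eq le_zero_eq size_1_singleton_mset size_eq_0_iff_empty)
  then show ?thesis
    by cases (auto simp: weight_def)
next
  case False
  then show ?thesis
    by (auto simp: weight_def small_weight_def chainlike_Node_iff)
qed

lemma graft_sum_tree:
  "(\<Sum>f \<in> J \<rightarrow>\<^sub>E vertices (PNode ts). g (graft (PNode ts) (fibre b J f))) = graft_sum (\<lambda>M. g (Node M)) ts J b"
  unfolding graft_sum_def by simp

text \<open>A grafted tree is a chain only if the original tree is one and received nothing, or one
  chain at its leaf; vertex numbers then add. Two or more grafted trees always create branching, in
  agreement with \<open>small_weight\<close>.\<close>

lemma sum_weight_graft:
  "finite A \<Longrightarrow> (\<Sum>f \<in> A \<rightarrow>\<^sub>E vertices T. weight y (graft T (fibre b A f)))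
     = weight y (shape T) * small_weight y (labels b A)"
proof (induction T)
  case (PNode ts)
  consider "ts = []" | T where "ts = [T]" | T T' ts' where "ts = T # T' # ts'"
    by (cases ts rule: list.exhaust; cases "tl ts" rule: list.exhaust; simp)
  then show ?case
  proof cases
    case 1
    then show ?thesis
      unfolding graft_sum_tree by (simp add: weight_Node)
  next
    case 2
    \<comment> \<open>A label outside \<open>B\<close> becomes a second child of the root, so all
      labels must go into \<open>T\<close>.\<close>
    have zero: "(\<Sum>f \<in> B \<rightarrow>\<^sub>E vertices T.
        weight y (Node (add_mset (graft T (fibre b B f)) (labels b (A - B))))) = 0"
      if "B \<in> Pow A" "B \<notin> {A}" for B
    proof -
      have "finite (A - B)" "A - B \<noteq> {}"
        using that PNode.prems by auto
      then obtain c M where "labels b (A - B) = add_mset c M"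
        by (metis (no_types, lifting) finite_set_mset_mset_set image_mset_is_empty_iff multiset_cases set_mset_empty)
      then show ?thesis
        by (simp add: weight_Node)
    qed
    have "(\<Sum>B \<in> Pow A. \<Sum>f \<in> B \<rightarrow>\<^sub>E vertices T.
        weight y (Node (add_mset (graft T (fibre b B f)) (labels b (A - B)))))
      = (\<Sum>B \<in> {A}. \<Sum>f \<in> B \<rightarrow>\<^sub>E vertices T.
        weight y (Node (add_mset (graft T (fibre b B f)) (labels b (A - B)))))"
      using PNode.prems zero by (intro sum.mono_neutral_right) auto
    also have "\<dots> = y * (\<Sum>f \<in> A \<rightarrow>\<^sub>E vertices T. weight y (graft T (fibre b A f)))"
      by (simp add: weight_Node sum_distrib_left)
    also have "\<dots> = y * weight y (shape T) * small_weight y (labels b A)"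
      using PNode.IH[of T] PNode.prems 2 by simp
    finally show ?thesis
      unfolding graft_sum_tree using 2 PNode.prems by (simp add: graft_sum_Cons weight_Node)
  next
    case 3
    then show ?thesis
      unfolding graft_sum_tree using PNode.prems
      by (simp add: graft_sum_Cons graft_sum_def weight_Node finite_subset)
  qed
qed

lemma sum_Pow_small_weight:
  assumes "finite J"
  shows "(\<Sum>A \<in> Pow J. small_weight y (labels b A) * X A) = X {} + (\<Sum>i\<in>J. weight y (b i) * X {i})"
proof -
  have zero: "small_weight y (labels b A) = 0" if A: "A \<subseteq> J" "A \<noteq> {}" "\<forall>i\<in>J. A \<noteq> {i}" for A
  proof -
    have fin: "finite A"
      using A(1) assms finite_subset by blast
    have "card A \<noteq> 1"
      using A by (auto simp: card_1_singleton_iff)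
    then show ?thesis
      using A fin by (simp add: small_weight_def mset_set_empty_iff)
  qed
  have "(\<Sum>A \<in> Pow J. small_weight y (labels b A) * X A)
      = (\<Sum>A \<in> insert {} ((\<lambda>i. {i}) ` J). small_weight y (labels b A) * X A)"
    using assms zero by (intro sum.mono_neutral_right) auto
  also have "\<dots> = X {} + (\<Sum>A \<in> (\<lambda>i. {i}) ` J. small_weight y (labels b A) * X A)"
    using assms by (subst sum.insert) auto
  also have "(\<Sum>A \<in> (\<lambda>i. {i}) ` J. small_weight y (labels b A) * X A) = (\<Sum>i\<in>J. weight y (b i) * X {i})"
    by (subst sum.reindex) (auto simp: inj_on_def)
  finally show ?thesis .
qed

text \<open>The terms of a convolution in which the new one-variable character takes exactly one
  root branch \<open>c\<close>; since that character vanishes on trees with two or more branches,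
  the only other term is the one where it takes none.\<close>

definition removal :: "real \<Rightarrow> (rtree multiset \<Rightarrow> real) \<Rightarrow> rtree multiset \<Rightarrow> real" where
  "removal y \<phi> M = (\<Sum>c\<in>#M. weight y c * \<phi> (M - {#c#}))"

lemma removal_empty [simp]: "removal y \<phi> {#} = 0"
  by (simp add: removal_def)

lemma add_mset_minus_single: "d \<in># M \<Longrightarrow> add_mset c M - {#d#} = add_mset c (M - {#d#})"
  by (metis add_mset_commute add_mset_remove_trivial insert_DiffM)

lemma removal_add_mset:
  "removal y \<phi> (add_mset c M) = weight y c * \<phi> M + removal y (\<lambda>N. \<phi> (add_mset c N)) M"
proof -
  have "image_mset (\<lambda>d. weight y d * \<phi> (add_mset c M - {#d#})) M
      = image_mset (\<lambda>d. weight y d * \<phi> (add_mset c (M - {#d#}))) M"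
    by (intro image_mset_cong) (simp add: add_mset_minus_single)
  then show ?thesis
    by (simp add: removal_def)
qed

lemma removal_labels:
  "finite J \<Longrightarrow> removal y \<phi> (labels b J) = (\<Sum>i\<in>J. weight y (b i) * \<phi> (labels b (J - {i})))"
  unfolding removal_def multiset.map_comp sum_unfold_sum_mset[symmetric]
  by (auto simp: sum_unfold_sum_mset[symmetric] comp_def mset_set_Diff image_mset_Diff intro!: sum.cong)

definition remove_nth :: "nat \<Rightarrow> 'a list \<Rightarrow> 'a list" where
  "remove_nth j xs = take j xs @ drop (Suc j) xs"

lemma remove_nth_Cons [simp]:
  "remove_nth 0 (x # xs) = xs"
  "remove_nth (Suc j) (x # xs) = x # remove_nth j xs"
  by (simp_all add: remove_nth_def)

lemma removal_shapes:
  "removal y \<phi> (shapes ts) = (\<Sum>j<length ts. weight y (shape (ts ! j)) * \<phi> (shapes (remove_nth j ts)))"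
  by (induction ts arbitrary: \<phi>) (simp_all add: removal_add_mset sum.lessThan_Suc_shift del: sum.lessThan_Suc)

lemma sum_Pow_swap:
  assumes "finite J"
  shows "(\<Sum>A\<in>Pow J. \<Sum>i\<in>J - A. g i A) = (\<Sum>i\<in>J. \<Sum>A\<in>Pow (J - {i}). g i A)"
proof -
  have "(\<Sum>A\<in>Pow J. \<Sum>i\<in>J - A. g i A) = (\<Sum>(A, i)\<in>(SIGMA A:Pow J. J - A). g i A)"
    using assms by (subst sum.Sigma) auto
  also have "\<dots> = (\<Sum>(i, A)\<in>(SIGMA i:J. Pow (J - {i})). g i A)"
    by (rule sum.reindex_bij_witness[where i = prod.swap and j = prod.swap]) auto
  also have "\<dots> = (\<Sum>i\<in>J. \<Sum>A\<in>Pow (J - {i}). g i A)"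
    using assms by (subst sum.Sigma) auto
  finally show ?thesis .
qed

lemma graft_sum_Cons_diff:
  assumes "finite J"
  shows "(\<Sum>A\<in>Pow J. \<Sum>f\<in>A \<rightarrow>\<^sub>E vertices T. \<Sum>i\<in>J - A.
           w i * graft_sum (\<lambda>M. \<phi> (add_mset (graft T (fibre b A f)) M)) ts (J - A - {i}) b)
       = (\<Sum>i\<in>J. w i * graft_sum \<phi> (T # ts) (J - {i}) b)"
proof -
  have "J - {i} - A = J - A - {i}" for A i
    by auto
  then have "(\<Sum>i\<in>J. w i * graft_sum \<phi> (T # ts) (J - {i}) b) =
     (\<Sum>i\<in>J. \<Sum>A\<in>Pow (J - {i}). \<Sum>f\<in>A \<rightarrow>\<^sub>E vertices T.
        w i * graft_sum (\<lambda>M. \<phi> (add_mset (graft T (fibre b A f)) M)) ts (J - A - {i}) b)"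
    using assms by (simp add: graft_sum_Cons sum_distrib_left)
  also have "\<dots> = (\<Sum>A\<in>Pow J. \<Sum>i\<in>J - A. \<Sum>f\<in>A \<rightarrow>\<^sub>E vertices T.
        w i * graft_sum (\<lambda>M. \<phi> (add_mset (graft T (fibre b A f)) M)) ts (J - A - {i}) b)"
    using assms by (rule sum_Pow_swap[symmetric])
  also have "\<dots> = (\<Sum>A\<in>Pow J. \<Sum>f\<in>A \<rightarrow>\<^sub>E vertices T. \<Sum>i\<in>J - A.
        w i * graft_sum (\<lambda>M. \<phi> (add_mset (graft T (fibre b A f)) M)) ts (J - A - {i}) b)"
    by (intro sum.cong refl sum.swap)
  finally show ?thesis ..
qed

text \<open>The removed branch of a grafted tree is either a label joined to the root, which gives
  the first sum, or the \<open>j\<close>-th old branch with all that was grafted into it. By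
  \<open>sum_weight_graft\<close> the latter counts only if it received nothing or a single label
  \<open>i\<close>; these are the two summands of the second sum.\<close>

lemma graft_sum_removal:
  "finite J \<Longrightarrow> graft_sum (removal y \<phi>) ts J b =
     (\<Sum>i\<in>J. weight y (b i) * graft_sum \<phi> ts (J - {i}) b)
   + (\<Sum>j<length ts. weight y (shape (ts ! j)) * (graft_sum \<phi> (remove_nth j ts) J b
        + (\<Sum>i\<in>J. weight y (b i) * graft_sum \<phi> (remove_nth j ts) (J - {i}) b)))"
proof (induction ts arbitrary: \<phi> J)
  case Nil
  then show ?case
    by (simp add: removal_labels)
next
  case (Cons T ts)
  let ?\<phi> = "\<lambda>A f M. \<phi> (add_mset (graft T (fibre b A f)) M)"
  let ?w = "\<lambda>i. weight y (b i)" and ?u = "\<lambda>j. weight y (shape (ts ! j))"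
  have "graft_sum (removal y \<phi>) (T # ts) J b =
     (\<Sum>A\<in>Pow J. \<Sum>f\<in>A \<rightarrow>\<^sub>E vertices T. weight y (graft T (fibre b A f)) * graft_sum \<phi> ts (J - A) b)
   + (\<Sum>A\<in>Pow J. \<Sum>f\<in>A \<rightarrow>\<^sub>E vertices T. graft_sum (removal y (?\<phi> A f)) ts (J - A) b)"
    using Cons.prems
    by (simp add: graft_sum_Cons removal_add_mset graft_sum_add graft_sum_scale sum.distrib)
  also have "(\<Sum>A\<in>Pow J. \<Sum>f\<in>A \<rightarrow>\<^sub>E vertices T. weight y (graft T (fibre b A f)) * graft_sum \<phi> ts (J - A) b)
     = (\<Sum>A\<in>Pow J. weight y (shape T) * (small_weight y (labels b A) * graft_sum \<phi> ts (J - A) b))"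
    using Cons.prems
    by (intro sum.cong) (auto simp: sum_distrib_right[symmetric] sum_weight_graft finite_subset)
  also have "\<dots> = weight y (shape T) * (graft_sum \<phi> ts J b + (\<Sum>i\<in>J. ?w i * graft_sum \<phi> ts (J - {i}) b))"
    using Cons.prems sum_Pow_small_weight[of J y b "\<lambda>A. graft_sum \<phi> ts (J - A) b"]
    by (simp add: sum_distrib_left[symmetric])
  \<comment> \<open>Here the removed branch lies in \<open>ts\<close>; the induction hypothesis is
    used for the functional in which the grafted \<open>T\<close> is a fixed further branch.\<close>
  also have "(\<Sum>A\<in>Pow J. \<Sum>f\<in>A \<rightarrow>\<^sub>E vertices T. graft_sum (removal y (?\<phi> A f)) ts (J - A) b)
     = (\<Sum>A\<in>Pow J. \<Sum>f\<in>A \<rightarrow>\<^sub>E vertices T. (\<Sum>i\<in>J - A. ?w i * graft_sum (?\<phi> A f) ts (J - A - {i}) b)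
        + (\<Sum>j<length ts. ?u j * (graft_sum (?\<phi> A f) (remove_nth j ts) (J - A) b
            + (\<Sum>i\<in>J - A. ?w i * graft_sum (?\<phi> A f) (remove_nth j ts) (J - A - {i}) b))))"
    using Cons.prems by (intro sum.cong refl Cons.IH) auto
  also have "\<dots> = (\<Sum>A\<in>Pow J. \<Sum>f\<in>A \<rightarrow>\<^sub>E vertices T. \<Sum>i\<in>J - A. ?w i * graft_sum (?\<phi> A f) ts (J - A - {i}) b)
        + (\<Sum>j<length ts. \<Sum>A\<in>Pow J. \<Sum>f\<in>A \<rightarrow>\<^sub>E vertices T. ?u j * (graft_sum (?\<phi> A f) (remove_nth j ts) (J - A) b
            + (\<Sum>i\<in>J - A. ?w i * graft_sum (?\<phi> A f) (remove_nth j ts) (J - A - {i}) b)))"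
    unfolding sum.distrib
    by (subst (2) sum.swap, subst (5) sum.swap) (rule refl)
  also have "(\<Sum>A\<in>Pow J. \<Sum>f\<in>A \<rightarrow>\<^sub>E vertices T. \<Sum>i\<in>J - A. ?w i * graft_sum (?\<phi> A f) ts (J - A - {i}) b)
     = (\<Sum>i\<in>J. ?w i * graft_sum \<phi> (T # ts) (J - {i}) b)"
    using Cons.prems by (rule graft_sum_Cons_diff)
  also have "(\<Sum>j<length ts. \<Sum>A\<in>Pow J. \<Sum>f\<in>A \<rightarrow>\<^sub>E vertices T. ?u j * (graft_sum (?\<phi> A f) (remove_nth j ts) (J - A) b
            + (\<Sum>i\<in>J - A. ?w i * graft_sum (?\<phi> A f) (remove_nth j ts) (J - A - {i}) b)))
     = (\<Sum>j<length ts. ?u j * (graft_sum \<phi> (T # remove_nth j ts) J b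
            + (\<Sum>i\<in>J. ?w i * graft_sum \<phi> (T # remove_nth j ts) (J - {i}) b)))"
    using Cons.prems
    by (simp add: sum_distrib_left[symmetric] sum.distrib graft_sum_Cons[of J]
        graft_sum_Cons_diff[where \<phi> = \<phi> and w = ?w and b = b])
  finally show ?case
    by (simp add: sum.lessThan_Suc_shift del: sum.lessThan_Suc)
qed


text \<open>The right side of \<open>graft_sum_removal\<close>, together with the term where no
  branch is removed, is the expansion of the product: a branch is removed from neither factor, from
  the labels, from \<open>shapes ts\<close>, or from both. In the last case the two removed branches
  form a single branch of the grafted tree.\<close>

lemma graft_multiplicative_add_removal:
  assumes "graft_multiplicative \<phi>"
  shows "graft_multiplicative (\<lambda>M. \<phi> M + removal y \<phi> M)"
  unfolding graft_multiplicative_def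
proof (intro allI impI)
  fix ts and J :: "nat set" and b :: "nat \<Rightarrow> rtree"
  assume J: "finite J"
  have "graft_sum \<phi> us K b = \<phi> (labels b K) * \<phi> (shapes us)" if "K \<subseteq> J" for us and K :: "nat set"
    using assms finite_subset[OF that J] by (auto simp: graft_multiplicative_def)
  then have "graft_sum (\<lambda>M. \<phi> M + removal y \<phi> M) ts J b =
      \<phi> (labels b J) * \<phi> (shapes ts)
    + (\<Sum>i\<in>J. weight y (b i) * \<phi> (labels b (J - {i}))) * \<phi> (shapes ts)
    + (\<Sum>j<length ts. weight y (shape (ts ! j)) * \<phi> (shapes (remove_nth j ts)))
        * (\<phi> (labels b J) + (\<Sum>i\<in>J. weight y (b i) * \<phi> (labels b (J - {i}))))"
    using J by (simp add: graft_sum_add graft_sum_removal sum_distrib_left sum_distrib_right algebra_simps sum.distrib)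
  also have "\<dots> = (\<phi> (labels b J) + removal y \<phi> (labels b J)) * (\<phi> (shapes ts) + removal y \<phi> (shapes ts))"
    unfolding removal_shapes removal_labels[OF J] by (simp add: algebra_simps)
  finally show "graft_sum (\<lambda>M. \<phi> M + removal y \<phi> M) ts J b =
    (\<phi> (labels b J) + removal y \<phi> (labels b J)) * (\<phi> (shapes ts) + removal y \<phi> (shapes ts))" .
qed

text \<open>\<open>finite_char (y # ys)\<close> is the convolution of \<open>finite_char ys\<close> with the character that maps the chain
  with \<open>m + 1\<close> vertices to \<open>y\<^sup>m\<close> and all other trees to \<open>0\<close>. In both, a tree is given by its branches.\<close>

primrec finite_char :: "real list \<Rightarrow> rtree multiset \<Rightarrow> real" where
  "finite_char [] = (\<lambda>M. if M = {#} then 1 else 0)"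
| "finite_char (y # ys) = (\<lambda>M. finite_char ys M + removal y (finite_char ys) M)"

lemma graft_sum_zero: "(\<And>M. \<phi> M = 0) \<Longrightarrow> graft_sum \<phi> ts J b = 0"
  by (simp add: graft_sum_def)

lemma graft_multiplicative_finite_char: "graft_multiplicative (finite_char ys)"
proof (induction ys)
  case Nil
  have "graft_sum (finite_char []) ts J b = finite_char [] (labels b J) * finite_char [] (shapes ts)"
    if "finite J" for ts J b
    using that by (cases ts) (auto simp: graft_sum_Cons graft_sum_zero)
  then show ?case
    unfolding graft_multiplicative_def by blast
next
  case (Cons y ys)
  then show ?case
    unfolding finite_char.simps by (rule graft_multiplicative_add_removal)
qed

lemma finite_char_empty [simp]: "finite_char ys {#} = 1"
  by (induction ys) auto

lemma sum_mset_nonneg_real: "(\<And>x. x \<in># M \<Longrightarrow> 0 \<le> g x) \<Longrightarrow> 0 \<le> (\<Sum>x\<in>#M. g x :: real)"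
  by (induction M) auto

lemma finite_char_nonneg: "(\<And>y. y \<in> set ys \<Longrightarrow> 0 \<le> y) \<Longrightarrow> 0 \<le> finite_char ys M"
proof (induction ys arbitrary: M)
  case (Cons y ys)
  have "0 \<le> (\<Sum>c\<in>#M. weight y c * finite_char ys (M - {#c#}))"
    using Cons by (intro sum_mset_nonneg_real) (auto simp: weight_def)
  then show ?case
    using Cons by (simp add: removal_def)
qed auto

lemma finite_char_eq_0: "c \<in># M \<Longrightarrow> \<not> chainlike c \<Longrightarrow> finite_char ys M = 0"
proof (induction ys arbitrary: M)
  case (Cons y ys)
  have "weight y d * finite_char ys (M - {#d#}) = 0" if "d \<in># M" for d
  proof (cases "c = d")
    case False
    then show ?thesis
      using Cons.IH[of "M - {#d#}"] Cons.prems by (simp add: in_diff_count)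
  qed (use Cons in \<open>simp add: weight_def\<close>)
  then have "image_mset (\<lambda>d. weight y d * finite_char ys (M - {#d#})) M = image_mset (\<lambda>d. 0) M"
    by (intro image_mset_cong) auto
  then have "removal y (finite_char ys) M = 0"
    unfolding removal_def by simp
  then show ?case
    using Cons by simp
qed auto

lemma finite_char_chain: "0 < k \<Longrightarrow> finite_char ys {#chain k#} = (\<Sum>y\<leftarrow>ys. y ^ k)"
  by (induction ys) (simp_all add: removal_def weight_def nverts_chain)

text \<open>Only grafting at the leaf turns a chain into a chain.\<close>

lemma sum_graft_chainlike:
  assumes "chainlike (shape T)" "chainlike c" "b 0 = c" "\<And>d. \<not> chainlike d \<Longrightarrow> g d = 0"
  shows "(\<Sum>f \<in> {0} \<rightarrow>\<^sub>E vertices T. g (graft T (fibre b {0} f)))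
    = (g (chain (nverts (shape T) + nverts c)) :: real)"
  using assms(1,4)
proof (induction T arbitrary: g)
  case (PNode ts)
  consider "ts = []" | T where "ts = [T]" | T T' ts' where "ts = T # T' # ts'"
    by (cases ts rule: list.exhaust; cases "tl ts" rule: list.exhaust; simp)
  then show ?case
  proof cases
    case 1
    have "Node {#c#} = chain (Suc (nverts c))"
      using chainlike_eq_chain[OF \<open>chainlike c\<close>] Node_chain[of "nverts c"] by simp
    then show ?thesis
      unfolding graft_sum_tree using 1 assms(3) by simp
  next
    case 2
    have "(\<Sum>f \<in> {0} \<rightarrow>\<^sub>E vertices T. g (Node {#graft T (fibre b {0} f)#}))
        = g (Node {#chain (nverts (shape T) + nverts c)#})"
      using PNode.prems 2 by (intro PNode.IH) auto
    moreover have "Node {#chain (nverts (shape T) + nverts c)#} = chain (Suc (nverts (shape T) + nverts c))"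
      by (intro Node_chain) simp
    moreover have "g (Node {#shape T, c#}) = 0"
      using PNode.prems by simp
    moreover have "Pow {0::nat} = {{}, {0}}"
      by auto
    ultimately show ?thesis
      unfolding graft_sum_tree using 2 assms(3) PNode.prems(2)
      by (simp add: graft_sum_Cons)
  next
    case 3
    then show ?thesis
      using PNode.prems by simp
  qed
qed

text \<open>The chain \<open>c\<close> survives at the root, as a branch of its own, or at the leaf
  of one branch \<open>d\<close>, which it lengthens. Every other grafting creates branching below
  the root, where \<phi> vanishes.\<close>

lemma graft_sum_chainlike:
  assumes "\<And>M c. c \<in># M \<Longrightarrow> \<not> chainlike c \<Longrightarrow> \<phi> M = 0"
    and "chainlike c" "b 0 = c" "\<And>d. d \<in># shapes ts \<Longrightarrow> chainlike d"
  shows "graft_sum \<phi> ts {0} b = \<phi> (add_mset c (shapes ts))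
    + (\<Sum>d\<in>#shapes ts. \<phi> (add_mset (chain (nverts d + nverts c)) (shapes ts - {#d#})))"
  using assms(1,4)
proof (induction ts arbitrary: \<phi>)
  case Nil
  then show ?case
    using assms(3) by simp
next
  case (Cons T ts)
  let ?d = "\<lambda>d. chain (nverts d + nverts c)"
  have IH: "graft_sum (\<lambda>M. \<phi> (add_mset (shape T) M)) ts {0} b = \<phi> (add_mset (shape T) (add_mset c (shapes ts)))
      + (\<Sum>d\<in>#shapes ts. \<phi> (add_mset (shape T) (add_mset (?d d) (shapes ts - {#d#}))))"
  proof (rule Cons.IH)
    fix M c assume "c \<in># M" "\<not> chainlike c"
    then show "\<phi> (add_mset (shape T) M) = 0"
      using Cons.prems(1)[of c "add_mset (shape T) M"] by simp
  qed (use Cons.prems in simp)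
  have "(\<Sum>f \<in> {0} \<rightarrow>\<^sub>E vertices T. \<phi> (add_mset (graft T (fibre b {0} f)) (shapes ts)))
      = \<phi> (add_mset (?d (shape T)) (shapes ts))"
    using Cons.prems(2) assms(2,3) by (intro sum_graft_chainlike Cons.prems(1)) auto
  moreover have "Pow {0::nat} = {{}, {0}}"
    by auto
  moreover have "image_mset (\<lambda>d. \<phi> (add_mset (shape T) (add_mset (?d d) (shapes ts - {#d#})))) (shapes ts)
     = image_mset (\<lambda>d. \<phi> (add_mset (?d d) (shapes (T # ts) - {#d#}))) (shapes ts)"
  proof (rule image_mset_cong)
    fix d assume "d \<in># shapes ts"
    then have "shapes (T # ts) - {#d#} = add_mset (shape T) (shapes ts - {#d#})"
      by (simp add: add_mset_minus_single del: mset_map)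
    then show "\<phi> (add_mset (shape T) (add_mset (?d d) (shapes ts - {#d#}))) =
        \<phi> (add_mset (?d d) (shapes (T # ts) - {#d#}))"
      by (simp only: add_mset_commute)
  qed
  moreover have "graft T (fibre b {} f) = shape T" for f
    by (rule graft_empty) (simp add: fibre_def)
  ultimately show ?case
    using IH by (simp add: graft_sum_Cons graft_sum_empty add_mset_commute)
qed

text \<open>The rule for the product of the \<open>k\<close>-th power sum and the augmented monomial symmetric function of \<open>\<mu>\<close>.\<close>

definition stuffle :: "(nat multiset \<Rightarrow> real) \<Rightarrow> bool" where
  "stuffle h \<longleftrightarrow> h {#} = 1 \<and> (\<forall>k \<mu>. 0 < k \<longrightarrow> int_partition \<mu> \<longrightarrow>
     h {#k#} * h \<mu> = h (add_mset k \<mu>) + (\<Sum>j\<in>#\<mu>. h (add_mset (j + k) (\<mu> - {#j#}))))"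

lemma graft_sum_path_forest:
  assumes "\<And>M c. c \<in># M \<Longrightarrow> \<not> chainlike c \<Longrightarrow> \<phi> M = 0"
    and "0 < k" "b 0 = chain k" "shapes ts = image_mset chain \<mu>" "int_partition \<mu>"
  shows "graft_sum \<phi> ts {0} b = \<phi> (image_mset chain (add_mset k \<mu>))
    + (\<Sum>j\<in>#\<mu>. \<phi> (image_mset chain (add_mset (j + k) (\<mu> - {#j#}))))"
proof -
  have "image_mset (\<lambda>j. \<phi> (add_mset (chain (nverts (chain j) + nverts (chain k))) (image_mset chain \<mu> - {#chain j#}))) \<mu>
    = image_mset (\<lambda>j. \<phi> (image_mset chain (add_mset (j + k) (\<mu> - {#j#})))) \<mu>"
  proof (rule image_mset_cong)
    fix j assume j: "j \<in># \<mu>"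
    then have "0 < j"
      using assms(5) by (auto simp: int_partition_def intro: gr0I)
    then show "\<phi> (add_mset (chain (nverts (chain j) + nverts (chain k))) (image_mset chain \<mu> - {#chain j#}))
        = \<phi> (image_mset chain (add_mset (j + k) (\<mu> - {#j#})))"
      using j assms(2) by (simp add: nverts_chain image_mset_Diff)
  qed
  moreover have "graft_sum \<phi> ts {0} b = \<phi> (add_mset (chain k) (shapes ts))
    + (\<Sum>d\<in>#shapes ts. \<phi> (add_mset (chain (nverts d + nverts (chain k))) (shapes ts - {#d#})))"
    using assms by (intro graft_sum_chainlike) auto
  ultimately show ?thesis
    unfolding assms(4) by (simp add: multiset.map_comp comp_def)
qed

lemma ex_ptrees: "\<exists>ts. shapes ts = M"
proof -
  obtain xs where "mset xs = M"
    using ex_mset by blast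
  then have "shapes (map plane xs) = M"
    by (simp add: comp_def shape_plane)
  then show ?thesis ..
qed

lemma stuffle_finite_char: "stuffle (\<lambda>\<mu>. finite_char ys (image_mset chain \<mu>))"
proof -
  have "finite_char ys {#chain k#} * finite_char ys (image_mset chain \<mu>) =
    finite_char ys (image_mset chain (add_mset k \<mu>))
    + (\<Sum>j\<in>#\<mu>. finite_char ys (image_mset chain (add_mset (j + k) (\<mu> - {#j#}))))"
    if "0 < k" "int_partition \<mu>" for k \<mu>
  proof -
    obtain ts where ts: "shapes ts = image_mset chain \<mu>"
      using ex_ptrees by blast
    have "graft_sum (finite_char ys) ts {0} (\<lambda>_. chain k) = finite_char ys {#chain k#} * finite_char ys (shapes ts)"
      using graft_multiplicative_finite_char[of ys] by (simp add: graft_multiplicative_def)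
    moreover have "graft_sum (finite_char ys) ts {0} (\<lambda>_. chain k) =
        finite_char ys (image_mset chain (add_mset k \<mu>))
        + (\<Sum>j\<in>#\<mu>. finite_char ys (image_mset chain (add_mset (j + k) (\<mu> - {#j#}))))"
      using that ts by (intro graft_sum_path_forest finite_char_eq_0) auto
    ultimately show ?thesis
      unfolding ts by argo
  qed
  then show ?thesis
    by (simp add: stuffle_def)
qed

section \<open>Linear functionals on the tree basis\<close>

lemma lookup_scaleR: "Poly_Mapping.lookup (r *\<^sub>R x) t = r *\<^sub>R Poly_Mapping.lookup x t"
  unfolding scaleR_poly_mapping_def
  by (subst Abs_poly_mapping_inverse)
    (auto intro: finite_subset[OF _ finite_keys[of x]] simp: in_keys_iff)

lemma linear_gl:
  assumes "linear \<psi>"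
  shows "\<psi> x = (\<Sum>t \<in> Poly_Mapping.keys x. Poly_Mapping.lookup x t * \<psi> (F t))"
proof -
  have "x = (\<Sum>t \<in> Poly_Mapping.keys x. Poly_Mapping.lookup x t *\<^sub>R F t)"
    by (rule poly_mapping_eqI)
      (auto simp: F_def lookup_sum lookup_scaleR lookup_single when_def in_keys_iff sum.delta
        if_distrib[of "\<lambda>r. _ * r"] cong: if_cong)
  then have "\<psi> x = \<psi> (\<Sum>t \<in> Poly_Mapping.keys x. Poly_Mapping.lookup x t *\<^sub>R F t)"
    by simp
  also have "\<dots> = (\<Sum>t \<in> Poly_Mapping.keys x. Poly_Mapping.lookup x t * \<psi> (F t))"
    using assms by (simp add: linear_sum linear_cmul)
  finally show ?thesis .
qed

lemma F_mult: "F s \<star> F t = gl_tree_mult s t"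
  by (simp add: gl_mult_def F_def)

lemma linear_gl_tree_mult:
  assumes "linear \<psi>" "plane t = PNode ts"
  shows "\<psi> (gl_tree_mult s t) = graft_sum (\<lambda>M. \<psi> (F (Node M))) ts {..<length (branch_list s)} ((!) (branch_list s))"
  using assms
  by (simp add: gl_tree_mult_def Let_def linear_sum graft_sum_def fibre_def del: vertices.simps graft.simps)
    (simp add: fibre_def)

section \<open>Vanishing off path forests\<close>

lemma labels_nth: "labels ((!) xs) {..<length xs} = mset xs"
proof -
  have "labels ((!) xs) {..<length xs} = mset (map ((!) xs) [0..<length xs])"
    by (simp add: atLeast0LessThan)
  then show ?thesis
    by (simp add: map_nth)
qed

lemma labels_split:
  assumes "finite J" "labels b J = X + Y"
  obtains A where "A \<subseteq> J" "labels b A = X" "labels b (J - A) = Y"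
proof -
  obtain B C where BC: "mset_set J = B + C" "image_mset b B = X" "image_mset b C = Y"
    using image_mset_eq_plusD[OF assms(2)] by blast
  have B: "B = mset_set (set_mset B)"
  proof (rule multiset_eqI)
    fix i
    have "count B i \<le> 1"
      using arg_cong[OF BC(1), of "\<lambda>M. count M i"] by (cases "i \<in> J") (auto simp: assms(1) count_mset_set')
    then show "count B i = count (mset_set (set_mset B)) i"
      by (cases "i \<in># B") (auto simp: not_in_iff dest: count_inI intro: le_antisym)
  qed
  have "set_mset B \<subseteq> J"
    using arg_cong[OF BC(1), of set_mset] assms(1) by auto
  moreover from this have "mset_set (J - set_mset B) = C"
    using BC(1) B assms(1) by (metis add_diff_cancel_left' finite_subset mset_set_Diff)
  ultimately show ?thesis
    using that[of "set_mset B"] B BC by metis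
qed

text \<open>Equal branches are distinct occurrences in the product, so a distribution given by
  multisets has to be lifted to indices. Hence every tree obtained by distributing the branches of
  the left factor is a term of the product.\<close>

lemma ex_fibre:
  assumes "finite V" "finite J" "labels b J = (\<Sum>v\<in>V. g v)"
  shows "\<exists>f \<in> J \<rightarrow>\<^sub>E V. \<forall>v\<in>V. fibre b J f v = g v"
  using assms
proof (induction V arbitrary: J)
  case empty
  then have "J = {}"
    by (simp add: mset_set_empty_iff)
  then show ?case
    by auto
next
  case (insert v V)
  obtain A where A: "A \<subseteq> J" "labels b A = g v" "labels b (J - A) = (\<Sum>v\<in>V. g v)"
    by (rule labels_split[of J b "g v" "\<Sum>v\<in>V. g v"]) (use insert in auto)
  then obtain f where f: "f \<in> (J - A) \<rightarrow>\<^sub>E V" "\<And>u. u \<in> V \<Longrightarrow> fibre b (J - A) f u = g u"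
    using insert.IH[of "J - A"] insert.prems by blast
  let ?f = "\<lambda>i. if i \<in> A then v else f i"
  have "?f \<in> J \<rightarrow>\<^sub>E insert v V"
    using f(1) A(1) by (auto simp: PiE_def extensional_def Pi_def)
  moreover have "{i \<in> J. ?f i = v} = A"
    using f(1) A(1) insert.hyps(2) by auto
  moreover have "{i \<in> J. ?f i = u} = {i \<in> J - A. f i = u}" if "u \<in> V" for u
    using that insert.hyps(2) by auto
  ultimately have "\<forall>u\<in>insert v V. fibre b J ?f u = g u"
    using f(2) A(2) by (auto simp: fibre_def)
  with \<open>?f \<in> J \<rightarrow>\<^sub>E insert v V\<close> show ?case
    by blast
qed

lemma vertices_PNode_Nil [simp]: "[] \<in> vertices T"
  by (cases T) auto

lemma character_graft_sum:
  assumes "character \<psi>" "plane t = PNode ts"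
  shows "graft_sum (\<lambda>M. \<psi> (F (Node M))) ts {..<length (branch_list s)} ((!) (branch_list s))
    = \<psi> (F s) * \<psi> (F t)"
  using assms linear_gl_tree_mult[of \<psi> t ts s] by (simp add: character_def F_mult[symmetric])

lemma graft_cong: "(\<And>v. v \<in> vertices T \<Longrightarrow> g v = g' v) \<Longrightarrow> graft T g = graft T g'"
proof (induction T arbitrary: g g')
  case (PNode ts)
  have "graft (ts ! i) (\<lambda>v. g (i # v)) = graft (ts ! i) (\<lambda>v. g' (i # v))" if "i < length ts" for i
    using that PNode.prems by (intro PNode.IH) auto
  then have "map (\<lambda>i. graft (ts ! i) (\<lambda>v. g (i # v))) [0..<length ts]
      = map (\<lambda>i. graft (ts ! i) (\<lambda>v. g' (i # v))) [0..<length ts]"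
    by simp
  moreover have "g [] = g' []"
    using PNode.prems by simp
  ultimately show ?case
    by (simp only: graft.simps)
qed

lemma plane_eq_PNode: "plane (Node B) = PNode ts \<Longrightarrow> shapes ts = B"
  using shape_plane[of "Node B"] by simp

text \<open>\<open>g\<close> describes one particular term of the product by what each vertex in
  \<open>V\<close> receives, all other vertices receiving nothing. That term is killed, being a
  summand of a vanishing sum of nonnegative numbers.\<close>

lemma character_vanishes_graft:
  assumes "character \<psi>" "basis_positive \<psi>" "\<psi> (F s) = 0 \<or> \<psi> (F t) = 0"
    and V: "V \<subseteq> vertices (plane t)" and g: "branches s = (\<Sum>v\<in>V. g v)"
  shows "\<psi> (F (graft (plane t) (\<lambda>v. if v \<in> V then g v else {#}))) = 0"
proof -
  obtain ts where ts: "plane t = PNode ts"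
    by (cases "plane t")
  let ?ss = "branch_list s"
  have "finite V"
    using V finite_vertices finite_subset by blast
  then obtain f where f: "f \<in> {..<length ?ss} \<rightarrow>\<^sub>E V"
    "\<And>v. v \<in> V \<Longrightarrow> fibre ((!) ?ss) {..<length ?ss} f v = g v"
    using ex_fibre[of V "{..<length ?ss}" "(!) ?ss" g] g by (auto simp: labels_nth mset_branch_list)
  have "graft_sum (\<lambda>M. \<psi> (F (Node M))) ts {..<length ?ss} ((!) ?ss) = 0"
    using character_graft_sum[OF assms(1) ts, of s] assms(3) by auto
  moreover have "f \<in> {..<length ?ss} \<rightarrow>\<^sub>E vertices (PNode ts)"
    using f(1) V ts by (auto simp: PiE_def Pi_def)
  moreover have "\<forall>f \<in> {..<length ?ss} \<rightarrow>\<^sub>E vertices (PNode ts).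
      0 \<le> \<psi> (F (Node (branches (graft (PNode ts) (fibre ((!) ?ss) {..<length ?ss} f)))))"
    using assms(2) by (simp add: basis_positive_def)
  ultimately have "\<psi> (F (Node (branches (graft (PNode ts) (fibre ((!) ?ss) {..<length ?ss} f))))) = 0"
    unfolding graft_sum_def
    by (subst (asm) sum_nonneg_eq_0_iff) (auto intro!: finite_PiE simp del: vertices.simps)
  moreover have "fibre ((!) ?ss) {..<length ?ss} f v = (if v \<in> V then g v else {#})" for v
  proof (cases "v \<in> V")
    case False
    then have "{i \<in> {..<length ?ss}. f i = v} = {}"
      using f(1) by auto
    then have "fibre ((!) ?ss) {..<length ?ss} f v = {#}"
      unfolding fibre_def by (simp only: mset_set.empty image_mset_empty)
    then show ?thesis
      using False by simp
  qed (use f in simp)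
  ultimately show ?thesis
    unfolding ts by (simp add: fun_eq_iff[symmetric] cong: graft_cong)
qed

lemma character_vanishes_root:
  assumes "character \<psi>" "basis_positive \<psi>" "\<psi> (F (Node B)) = 0"
  shows "\<psi> (F (Node (B + N))) = 0"
proof -
  obtain ts where ts: "plane (Node B) = PNode ts"
    by (cases "plane (Node B)")
  have "\<psi> (F (graft (plane (Node B)) (\<lambda>v. if v \<in> {[]} then N else {#}))) = 0"
    by (rule character_vanishes_graft[of \<psi> "Node N"]) (use assms in auto)
  moreover have "map (\<lambda>i. graft (ts ! i) (\<lambda>v. {#})) [0..<length ts] = map shape ts"
    by (intro nth_equalityI) (auto intro: graft_empty)
  ultimately show ?thesis
    using plane_eq_PNode[OF ts] unfolding ts by simp
qed

lemma plane_singleton: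
  obtains T where "plane (Node {#d#}) = PNode [T]" "shape T = d"
proof -
  obtain ts where ts: "plane (Node {#d#}) = PNode ts"
    by (cases "plane (Node {#d#})")
  then have "mset (map shape ts) = {#d#}"
    by (rule plane_eq_PNode)
  then have "map shape ts = [d]"
    by (simp only: mset_single_iff)
  then show ?thesis
    using that ts by auto
qed

text \<open>All branches of \<open>s\<close> are joined to the only child of the root, whose address
  is \<open>[0]\<close>. The killed factor may stand on either side; both cases occur in climbing
  from a subtree to the root.\<close>

lemma character_vanishes_child:
  assumes "character \<psi>" "basis_positive \<psi>"
    "\<psi> (F s) = 0 \<or> \<psi> (F (Node {#Node B#})) = 0" "branches s = N"
  shows "\<psi> (F (Node {#Node (B + N)#})) = 0"
proof -
  obtain T where T: "plane (Node {#Node B#}) = PNode [T]" "shape T = Node B"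
    by (rule plane_singleton)
  obtain ts where ts: "T = PNode ts"
    by (cases T)
  have "\<psi> (F (graft (plane (Node {#Node B#})) (\<lambda>v. if v \<in> {[0]} then N else {#}))) = 0"
    by (rule character_vanishes_graft[of \<psi> s]) (use assms T in auto)
  moreover have "map (\<lambda>i. graft (ts ! i) (\<lambda>v. {#})) [0..<length ts] = map shape ts"
    by (intro nth_equalityI) (auto intro: graft_empty)
  ultimately show ?thesis
    using T unfolding ts by simp
qed

section \<open>Small trees and the commutator\<close>

lemma shape_eq_bullet [simp]: "shape T = Node {#} \<longleftrightarrow> T = PNode []"
  by (cases T) auto

lemma map_eq_two: "map f xs = [a, b] \<longleftrightarrow> (\<exists>x y. xs = [x, y] \<and> f x = a \<and> f y = b)"
  by (auto simp: map_eq_Cons_conv)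

lemma mset_eq_twice: "mset xs = {#a, a#} \<longleftrightarrow> xs = [a, a]"
proof
  assume xs: "mset xs = {#a, a#}"
  have "xs = replicate 2 a"
  proof (rule replicate_eqI)
    show "length xs = 2"
      using arg_cong[OF xs, of size] by simp
    show "y = a" if "y \<in> set xs" for y
      using arg_cong[OF xs, of set_mset] that by auto
  qed
  then show "xs = [a, a]"
    by (simp add: numeral_2_eq_2)
qed simp

abbreviation cherry :: rtree where
  "cherry \<equiv> Node {#bullet, bullet#}"

lemma shape_eq_cherry: "shape T = cherry \<longleftrightarrow> T = PNode [PNode [], PNode []]"
proof (cases T)
  case (PNode ts)
  have "shape T = cherry \<longleftrightarrow> mset (map shape ts) = {#bullet, bullet#}"
    using PNode by simp
  also have "\<dots> \<longleftrightarrow> ts = [PNode [], PNode []]"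
    unfolding mset_eq_twice map_eq_two by (auto simp: bullet_def)
  finally show ?thesis
    using PNode by simp
qed

lemma graft_sum_Cons_bullet:
  assumes "finite J"
  shows "graft_sum \<phi> (PNode [] # ts) J b =
    (\<Sum>A \<in> Pow J. graft_sum (\<lambda>M. \<phi> (add_mset (Node (labels b A)) M)) ts (J - A) b)"
proof -
  have "(\<Sum>f \<in> A \<rightarrow>\<^sub>E vertices (PNode []).
       graft_sum (\<lambda>M. \<phi> (add_mset (graft (PNode []) (fibre b A f)) M)) ts (J - A) b)
     = graft_sum (\<lambda>M. \<phi> (add_mset (Node (labels b A)) M)) ts (J - A) b" for A
  proof -
    have "{i \<in> A. f i = []} = A" if "f \<in> A \<rightarrow>\<^sub>E {[]}" for f :: "nat \<Rightarrow> nat list"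
      using that by auto
    then show ?thesis
      by (simp add: PiE_singleton fibre_def)
  qed
  then show ?thesis
    using assms by (simp only: graft_sum_Cons)
qed

lemma tau_eq: "tau = Node {#bullet#}"
  by (simp add: numeral_2_eq_2)

lemma branch_list_singleton: "branch_list (Node {#c#}) = [c]"
  using mset_branch_list[of "Node {#c#}"] by (simp only: rtree.sel mset_single_iff)

text \<open>The tree in question is the commutator of \<open>F cherry\<close> and \<open>F tau\<close>.\<close>

lemma character_cherry:
  assumes "character \<psi>"
  shows "\<psi> (F (Node {#cherry#})) = 0"
proof -
  let ?\<phi> = "\<lambda>M. \<psi> (F (Node M))"
  obtain T where "plane (Node {#bullet#}) = PNode [T]" "shape T = bullet"
    by (rule plane_singleton)
  then have "plane tau = PNode [PNode []]"
    unfolding tau_eq by (simp add: bullet_def)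
  then have tau: "graft_sum ?\<phi> [PNode []] {..<length (branch_list s)} ((!) (branch_list s)) = \<psi> (F s) * \<psi> (F tau)" for s
    by (rule character_graft_sum[OF assms])
  have "plane cherry = PNode [PNode [], PNode []]"
    using shape_eq_cherry shape_plane by blast
  then have cherry: "graft_sum ?\<phi> [PNode [], PNode []] {..<length (branch_list s)} ((!) (branch_list s)) = \<psi> (F s) * \<psi> (F cherry)" for s
    by (rule character_graft_sum[OF assms])
  have "branch_list cherry = [bullet, bullet]"
    using mset_branch_list[of cherry] by (simp only: rtree.sel mset_eq_twice)
  moreover have "{..<length [bullet, bullet]} = {0, 1}" "{..<length [bullet]} = {0}"
    by auto
  moreover have 1: "Pow {0, Suc 0} = {{}, {0}, {Suc 0}, {0, Suc 0}}" "Pow {0::nat} = {{}, {0}}"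
    by auto
  ultimately have *: "graft_sum ?\<phi> [PNode []] {0, 1} ((!) [bullet, bullet])
     = graft_sum ?\<phi> [PNode [], PNode []] {0} ((!) [bullet])"
    using tau[of cherry] cherry[of tau] by (simp only: tau_eq branch_list_singleton mult.commute)
  \<comment> \<open>Of the four maps into the two vertices of \<open>tau\<close>, one puts both
    bullets at the root, two separate them, and one puts both at the leaf. The last one gives the
    only tree missing from the opposite product.\<close>
  have "graft_sum ?\<phi> [PNode []] {0, 1} ((!) [bullet, bullet])
     = ?\<phi> {#bullet, bullet, bullet#} + 2 * ?\<phi> {#bullet, tau#} + ?\<phi> {#cherry#}"
    by (simp add: graft_sum_Cons_bullet 1 tau_eq bullet_def[symmetric] add_mset_commute insert_Diff_if)
  moreover have "graft_sum ?\<phi> [PNode [], PNode []] {0} ((!) [bullet])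
     = ?\<phi> {#bullet, bullet, bullet#} + 2 * ?\<phi> {#bullet, tau#}"
    by (simp add: graft_sum_Cons_bullet 1 tau_eq bullet_def[symmetric] add_mset_commute insert_Diff_if)
  ultimately show ?thesis
    using * by simp
qed

text \<open>The tree arises from the killed tree \<open>Node {#cherry#}\<close>: two members
  \<open>x\<close> and \<open>y\<close> of \<open>M\<close> are grown from the leaves of the cherry,
  and the others are joined to the branching vertex. The left factor collects the branches needed
  for this.\<close>

lemma character_vanishes_fork:
  assumes "character \<psi>" "basis_positive \<psi>" "2 \<le> size M"
  shows "\<psi> (F (Node {#Node M#})) = 0"
proof -
  obtain x M' where "M = add_mset x M'"
    using assms(3) by (cases M) auto
  moreover obtain y N where "M' = add_mset y N"
    using assms(3) calculation by (cases M') auto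
  ultimately have M: "M = add_mset x (add_mset y N)"
    by simp
  obtain T where "plane (Node {#cherry#}) = PNode [T]" "shape T = cherry"
    by (rule plane_singleton)
  then have pl: "plane (Node {#cherry#}) = PNode [PNode [PNode [], PNode []]]"
    by (simp add: shape_eq_cherry)
  let ?g = "\<lambda>v. if v = [0] then N else if v = [0, 0] then branches x else branches y"
  let ?V = "{[0], [0, 0], [0, 1::nat]}"
  have "\<psi> (F (graft (plane (Node {#cherry#})) (\<lambda>v. if v \<in> ?V then ?g v else {#}))) = 0"
    by (rule character_vanishes_graft[of \<psi> "Node (branches x + branches y + N)"])
      (use assms pl character_cherry in \<open>auto simp: numeral_2_eq_2 lessThan_Suc add_ac\<close>)
  moreover have "graft (plane (Node {#cherry#})) (\<lambda>v. if v \<in> ?V then ?g v else {#}) = Node {#Node M#}"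
    unfolding pl M by (simp add: numeral_2_eq_2)
  ultimately show ?thesis
    by simp
qed

text \<open>Vanishing is carried upwards. If \<open>Node {#b#}\<close> is killed, grafting
  \<open>b\<close> onto the child in \<open>tau\<close> kills the tree with \<open>b\<close> one
  level deeper, and the remaining branches of \<open>t\<close> are then joined to the parent of
  \<open>b\<close>.\<close>

lemma character_vanishes_subtree:
  assumes "character \<psi>" "basis_positive \<psi>"
  shows "subtree u b \<Longrightarrow> 2 \<le> size (branches u) \<Longrightarrow> \<psi> (F (Node {#b#})) = 0"
proof (induction rule: subtree.induct)
  case (subtree_refl t)
  then show ?case
    using character_vanishes_fork[OF assms, of "branches t"] by simp
next
  case (subtree_branch b t u)
  then have "\<psi> (F (Node {#b#})) = 0"
    by simp
  then have "\<psi> (F (Node {#Node ({#} + {#b#})#})) = 0"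
    by (intro character_vanishes_child[OF assms, of "Node {#b#}"]) auto
  then have "\<psi> (F (Node {#Node ({#b#} + (branches t - {#b#}))#})) = 0"
    by (intro character_vanishes_child[OF assms, of "Node (branches t - {#b#})"]) auto
  then show ?case
    using subtree_branch.hyps by simp
qed

lemma character_vanishes:
  assumes "character \<psi>" "basis_positive \<psi>" "\<not> path_forest t"
  shows "\<psi> (F t) = 0"
proof -
  obtain b u where b: "b \<in># branches t" "subtree u b" "2 \<le> size (branches u)"
    using assms(3) by (auto simp: path_forest_def not_le)
  have "\<psi> (F (Node {#b#})) = 0"
    using character_vanishes_subtree[OF assms(1,2) b(2,3)] .
  then have "\<psi> (F (Node ({#b#} + (branches t - {#b#})))) = 0"
    by (rule character_vanishes_root[OF assms(1,2)])
  then show ?thesis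
    using b(1) by simp
qed

lemma character_vanishes_I_pf:
  assumes "character \<psi>" "basis_positive \<psi>" "x \<in> I_pf"
  shows "\<psi> x = 0"
proof -
  have "linear \<psi>"
    using assms(1) by (simp add: character_def)
  moreover have "x \<in> span {F t |t. \<not> path_forest t}"
    using assms(3) unfolding I_pf_def .
  moreover have "\<psi> y = 0" if y: "y \<in> {F t |t. \<not> path_forest t}" for y
  proof -
    obtain t where "y = F t" "\<not> path_forest t"
      using y by blast
    then show ?thesis
      using character_vanishes[OF assms(1,2)] by simp
  qed
  ultimately show ?thesis
    using linear_eq_0_on_span by blast
qed

lemma character_bullet_mult:
  assumes "character \<psi>"
  shows "\<psi> (F bullet) * \<psi> (F t) = \<psi> (F t)"
proof -
  obtain B ts where t: "t = Node B" "plane t = PNode ts"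
    by (metis ptree.exhaust rtree.exhaust)
  have "branch_list bullet = []"
    using mset_branch_list[of bullet] by (simp add: bullet_def)
  then show ?thesis
    using character_graft_sum[OF assms t(2), of bullet] plane_eq_PNode[OF t(2)[unfolded t(1)]] t(1)
    by (simp add: graft_sum_empty del: mset_map)
qed

lemma path_tree_single: "path_tree {#k#} = Node {#chain k#}"
  by (simp add: path_tree_def)

lemma stuffle_character:
  assumes "character \<psi>" "basis_positive \<psi>" "\<psi> (F bullet) = 1"
  shows "stuffle (\<lambda>\<mu>. \<psi> (F (path_tree \<mu>)))"
  unfolding stuffle_def
proof (intro conjI allI impI)
  show "\<psi> (F (path_tree {#})) = 1"
    using assms(3) by (simp add: path_tree_def bullet_def)
next
  fix k \<mu> assume k: "0 < (k::nat)" "int_partition \<mu>"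
  let ?\<phi> = "\<lambda>M. \<psi> (F (Node M))"
  obtain ts where ts: "plane (path_tree \<mu>) = PNode ts"
    by (cases "plane (path_tree \<mu>)")
  then have shapes: "shapes ts = image_mset chain \<mu>"
    unfolding path_tree_def by (rule plane_eq_PNode)
  have zero: "?\<phi> M = 0" if "c \<in># M" "\<not> chainlike c" for c M
    using that assms by (intro character_vanishes) (auto simp: path_forest_Node)
  have "{..<length [chain k]} = {0}"
    by auto
  then have "\<psi> (F (path_tree {#k#})) * \<psi> (F (path_tree \<mu>)) = graft_sum ?\<phi> ts {0} ((!) [chain k])"
    using character_graft_sum[OF assms(1) ts, of "path_tree {#k#}"]
    by (simp only: path_tree_single branch_list_singleton)
  also have "\<dots> = ?\<phi> (image_mset chain (add_mset k \<mu>))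
      + (\<Sum>j\<in>#\<mu>. ?\<phi> (image_mset chain (add_mset (j + k) (\<mu> - {#j#}))))"
    using k shapes by (intro graft_sum_path_forest) (auto intro: zero)
  finally show "\<psi> (F (path_tree {#k#})) * \<psi> (F (path_tree \<mu>)) = \<psi> (F (path_tree (add_mset k \<mu>)))
      + (\<Sum>j\<in>#\<mu>. \<psi> (F (path_tree (add_mset (j + k) (\<mu> - {#j#})))))"
    by (simp add: path_tree_def)
qed

section \<open>Evaluating symmetric functions\<close>

definition vars_support :: "nat \<Rightarrow> series \<Rightarrow> (nat \<Rightarrow>\<^sub>0 nat) set" where
  "vars_support N f = {\<alpha>. Poly_Mapping.keys \<alpha> \<subseteq> {..<N} \<and> f \<alpha> \<noteq> 0}"

definition monom_eval :: "nat \<Rightarrow> (nat \<Rightarrow> real) \<Rightarrow> (nat \<Rightarrow>\<^sub>0 nat) \<Rightarrow> real" where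
  "monom_eval N x \<alpha> = (\<Prod>i<N. x i ^ Poly_Mapping.lookup \<alpha> i)"

text \<open>The substitution of \<open>x\<close> for the first \<open>N\<close> variables and of 0
  for the others. It is meaningful on \<open>Sym\<close>, where \<open>finite_vars_support\<close>
  leaves finitely many monomials; a sum over an infinite support would be 0 by convention.\<close>

definition series_eval :: "nat \<Rightarrow> (nat \<Rightarrow> real) \<Rightarrow> series \<Rightarrow> real" where
  "series_eval N x f = (\<Sum>\<alpha> \<in> vars_support N f. f \<alpha> * monom_eval N x \<alpha>)"

lemma keys_add_nat: "Poly_Mapping.keys (\<beta> + \<gamma> :: nat \<Rightarrow>\<^sub>0 nat) = Poly_Mapping.keys \<beta> \<union> Poly_Mapping.keys \<gamma>"
  by (auto simp: in_keys_iff lookup_add)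

lemma monom_eval_add: "monom_eval N x (\<beta> + \<gamma>) = monom_eval N x \<beta> * monom_eval N x \<gamma>"
  by (simp add: monom_eval_def lookup_add power_add prod.distrib)

lemma finite_splits: "finite {(\<beta>, \<gamma>). \<beta> + \<gamma> = (\<alpha> :: nat \<Rightarrow>\<^sub>0 nat)}"
proof -
  let ?K = "Poly_Mapping.keys \<alpha>"
  let ?B = "{\<beta> :: nat \<Rightarrow>\<^sub>0 nat. \<forall>i. Poly_Mapping.lookup \<beta> i \<le> Poly_Mapping.lookup \<alpha> i}"
  have "inj_on (\<lambda>\<beta>. restrict (Poly_Mapping.lookup \<beta>) ?K) ?B"
  proof (rule inj_onI)
    fix \<beta> \<gamma>
    assume b: "\<beta> \<in> ?B" and c: "\<gamma> \<in> ?B"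
      and eq: "restrict (Poly_Mapping.lookup \<beta>) ?K = restrict (Poly_Mapping.lookup \<gamma>) ?K"
    show "\<beta> = \<gamma>"
    proof (rule poly_mapping_eqI)
      fix i
      show "Poly_Mapping.lookup \<beta> i = Poly_Mapping.lookup \<gamma> i"
      proof (cases "i \<in> ?K")
        case True
        then show ?thesis
          using fun_cong[OF eq, of i] by simp
      next
        case False
        then have "Poly_Mapping.lookup \<alpha> i = 0"
          by (simp add: in_keys_iff)
        then show ?thesis
          using b[THEN CollectD, THEN spec, of i] c[THEN CollectD, THEN spec, of i] by simp
      qed
    qed
  qed
  moreover have "(\<lambda>\<beta>. restrict (Poly_Mapping.lookup \<beta>) ?K) ` ?B \<subseteq> (\<Pi>\<^sub>E i\<in>?K. {..Poly_Mapping.lookup \<alpha> i})"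
    by auto
  moreover have "finite (\<Pi>\<^sub>E i\<in>?K. {..Poly_Mapping.lookup \<alpha> i})"
    by (intro finite_PiE) auto
  ultimately have "finite ?B"
    by (rule inj_on_finite)
  then have "finite (?B \<times> ?B)"
    by simp
  moreover have "{(\<beta>, \<gamma>). \<beta> + \<gamma> = \<alpha>} \<subseteq> ?B \<times> ?B"
    by (clarsimp simp: lookup_add)
  ultimately show ?thesis
    using finite_subset by blast
qed

lemma series_eval_superset:
  assumes "finite S" "vars_support N f \<subseteq> S" "\<And>\<alpha>. \<alpha> \<in> S \<Longrightarrow> Poly_Mapping.keys \<alpha> \<subseteq> {..<N}"
  shows "series_eval N x f = (\<Sum>\<alpha>\<in>S. f \<alpha> * monom_eval N x \<alpha>)"
  unfolding series_eval_def using assms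
  by (intro sum.mono_neutral_left) (auto simp: vars_support_def)

lemma vars_support_s_mult:
  "vars_support N (s_mult f g) \<subseteq> (\<lambda>(\<beta>, \<gamma>). \<beta> + \<gamma>) ` (vars_support N f \<times> vars_support N g)"
proof
  fix \<alpha> assume a: "\<alpha> \<in> vars_support N (s_mult f g)"
  then have "(\<Sum>(\<beta>, \<gamma>) \<in> {(\<beta>, \<gamma>). \<beta> + \<gamma> = \<alpha>}. f \<beta> * g \<gamma>) \<noteq> 0"
    by (simp add: vars_support_def s_mult_def)
  then obtain z where z: "z \<in> {(\<beta>, \<gamma>). \<beta> + \<gamma> = \<alpha>}" "(case z of (\<beta>, \<gamma>) \<Rightarrow> f \<beta> * g \<gamma>) \<noteq> 0"
    by (rule sum.not_neutral_contains_not_neutral)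
  then obtain \<beta> \<gamma> where bc: "\<alpha> = \<beta> + \<gamma>" "f \<beta> \<noteq> 0" "g \<gamma> \<noteq> 0"
    by (cases z) auto
  then have "\<beta> \<in> vars_support N f" "\<gamma> \<in> vars_support N g"
    using a by (auto simp: vars_support_def keys_add_nat)
  then show "\<alpha> \<in> (\<lambda>(\<beta>, \<gamma>). \<beta> + \<gamma>) ` (vars_support N f \<times> vars_support N g)"
    using bc by force
qed

lemma power_sum_nonzero: "power_sum k \<alpha> \<noteq> 0 \<longleftrightarrow> (\<exists>i. \<alpha> = Poly_Mapping.single i k)"
  by (simp add: power_sum_def)

lemma vars_support_power_sum:
  assumes "0 < k"
  shows "vars_support N (power_sum k) = (\<lambda>i. Poly_Mapping.single i k) ` {..<N}"
  using assms by (auto simp: vars_support_def power_sum_nonzero)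

lemma finite_vars_support: "f \<in> Sym \<Longrightarrow> finite (vars_support N f)"
proof (induction rule: Sym.induct)
  case Sym_one
  have "vars_support N s_one \<subseteq> {0}"
    by (auto simp: vars_support_def s_one_def split: if_splits)
  then show ?case
    by (rule finite_subset) simp
next
  case (Sym_power_sum k)
  then show ?case
    by (simp add: vars_support_power_sum)
next
  case (Sym_add f g)
  have "vars_support N (s_add f g) \<subseteq> vars_support N f \<union> vars_support N g"
    by (auto simp: vars_support_def s_add_def)
  then show ?case
    using Sym_add.IH finite_subset by blast
next
  case (Sym_scale f c)
  have "vars_support N (s_scale c f) \<subseteq> vars_support N f"
    by (auto simp: vars_support_def s_scale_def)
  then show ?case
    using Sym_scale.IH finite_subset by blast
next
  case (Sym_mult f g)
  then show ?case
    using vars_support_s_mult[of N f g] finite_subset by blast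
qed

lemma series_eval_one: "series_eval N x s_one = 1"
proof -
  have "vars_support N s_one = {0}"
    by (auto simp: vars_support_def s_one_def split: if_splits)
  then show ?thesis
    by (simp add: series_eval_def s_one_def monom_eval_def)
qed

lemma series_eval_power_sum:
  assumes "0 < k"
  shows "series_eval N x (power_sum k) = (\<Sum>i<N. x i ^ k)"
proof -
  have inj: "inj_on (\<lambda>i. Poly_Mapping.single i k) {..<N}"
    using assms by (auto simp: inj_on_def) (metis keys_single less_numeral_extra(3) singleton_inject)
  have "monom_eval N x (Poly_Mapping.single i k) = x i ^ k" if "i < N" for i
  proof -
    have "monom_eval N x (Poly_Mapping.single i k) = (\<Prod>j<N. if j = i then x i ^ k else 1)"
      unfolding monom_eval_def by (intro prod.cong) (auto simp: lookup_single when_def)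
    then show ?thesis
      using that by simp
  qed
  moreover have "power_sum k (Poly_Mapping.single i k) = 1" for i
    by (auto simp: power_sum_def)
  ultimately show ?thesis
    unfolding series_eval_def vars_support_power_sum[OF assms] by (simp add: sum.reindex[OF inj])
qed

lemma series_eval_add:
  assumes "f \<in> Sym" "g \<in> Sym"
  shows "series_eval N x (s_add f g) = series_eval N x f + series_eval N x g"
proof -
  let ?S = "vars_support N f \<union> vars_support N g"
  have S: "finite ?S" "\<And>\<alpha>. \<alpha> \<in> ?S \<Longrightarrow> Poly_Mapping.keys \<alpha> \<subseteq> {..<N}"
    using assms by (auto simp: finite_vars_support) (auto simp: vars_support_def)
  have "series_eval N x h = (\<Sum>\<alpha>\<in>?S. h \<alpha> * monom_eval N x \<alpha>)" if "vars_support N h \<subseteq> ?S" for h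
    using S that by (intro series_eval_superset) auto
  moreover have "vars_support N (s_add f g) \<subseteq> ?S"
    by (auto simp: vars_support_def s_add_def)
  ultimately show ?thesis
    by (simp add: s_add_def distrib_right sum.distrib)
qed

lemma series_eval_scale:
  assumes "f \<in> Sym"
  shows "series_eval N x (s_scale c f) = c * series_eval N x f"
proof -
  have "series_eval N x (s_scale c f) = (\<Sum>\<alpha>\<in>vars_support N f. s_scale c f \<alpha> * monom_eval N x \<alpha>)"
    using assms by (intro series_eval_superset) (auto simp: finite_vars_support, auto simp: vars_support_def s_scale_def)
  then show ?thesis
    by (simp add: series_eval_def s_scale_def sum_distrib_left mult.assoc)
qed

lemma series_eval_mult:
  assumes "f \<in> Sym" "g \<in> Sym"
  shows "series_eval N x (s_mult f g) = series_eval N x f * series_eval N x g"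
proof -
  let ?P = "vars_support N f \<times> vars_support N g"
  let ?p = "\<lambda>(\<beta>, \<gamma>). \<beta> + (\<gamma> :: nat \<Rightarrow>\<^sub>0 nat)"
  let ?t = "\<lambda>(\<beta>, \<gamma>). (f \<beta> * monom_eval N x \<beta>) * (g \<gamma> * monom_eval N x \<gamma>)"
  have fin: "finite ?P"
    using assms by (simp add: finite_vars_support)
  have "series_eval N x (s_mult f g) = (\<Sum>\<alpha>\<in>?p ` ?P. s_mult f g \<alpha> * monom_eval N x \<alpha>)"
    using fin vars_support_s_mult by (intro series_eval_superset) (auto simp: vars_support_def keys_add_nat)
  also have "\<dots> = (\<Sum>\<alpha>\<in>?p ` ?P. \<Sum>z\<in>{z\<in>?P. ?p z = \<alpha>}. ?t z)"
  proof (rule sum.cong[OF refl])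
    fix \<alpha> assume "\<alpha> \<in> ?p ` ?P"
    then have keys: "Poly_Mapping.keys \<alpha> \<subseteq> {..<N}"
      by (auto simp: vars_support_def keys_add_nat)
    have "s_mult f g \<alpha> * monom_eval N x \<alpha> = (\<Sum>z\<in>{(\<beta>, \<gamma>). \<beta> + \<gamma> = \<alpha>}. ?t z)"
      unfolding s_mult_def sum_distrib_right
      by (intro sum.cong) (auto simp: monom_eval_add)
    also have "\<dots> = (\<Sum>z\<in>{z\<in>?P. ?p z = \<alpha>}. ?t z)"
      using finite_splits[of \<alpha>] keys
      by (intro sum.mono_neutral_right) (auto simp: vars_support_def keys_add_nat)
    finally show "s_mult f g \<alpha> * monom_eval N x \<alpha> = (\<Sum>z\<in>{z\<in>?P. ?p z = \<alpha>}. ?t z)" .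
  qed
  also have "\<dots> = (\<Sum>z\<in>?P. ?t z)"
    using fin by (rule sum.image_gen[symmetric])
  also have "\<dots> = series_eval N x f * series_eval N x g"
    unfolding series_eval_def sum_product sum.cartesian_product ..
  finally show ?thesis .
qed

subsection \<open>Augmented monomial symmetric functions\<close>

definition exponents :: "(nat \<Rightarrow>\<^sub>0 nat) \<Rightarrow> nat multiset" where
  "exponents \<alpha> = image_mset (Poly_Mapping.lookup \<alpha>) (mset_set (Poly_Mapping.keys \<alpha>))"

definition aug_coeff :: "nat multiset \<Rightarrow> real" where
  "aug_coeff \<mu> = (\<Prod>j \<in> set_mset \<mu>. fact (count \<mu> j))"

lemma aug_monomial_sym_eq: "aug_monomial_sym \<mu> \<alpha> = (if exponents \<alpha> = \<mu> then aug_coeff \<mu> else 0)"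
  by (simp add: aug_monomial_sym_def s_scale_def monomial_sym_def exponents_def aug_coeff_def)

lemma aug_coeff_add_mset: "aug_coeff (add_mset k \<mu>) = real (count \<mu> k + 1) * aug_coeff \<mu>"
proof -
  let ?S = "insert k (set_mset \<mu>)"
  have "aug_coeff \<mu> = (\<Prod>j \<in> ?S. fact (count \<mu> j))"
    unfolding aug_coeff_def by (intro prod.mono_neutral_left) (auto simp: not_in_iff)
  moreover have "aug_coeff (add_mset k \<mu>) = (\<Prod>j \<in> ?S. (if j = k then real (count \<mu> k + 1) else 1) * fact (count \<mu> j))"
    unfolding aug_coeff_def by (intro prod.cong) auto
  ultimately show ?thesis
    by (simp add: prod.distrib)
qed

lemma count_exponents:
  assumes "0 < a"
  shows "count (exponents \<alpha>) a = card {i. Poly_Mapping.lookup \<alpha> i = a}"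
proof -
  have "{i. Poly_Mapping.lookup \<alpha> i = a} = {i \<in> Poly_Mapping.keys \<alpha>. Poly_Mapping.lookup \<alpha> i = a}"
    using assms by (auto simp: in_keys_iff)
  then show ?thesis
    by (simp add: exponents_def count_image_mset' eq_commute[of a])
qed

text \<open>Lowering the exponent of \<open>i\<close> from \<open>j + k\<close> to \<open>j\<close>; a part \<open>0\<close> is dropped.\<close>

lemma exponents_minus_single:
  assumes k: "0 < k" and a: "Poly_Mapping.lookup \<alpha> i = j + k"
  shows "exponents (\<alpha> - Poly_Mapping.single i k) =
    (if j = 0 then exponents \<alpha> - {#k#} else add_mset j (exponents \<alpha> - {#j + k#}))"
    and "j + k \<in># exponents \<alpha>"
proof -
  let ?\<beta> = "\<alpha> - Poly_Mapping.single i k"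
  let ?K = "Poly_Mapping.keys \<alpha>"
  have i: "i \<in> ?K"
    using assms by (simp add: in_keys_iff)
  have lookup: "Poly_Mapping.lookup ?\<beta> l = (if l = i then j else Poly_Mapping.lookup \<alpha> l)" for l
    using a by (simp add: lookup_minus lookup_single when_def)
  have K: "mset_set ?K = add_mset i (mset_set (?K - {i}))"
    using i by (metis finite_keys insert_Diff_single insert_absorb mset_set.insert_remove)
  have eq: "image_mset (Poly_Mapping.lookup ?\<beta>) (mset_set (?K - {i}))
      = image_mset (Poly_Mapping.lookup \<alpha>) (mset_set (?K - {i}))"
    by (intro image_mset_cong) (auto simp: lookup)
  have ex: "exponents \<alpha> = add_mset (j + k) (image_mset (Poly_Mapping.lookup \<alpha>) (mset_set (?K - {i})))"
    unfolding exponents_def K using a by simp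
  then show "j + k \<in># exponents \<alpha>"
    by simp
  show "exponents ?\<beta> = (if j = 0 then exponents \<alpha> - {#k#} else add_mset j (exponents \<alpha> - {#j + k#}))"
  proof (cases "j = 0")
    case True
    then have "Poly_Mapping.keys ?\<beta> = ?K - {i}"
      by (auto simp: in_keys_iff lookup split: if_splits)
    then show ?thesis
      using True ex eq unfolding exponents_def[of ?\<beta>] by simp
  next
    case False
    then have "Poly_Mapping.keys ?\<beta> = ?K"
      using i by (auto simp: in_keys_iff lookup split: if_splits)
    then have "exponents ?\<beta> = image_mset (Poly_Mapping.lookup ?\<beta>) (add_mset i (mset_set (?K - {i})))"
      unfolding exponents_def K[symmetric] by simp
    then show ?thesis
      using False ex eq by (simp add: lookup)
  qed
qed

lemma s_mult_power_sum:
  assumes "0 < k"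
  shows "s_mult (power_sum k) f \<alpha> =
    (\<Sum>i | k \<le> Poly_Mapping.lookup \<alpha> i. f (\<alpha> - Poly_Mapping.single i k))"
proof -
  let ?I = "{i. k \<le> Poly_Mapping.lookup \<alpha> i}"
  let ?h = "\<lambda>i. (Poly_Mapping.single i k, \<alpha> - Poly_Mapping.single i k)"
  have le: "Poly_Mapping.single i k + (\<alpha> - Poly_Mapping.single i k) = \<alpha>" if "k \<le> Poly_Mapping.lookup \<alpha> i" for i
    using that by (intro poly_mapping_eqI) (auto simp: lookup_add lookup_minus lookup_single when_def)
  have inj: "inj_on ?h ?I"
    using assms by (auto simp: inj_on_def) (metis keys_single less_numeral_extra(3) singleton_inject)
  have "s_mult (power_sum k) f \<alpha> = (\<Sum>z\<in>?h ` ?I. case z of (\<beta>, \<gamma>) \<Rightarrow> power_sum k \<beta> * f \<gamma>)"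
    unfolding s_mult_def
  proof (intro sum.mono_neutral_right finite_splits ballI)
    show "?h ` ?I \<subseteq> {(\<beta>, \<gamma>). \<beta> + \<gamma> = \<alpha>}"
      using le by auto
    fix z assume z: "z \<in> {(\<beta>, \<gamma>). \<beta> + \<gamma> = \<alpha>} - ?h ` ?I"
    obtain \<beta> \<gamma> where bc: "z = (\<beta>, \<gamma>)" "\<beta> + \<gamma> = \<alpha>"
      using z by auto
    have "power_sum k \<beta> = 0"
    proof (rule ccontr)
      assume "power_sum k \<beta> \<noteq> 0"
      then obtain i where i: "\<beta> = Poly_Mapping.single i k"
        by (auto simp: power_sum_nonzero)
      then have "z = ?h i" "i \<in> ?I"
        using bc by (auto simp: lookup_add)
      then show False
        using z by blast
    qed
    then show "(case z of (\<beta>, \<gamma>) \<Rightarrow> power_sum k \<beta> * f \<gamma>) = 0"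
      by (simp add: bc)
  qed
  also have "\<dots> = (\<Sum>i\<in>?I. f (\<alpha> - Poly_Mapping.single i k))"
    unfolding sum.reindex[OF inj] by (intro sum.cong) (auto simp: power_sum_def)
  finally show ?thesis .
qed

lemma sum_mset_eq_sum_count: "(\<Sum>j\<in>#\<mu>. g j) = (\<Sum>j\<in>set_mset \<mu>. real (count \<mu> j) * g j)"
proof (induction \<mu>)
  case (add k \<mu>)
  have "(\<Sum>j\<in>set_mset (add_mset k \<mu>). real (count (add_mset k \<mu>) j) * g j)
    = (\<Sum>j\<in>insert k (set_mset \<mu>). (if j = k then g k else 0) + real (count \<mu> j) * g j)"
    by (intro sum.cong) (auto simp: algebra_simps)
  also have "\<dots> = g k + (\<Sum>j\<in>insert k (set_mset \<mu>). real (count \<mu> j) * g j)"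
    by (simp add: sum.distrib)
  also have "(\<Sum>j\<in>insert k (set_mset \<mu>). real (count \<mu> j) * g j) = (\<Sum>j\<in>set_mset \<mu>. real (count \<mu> j) * g j)"
    by (intro sum.mono_neutral_right) (auto simp: not_in_iff)
  finally show ?case
    using add by simp
qed simp

lemma finite_lookup_ge: "0 < k \<Longrightarrow> finite {i. k \<le> Poly_Mapping.lookup (\<alpha> :: nat \<Rightarrow>\<^sub>0 nat) i}"
  by (rule finite_subset[OF _ finite_keys[of \<alpha>]]) (auto simp: in_keys_iff)

text \<open>Coefficients are compared monomial by monomial. The variable that contributes its
  \<open>k\<close>-th power has exponent \<open>j + k\<close> and drops to \<open>j\<close>: for
  \<open>j = 0\<close> the part \<open>k\<close> was adjoined, otherwise a part \<open>j\<close> of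
  \<mu> was enlarged.\<close>

lemma power_sum_mult_aug:
  assumes k: "0 < k" and \<mu>: "int_partition \<mu>"
  shows "s_mult (power_sum k) (aug_monomial_sym \<mu>) \<alpha> = aug_monomial_sym (add_mset k \<mu>) \<alpha>
    + (\<Sum>j\<in>#\<mu>. aug_monomial_sym (add_mset (j + k) (\<mu> - {#j#})) \<alpha>)"
proof -
  let ?L = "Poly_Mapping.lookup \<alpha>"
  \<comment> \<open>The index 0 stands for a variable that is absent before multiplication; as 0 is
    not a part, \<open>\<mu> - {#0#}\<close> is \<mu>.\<close>
  let ?J = "insert 0 (set_mset \<mu>)"
  let ?t = "\<lambda>j. if exponents \<alpha> = add_mset (j + k) (\<mu> - {#j#}) then aug_coeff \<mu> else 0"
  have zero: "0 \<notin># \<mu>"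
    using \<mu> by (simp add: int_partition_def)
  have term_eq: "aug_monomial_sym \<mu> (\<alpha> - Poly_Mapping.single i k) = (\<Sum>j\<in>?J. if ?L i = j + k then ?t j else 0)"
    if "k \<le> ?L i" for i
  proof -
    define j where "j = ?L i - k"
    have j: "?L i = j + k"
      using that by (simp add: j_def)
    note ex = exponents_minus_single[OF k j]
    have "exponents (\<alpha> - Poly_Mapping.single i k) = \<mu> \<longleftrightarrow> j \<in> ?J \<and> exponents \<alpha> = add_mset (j + k) (\<mu> - {#j#})"
    proof (cases "j = 0")
      case True
      have "exponents \<alpha> - {#k#} = \<mu> \<longleftrightarrow> exponents \<alpha> = add_mset k \<mu>"
        using ex(2) True by (metis add_0 add_mset_remove_trivial insert_DiffM)
      then show ?thesis
        using True zero ex(1) by (simp add: diff_single_trivial)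
    next
      case False
      have "add_mset j (exponents \<alpha> - {#j + k#}) = \<mu> \<longleftrightarrow> j \<in># \<mu> \<and> exponents \<alpha> - {#j + k#} = \<mu> - {#j#}"
        by (metis add_mset_remove_trivial insert_DiffM union_single_eq_member)
      also have "\<dots> \<longleftrightarrow> j \<in># \<mu> \<and> exponents \<alpha> = add_mset (j + k) (\<mu> - {#j#})"
        using ex(2) by (metis add_mset_remove_trivial insert_DiffM)
      finally show ?thesis
        using False ex(1) by simp
    qed
    then show ?thesis
      unfolding aug_monomial_sym_eq by (simp add: j sum.delta' del: insert_iff)
  qed
  have card: "(\<Sum>i | k \<le> ?L i. if ?L i = j + k then ?t j else 0) = real (count (exponents \<alpha>) (j + k)) * ?t j" for j
  proof -
    have "(\<Sum>i | k \<le> ?L i. if ?L i = j + k then ?t j else 0) = (\<Sum>i | ?L i = j + k. ?t j)"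
      by (intro sum.mono_neutral_cong_right finite_lookup_ge k) auto
    then show ?thesis
      using k by (simp add: count_exponents)
  qed
  \<comment> \<open>The variables with exponent \<open>j + k\<close> are as many as the multiplicity
    of \<open>j + k\<close> in the enlarged partition. This is the factor by which
    \<open>aug_coeff\<close> grows when that part is added, while deleting a part \<open>j\<close>
    divides it by \<open>count \<mu> j\<close>.\<close>
  have coeff: "real (count (exponents \<alpha>) (j + k)) * ?t j
      = (if j = 0 then 1 else real (count \<mu> j)) * aug_monomial_sym (add_mset (j + k) (\<mu> - {#j#})) \<alpha>"
    if "j \<in> ?J" for j
  proof (cases "j = 0")
    case True
    then show ?thesis
      using zero by (simp add: aug_monomial_sym_eq aug_coeff_add_mset diff_single_trivial)
  next
    case False
    then have "j \<in># \<mu>"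
      using that by simp
    then have "aug_coeff \<mu> = real (count \<mu> j) * aug_coeff (\<mu> - {#j#})"
      using aug_coeff_add_mset[of j "\<mu> - {#j#}"] by simp
    then show ?thesis
      using False by (simp add: aug_monomial_sym_eq aug_coeff_add_mset)
  qed
  have "s_mult (power_sum k) (aug_monomial_sym \<mu>) \<alpha>
      = (\<Sum>i | k \<le> ?L i. \<Sum>j\<in>?J. if ?L i = j + k then ?t j else 0)"
    unfolding s_mult_power_sum[OF k] by (intro sum.cong refl term_eq) simp
  also have "\<dots> = (\<Sum>j\<in>?J. \<Sum>i | k \<le> ?L i. if ?L i = j + k then ?t j else 0)"
    by (rule sum.swap)
  also have "\<dots> = (\<Sum>j\<in>?J. (if j = 0 then 1 else real (count \<mu> j)) * aug_monomial_sym (add_mset (j + k) (\<mu> - {#j#})) \<alpha>)"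
    unfolding card by (intro sum.cong refl coeff)
  also have "\<dots> = aug_monomial_sym (add_mset k \<mu>) \<alpha>
    + (\<Sum>j\<in>set_mset \<mu>. real (count \<mu> j) * aug_monomial_sym (add_mset (j + k) (\<mu> - {#j#})) \<alpha>)"
    using zero by (auto simp: diff_single_trivial intro!: sum.cong)
  finally show ?thesis
    unfolding sum_mset_eq_sum_count .
qed


lemma exponents_eq_empty [simp]: "exponents \<alpha> = {#} \<longleftrightarrow> \<alpha> = 0"
  by (simp add: exponents_def mset_set_empty_iff)

lemma aug_monomial_sym_empty: "aug_monomial_sym {#} = s_one"
  by (auto simp: fun_eq_iff aug_monomial_sym_eq s_one_def aug_coeff_def)

lemma s_mult_s_one: "s_mult f s_one = f"
proof
  fix \<alpha>
  have "s_mult f s_one \<alpha> = (\<Sum>z\<in>{(\<alpha>, 0)}. case z of (\<beta>, \<gamma>) \<Rightarrow> f \<beta> * s_one \<gamma>)"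
    unfolding s_mult_def
    by (intro sum.mono_neutral_right finite_splits) (auto simp: s_one_def split: if_splits)
  then show "s_mult f s_one \<alpha> = f \<alpha>"
    by (simp add: s_one_def)
qed

lemma aug_monomial_sym_single:
  assumes "0 < k"
  shows "aug_monomial_sym {#k#} = power_sum k"
proof -
  have "s_mult (power_sum k) (aug_monomial_sym {#}) \<alpha> = aug_monomial_sym {#k#} \<alpha>" for \<alpha>
    using power_sum_mult_aug[OF assms, of "{#}" \<alpha>] by (simp add: int_partition_def)
  then show ?thesis
    by (auto simp: aug_monomial_sym_empty s_mult_s_one)
qed

lemma Sym_sum:
  "finite I \<Longrightarrow> (\<And>i. i \<in> I \<Longrightarrow> f i \<in> Sym) \<Longrightarrow> (\<lambda>\<alpha>. \<Sum>i\<in>I. c i * f i \<alpha>) \<in> Sym"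
proof (induction I rule: finite_induct)
  case empty
  have "s_scale 0 s_one \<in> Sym"
    by (intro Sym.intros)
  then show ?case
    by (simp add: s_scale_def)
next
  case (insert i I)
  then have "s_add (s_scale (c i) (f i)) (\<lambda>\<alpha>. \<Sum>i\<in>I. c i * f i \<alpha>) \<in> Sym"
    by (intro Sym.intros) auto
  then show ?case
    using insert by (simp add: s_add_def s_scale_def)
qed

section \<open>Recursion on the number of parts\<close>

lemma int_partition_add_mset [simp]: "int_partition (add_mset k \<mu>) \<longleftrightarrow> 0 < k \<and> int_partition \<mu>"
  by (auto simp: int_partition_def)

lemma int_partition_diff [simp]: "int_partition \<mu> \<Longrightarrow> int_partition (\<mu> - {#j#})"
  by (auto simp: int_partition_def dest: in_diffD)

text \<open>The product rule is solved for the term with the largest number of parts: in all the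
  others \<open>k\<close> has been absorbed by a part, so there is one part less.\<close>

lemma aug_monomial_sym_in_Sym: "int_partition \<mu> \<Longrightarrow> aug_monomial_sym \<mu> \<in> Sym"
proof (induction "size \<mu>" arbitrary: \<mu>)
  case 0
  then show ?case
    by (simp add: aug_monomial_sym_empty Sym_one)
next
  case (Suc n)
  obtain k \<nu> where \<mu>: "\<mu> = add_mset k \<nu>"
    using Suc.hyps(2) by (cases \<mu>) auto
  have k: "0 < k" "int_partition \<nu>"
    using Suc.prems \<mu> by auto
  have "(\<lambda>\<alpha>. \<Sum>j\<in>set_mset \<nu>. real (count \<nu> j) * aug_monomial_sym (add_mset (j + k) (\<nu> - {#j#})) \<alpha>) \<in> Sym"
    (is "?h \<in> _")
  proof (intro Sym_sum Suc.hyps(1))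
    fix j assume "j \<in># \<nu>"
    then show "n = size (add_mset (j + k) (\<nu> - {#j#}))"
      using Suc.hyps(2) \<mu> by (simp add: size_Diff_singleton) (metis Suc_pred nonempty_has_size empty_iff set_mset_empty)
  qed (use k in auto)
  then have "s_add (s_mult (power_sum k) (aug_monomial_sym \<nu>)) (s_scale (-1) ?h) \<in> Sym"
    using Suc.hyps k \<mu> by (intro Sym.intros) auto
  also have "s_add (s_mult (power_sum k) (aug_monomial_sym \<nu>)) (s_scale (-1) ?h) = aug_monomial_sym \<mu>"
    using power_sum_mult_aug[OF k] by (simp add: fun_eq_iff s_add_def s_scale_def sum_mset_eq_sum_count \<mu>)
  finally show ?case .
qed

text \<open>A function obeying the rule is a fixed polynomial in its values at single parts, because
  the rule expresses \<open>h (add_mset k \<nu>)\<close> by \<open>h {#k#}\<close> and values at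
  partitions with fewer parts. This transports limits and, for constant sequences,
  equalities.\<close>

lemma stuffle_tendsto:
  assumes "\<And>n. stuffle (h n)" "stuffle h'"
    and "\<And>k. 0 < k \<Longrightarrow> (\<lambda>n. h n {#k#}) \<longlonglongrightarrow> h' {#k#}"
  shows "int_partition \<mu> \<Longrightarrow> (\<lambda>n. h n \<mu>) \<longlonglongrightarrow> h' \<mu>"
proof (induction "size \<mu>" arbitrary: \<mu>)
  case 0
  then show ?case
    using assms(1,2) by (simp add: stuffle_def)
next
  case (Suc m)
  obtain k \<nu> where \<mu>: "\<mu> = add_mset k \<nu>"
    using Suc.hyps(2) by (cases \<mu>) auto
  have k: "0 < k" "int_partition \<nu>"
    using Suc.prems \<mu> by auto
  have eq: "g \<mu> = g {#k#} * g \<nu> - (\<Sum>j\<in>set_mset \<nu>. real (count \<nu> j) * g (add_mset (j + k) (\<nu> - {#j#})))"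
    if "stuffle g" for g
    using that k unfolding stuffle_def \<mu> sum_mset_eq_sum_count by simp
  have "(\<lambda>n. h n (add_mset (j + k) (\<nu> - {#j#}))) \<longlonglongrightarrow> h' (add_mset (j + k) (\<nu> - {#j#}))" if "j \<in># \<nu>" for j
  proof (rule Suc.hyps(1))
    show "m = size (add_mset (j + k) (\<nu> - {#j#}))"
      using Suc.hyps(2) \<mu> that by (simp add: size_Diff_singleton) (metis Suc_pred nonempty_has_size empty_iff set_mset_empty)
  qed (use k in auto)
  moreover have "(\<lambda>n. h n \<nu>) \<longlonglongrightarrow> h' \<nu>"
    using Suc.hyps \<mu> k by auto
  ultimately show ?case
    unfolding eq[OF assms(1)] eq[OF assms(2)]
    by (intro tendsto_diff tendsto_mult tendsto_sum tendsto_const assms(3) k)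
qed

lemma stuffle_unique:
  assumes "stuffle h" "stuffle h'" "\<And>k. 0 < k \<Longrightarrow> h {#k#} = h' {#k#}" "int_partition \<mu>"
  shows "h \<mu> = h' \<mu>"
proof -
  have "(\<lambda>_::nat. h \<mu>) \<longlonglongrightarrow> h' \<mu>"
    by (rule stuffle_tendsto) (use assms in auto)
  then show ?thesis
    by (simp add: LIMSEQ_const_iff)
qed

subsection \<open>The homomorphism attached to a point of the Kingman simplex\<close>

text \<open>The mass \<open>1 - suminf p\<close> missing from \<open>p\<close> is spread over \<open>N\<close> further variables.\<close>

definition dust_approx :: "(nat \<Rightarrow> real) \<Rightarrow> nat \<Rightarrow> nat \<Rightarrow> real" where
  "dust_approx p N i = (if i < N then p i else (1 - suminf p) / real N)"

definition chi_hom :: "(nat \<Rightarrow> real) \<Rightarrow> (series \<Rightarrow> real) \<Rightarrow> bool" where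
  "chi_hom p h \<longleftrightarrow> h \<in> extensional Sym
     \<and> h s_one = 1
     \<and> (\<forall>f\<in>Sym. \<forall>g\<in>Sym. h (s_add f g) = h f + h g)
     \<and> (\<forall>c. \<forall>f\<in>Sym. h (s_scale c f) = c * h f)
     \<and> (\<forall>f\<in>Sym. \<forall>g\<in>Sym. h (s_mult f g) = h f * h g)
     \<and> h (power_sum 1) = 1
     \<and> (\<forall>k\<ge>2. h (power_sum k) = suminf (\<lambda>i. p i ^ k))"

lemma chi_eq_The: "chi p = (THE h. chi_hom p h)"
  by (simp add: chi_def chi_hom_def)

lemma chi_hom_unique:
  assumes "chi_hom p h" "chi_hom p h'"
  shows "h = h'"
proof -
  have "h f = h' f" if "f \<in> Sym" for f
    using that
  proof (induction rule: Sym.induct)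
    case (Sym_power_sum k)
    then show ?case
      using assms by (cases "k = 1") (auto simp: chi_hom_def)
  qed (use assms in \<open>auto simp: chi_hom_def\<close>)
  then show ?thesis
    using assms by (auto simp: chi_hom_def intro: extensionalityI)
qed

lemma NablaD:
  assumes "p \<in> Nabla"
  shows "antimono p" "\<And>i. 0 \<le> p i" "summable p" "suminf p \<le> 1" "\<And>i. p i \<le> 1"
proof -
  show *: "antimono p" "\<And>i. 0 \<le> p i" "summable p" "suminf p \<le> 1"
    using assms by (auto simp: Nabla_def)
  have "p i \<le> suminf p" for i
    using sum_le_suminf[of p "{i}"] * by simp
  then show "\<And>i. p i \<le> 1"
    using * order_trans by blast
qed

lemma summable_Nabla_power:
  assumes "p \<in> Nabla" "0 < k"
  shows "summable (\<lambda>i. p i ^ k)"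
proof (rule summable_comparison_test'[of p 0])
  show "norm (p i ^ k) \<le> p i" for i
    using NablaD[OF assms(1)] power_decreasing[of 1 k "p i"] assms(2) by simp
qed (use NablaD[OF assms(1)] in simp)

text \<open>With \<open>d\<close> for the missing mass, the further variables add
  \<open>N * (d / N) ^ k\<close>. For \<open>N > 0\<close> this is \<open>d\<close> if
  \<open>k = 1\<close>, which completes the total mass to 1 in the limit, and it tends to 0 if
  \<open>k \<ge> 2\<close>.\<close>

lemma power_sum_dust_approx:
  assumes p: "p \<in> Nabla" and k: "0 < k"
  shows "(\<lambda>N. \<Sum>i<2 * N. dust_approx p N i ^ k) \<longlonglongrightarrow> (if k = 1 then 1 else suminf (\<lambda>i. p i ^ k))"
proof -
  let ?d = "1 - suminf p"
  have split: "(\<Sum>i<2 * N. dust_approx p N i ^ k) = (\<Sum>i<N. p i ^ k) + real N * (?d / real N) ^ k" for N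
  proof -
    have "{..<2 * N} = {..<N} \<union> {N..<2 * N}"
      by auto
    then have "(\<Sum>i<2 * N. dust_approx p N i ^ k)
        = (\<Sum>i<N. dust_approx p N i ^ k) + (\<Sum>i=N..<2 * N. dust_approx p N i ^ k)"
      by (metis (no_types, lifting) sum.union_disjoint finite_lessThan finite_atLeastLessThan ivl_disj_int_one(2))
    then show ?thesis
      by (simp add: dust_approx_def)
  qed
  have lim1: "(\<lambda>N. \<Sum>i<N. p i ^ k) \<longlonglongrightarrow> suminf (\<lambda>i. p i ^ k)"
    by (rule summable_LIMSEQ[OF summable_Nabla_power[OF p k]])
  have "(\<lambda>N. real N * (?d / real N) ^ k) \<longlonglongrightarrow> (if k = 1 then ?d else 0)"
  proof (cases "k = 1")
    case True
    have "eventually (\<lambda>N. real N * (?d / real N) ^ k = ?d) sequentially"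
      using eventually_gt_at_top[of 0] by eventually_elim (simp add: True)
    then show ?thesis
      unfolding if_P[OF True] by (rule tendsto_eventually)
  next
    case False
    then obtain l where l: "k = Suc (Suc l)"
      using k by (cases k; cases "k - 1") auto
    have "(\<lambda>N. ?d ^ k * (1 / real N) ^ Suc l) \<longlonglongrightarrow> ?d ^ k * 0 ^ Suc l"
      by (intro tendsto_intros lim_1_over_n)
    then have "(\<lambda>N. ?d ^ k * (1 / real N) ^ Suc l) \<longlonglongrightarrow> 0"
      by simp
    moreover have "eventually (\<lambda>N. ?d ^ k * (1 / real N) ^ Suc l = real N * (?d / real N) ^ k) sequentially"
      using eventually_gt_at_top[of 0] by eventually_elim (simp add: l power_divide)
    ultimately show ?thesis
      unfolding if_not_P[OF False] by (rule Lim_transform_eventually)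
  qed
  from tendsto_add[OF lim1 this] show ?thesis
    unfolding split by (cases "k = 1") simp_all
qed

text \<open>Convergence of the evaluations is known on the power sums and is inherited under the
  operations generating \<open>Sym\<close>. The limit respects these operations, so the values
  prescribed on the generators are consistent.\<close>

lemma chi_hom_exists:
  assumes p: "p \<in> Nabla"
  shows "\<exists>h. chi_hom p h"
proof -
  let ?e = "\<lambda>N. series_eval (2 * N) (dust_approx p N)"
  have power_sum: "(\<lambda>N. ?e N (power_sum k)) \<longlonglongrightarrow> (if k = 1 then 1 else suminf (\<lambda>i. p i ^ k))" if "0 < k" for k
    using power_sum_dust_approx[OF p that] that by (simp add: series_eval_power_sum)
  have "convergent (\<lambda>N. ?e N f)" if "f \<in> Sym" for f
    using that
  proof (induction rule: Sym.induct)
    case Sym_one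
    then show ?case
      by (simp add: series_eval_one convergent_const)
  next
    case (Sym_power_sum k)
    then show ?case
      using power_sum[of k] by (auto simp: convergent_def)
  next
    case (Sym_add f g)
    then show ?case
      by (simp add: series_eval_add convergent_add)
  next
    case (Sym_scale f c)
    then show ?case
      using convergent_mult[of "\<lambda>_. c" "\<lambda>N. ?e N f"] by (simp add: series_eval_scale convergent_const)
  next
    case (Sym_mult f g)
    then show ?case
      by (simp add: series_eval_mult convergent_mult)
  qed
  then have lim: "(\<lambda>N. ?e N f) \<longlonglongrightarrow> lim (\<lambda>N. ?e N f)" if "f \<in> Sym" for f
    using that by (simp add: convergent_LIMSEQ_iff)
  define h where "h = restrict (\<lambda>f. lim (\<lambda>N. ?e N f)) Sym"
  have h: "(\<lambda>N. ?e N f) \<longlonglongrightarrow> h f" if "f \<in> Sym" for f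
    using lim that by (simp add: h_def)
  have uniq: "h f = l" if "f \<in> Sym" "(\<lambda>N. ?e N f) \<longlonglongrightarrow> l" for f l
    using LIMSEQ_unique[OF h[OF that(1)] that(2)] .
  have "chi_hom p h"
    unfolding chi_hom_def
  proof (intro conjI ballI allI impI)
    show "h \<in> extensional Sym"
      by (simp add: h_def)
    show "h s_one = 1"
      by (intro uniq) (simp_all add: series_eval_one Sym_one)
    show "h (power_sum 1) = 1"
      using power_sum[of 1] by (intro uniq) (simp_all add: Sym_power_sum)
    fix f g c assume fg: "f \<in> Sym"
    show "h (s_scale c f) = c * h f"
      by (intro uniq Sym.intros fg) (simp add: series_eval_scale fg tendsto_mult h)
    assume g: "g \<in> Sym"
    show "h (s_add f g) = h f + h g"
      by (intro uniq Sym.intros fg g) (simp add: series_eval_add fg g tendsto_add h)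
    show "h (s_mult f g) = h f * h g"
      by (intro uniq Sym.intros fg g) (simp add: series_eval_mult fg g tendsto_mult h)
  next
    fix k :: nat assume "2 \<le> k"
    then show "h (power_sum k) = suminf (\<lambda>i. p i ^ k)"
      using power_sum[of k] by (intro uniq) (auto intro: Sym_power_sum)
  qed
  then show ?thesis
    by blast
qed

lemma chi_hom_chi:
  assumes p: "p \<in> Nabla"
  shows "chi_hom p (chi p)"
proof -
  obtain h where h: "chi_hom p h"
    using chi_hom_exists[OF p] ..
  then have "chi p = h"
    unfolding chi_eq_The using chi_hom_unique by blast
  then show ?thesis
    using h by simp
qed

lemma
  assumes "p \<in> Nabla" "f \<in> Sym" "g \<in> Sym"
  shows chi_add: "chi p (s_add f g) = chi p f + chi p g"
    and chi_mult: "chi p (s_mult f g) = chi p f * chi p g"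
  using chi_hom_chi[OF assms(1)] assms(2,3) by (simp_all add: chi_hom_def)

lemma chi_sum:
  assumes "p \<in> Nabla"
  shows "finite I \<Longrightarrow> (\<And>i. i \<in> I \<Longrightarrow> f i \<in> Sym) \<Longrightarrow>
    chi p (\<lambda>\<alpha>. \<Sum>i\<in>I. c i * f i \<alpha>) = (\<Sum>i\<in>I. c i * chi p (f i))"
proof (induction I rule: finite_induct)
  case empty
  have "chi p (s_scale 0 s_one) = 0"
    using chi_hom_chi[OF assms] by (simp add: chi_hom_def Sym_one)
  then show ?case
    by (simp add: s_scale_def)
next
  case (insert i I)
  then have "(\<lambda>\<alpha>. \<Sum>i\<in>insert i I. c i * f i \<alpha>) = s_add (s_scale (c i) (f i)) (\<lambda>\<alpha>. \<Sum>i\<in>I. c i * f i \<alpha>)"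
    by (simp add: fun_eq_iff s_add_def s_scale_def)
  moreover have "s_scale (c i) (f i) \<in> Sym" "(\<lambda>\<alpha>. \<Sum>i\<in>I. c i * f i \<alpha>) \<in> Sym"
    using insert by (auto intro: Sym.intros Sym_sum)
  ultimately show ?case
    using insert chi_hom_chi[OF assms] by (simp add: chi_hom_def)
qed

lemma chi_power_sum:
  assumes "p \<in> Nabla" "0 < k"
  shows "chi p (power_sum k) = (if k = 1 then 1 else suminf (\<lambda>i. p i ^ k))"
  using chi_hom_chi[OF assms(1)] assms(2) by (auto simp: chi_hom_def)

lemma stuffle_chi:
  assumes p: "p \<in> Nabla"
  shows "stuffle (\<lambda>\<mu>. chi p (aug_monomial_sym \<mu>))"
  unfolding stuffle_def
proof (intro conjI allI impI)
  show "chi p (aug_monomial_sym {#}) = 1"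
    using chi_hom_chi[OF p] by (simp add: chi_hom_def aug_monomial_sym_empty)
next
  fix k \<mu> assume k: "0 < (k::nat)" "int_partition \<mu>"
  let ?h = "\<lambda>\<alpha>. \<Sum>j\<in>set_mset \<mu>. real (count \<mu> j) * aug_monomial_sym (add_mset (j + k) (\<mu> - {#j#})) \<alpha>"
  have Sym: "aug_monomial_sym (add_mset (j + k) (\<mu> - {#j#})) \<in> Sym" for j
    using k by (intro aug_monomial_sym_in_Sym) auto
  then have "?h \<in> Sym"
    by (intro Sym_sum) auto
  have Sym': "aug_monomial_sym \<mu> \<in> Sym" "aug_monomial_sym (add_mset k \<mu>) \<in> Sym" "power_sum k \<in> Sym"
    using k by (auto intro: aug_monomial_sym_in_Sym Sym_power_sum)
  have "s_mult (power_sum k) (aug_monomial_sym \<mu>) = s_add (aug_monomial_sym (add_mset k \<mu>)) ?h"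
    using power_sum_mult_aug[OF k] by (simp add: fun_eq_iff s_add_def sum_mset_eq_sum_count)
  then have "chi p (power_sum k) * chi p (aug_monomial_sym \<mu>) = chi p (s_add (aug_monomial_sym (add_mset k \<mu>)) ?h)"
    using chi_mult[OF p Sym'(3,1)] by simp
  also have "\<dots> = chi p (aug_monomial_sym (add_mset k \<mu>)) + chi p ?h"
    by (rule chi_add[OF p Sym'(2) \<open>?h \<in> Sym\<close>])
  finally have "chi p (power_sum k) * chi p (aug_monomial_sym \<mu>) = chi p (aug_monomial_sym (add_mset k \<mu>)) + chi p ?h" .
  then show "chi p (aug_monomial_sym {#k#}) * chi p (aug_monomial_sym \<mu>) = chi p (aug_monomial_sym (add_mset k \<mu>))
      + (\<Sum>j\<in>#\<mu>. chi p (aug_monomial_sym (add_mset (j + k) (\<mu> - {#j#}))))"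
    using k Sym by (simp add: chi_sum[OF p] sum_mset_eq_sum_count aug_monomial_sym_single)
qed

subsection \<open>The characters attached to the Kingman simplex\<close>

lemma psi_F: "psi p (F t) = chi p (Q_tree t)"
  by (simp add: psi_def Q_def F_def)

lemma psi_path_tree: "int_partition \<mu> \<Longrightarrow> psi p (F (path_tree \<mu>)) = chi p (aug_monomial_sym \<mu>)"
  by (simp add: psi_def Q_path_tree)

lemma psi_path_tree_single:
  assumes "p \<in> Nabla" "0 < k"
  shows "psi p (F (path_tree {#k#})) = (if k = 1 then 1 else suminf (\<lambda>i. p i ^ k))"
  using assms by (simp add: psi_path_tree int_partition_def aug_monomial_sym_single chi_power_sum)

lemma psi_not_path_forest:
  assumes "p \<in> Nabla" "\<not> path_forest t"
  shows "psi p (F t) = 0"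
  using chi_sum[OF assms(1), of "{}"] assms(2) by (simp add: psi_def Q_not_path_forest)

text \<open>Off path forests both sides vanish. On them both sides obey the stuffle rule, so it
  suffices to compare single chains, where the values are power sums. Nonnegativity and
  multiplicativity on trees reach \<open>psi p\<close> through this limit.\<close>

lemma psi_tendsto:
  assumes p: "p \<in> Nabla"
  shows "(\<lambda>N. finite_char (map (dust_approx p N) [0..<2 * N]) (branches t)) \<longlonglongrightarrow> psi p (F t)"
proof (cases "path_forest t")
  case False
  obtain M where t: "t = Node M"
    by (cases t)
  obtain c where "c \<in># M" "\<not> chainlike c"
    using False by (auto simp: t path_forest_Node)
  then have "finite_char ys (branches t) = 0" for ys
    using finite_char_eq_0 t by simp
  then show ?thesis
    using psi_not_path_forest[OF p False] by simp
next
  case True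
  then obtain \<mu> where \<mu>: "int_partition \<mu>" "t = path_tree \<mu>"
    by (auto simp: path_forest_iff)
  have "(\<lambda>N. finite_char (map (dust_approx p N) [0..<2 * N]) (image_mset chain \<mu>)) \<longlonglongrightarrow> chi p (aug_monomial_sym \<mu>)"
  proof (rule stuffle_tendsto[OF stuffle_finite_char stuffle_chi[OF p] _ \<mu>(1)])
    fix k :: nat assume k: "0 < k"
    have "finite_char (map (dust_approx p N) [0..<2 * N]) {#chain k#} = (\<Sum>i<2 * N. dust_approx p N i ^ k)" for N
      using k by (simp add: finite_char_chain comp_def interv_sum_list_conv_sum_set_nat atLeast0LessThan)
    then show "(\<lambda>N. finite_char (map (dust_approx p N) [0..<2 * N]) (image_mset chain {#k#}))
        \<longlonglongrightarrow> chi p (aug_monomial_sym {#k#})"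
      using power_sum_dust_approx[OF p k] k p by (simp add: aug_monomial_sym_single chi_power_sum)
  qed
  then show ?thesis
    using \<mu> by (simp add: psi_path_tree) (simp add: path_tree_def)
qed

lemma psi_F_nonneg:
  assumes p: "p \<in> Nabla"
  shows "0 \<le> psi p (F t)"
proof (rule LIMSEQ_le_const[OF psi_tendsto[OF p]], intro exI allI impI)
  fix N
  have "0 \<le> dust_approx p N i" for i
    using NablaD[OF p] by (simp add: dust_approx_def)
  then show "0 \<le> finite_char (map (dust_approx p N) [0..<2 * N]) (branches t)"
    by (intro finite_char_nonneg) auto
qed

lemma Q_tree_in_Sym: "Q_tree t \<in> Sym"
proof (cases "path_forest t")
  case True
  have "int_partition (image_mset nverts (branches t))"
    by (auto simp: int_partition_def) (metis nverts_pos less_numeral_extra(3))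
  then show ?thesis
    using True by (simp add: Q_tree_def aug_monomial_sym_in_Sym)
next
  case False
  then show ?thesis
    using Sym_sum[of "{}"] by (simp add: Q_tree_def)
qed

lemma psi_eq_sum:
  assumes "p \<in> Nabla" "finite S" "Poly_Mapping.keys x \<subseteq> S"
  shows "psi p x = (\<Sum>t\<in>S. Poly_Mapping.lookup x t * psi p (F t))"
proof -
  have "psi p x = (\<Sum>t\<in>Poly_Mapping.keys x. Poly_Mapping.lookup x t * psi p (F t))"
    using assms(1) unfolding psi_F by (simp add: psi_def Q_def chi_sum Q_tree_in_Sym)
  also have "\<dots> = (\<Sum>t\<in>S. Poly_Mapping.lookup x t * psi p (F t))"
    using assms by (intro sum.mono_neutral_left) (auto simp: in_keys_iff)
  finally show ?thesis .
qed

lemma linear_psi: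
  assumes p: "p \<in> Nabla"
  shows "linear (psi p)"
proof (rule linearI)
  fix x y :: gl and c :: real
  let ?S = "Poly_Mapping.keys x \<union> Poly_Mapping.keys y"
  have "Poly_Mapping.keys (x + y) \<subseteq> ?S"
    by (auto simp: in_keys_iff lookup_add)
  then show "psi p (x + y) = psi p x + psi p y"
    using psi_eq_sum[OF p, of ?S] by (simp add: lookup_add distrib_right sum.distrib)
  have "Poly_Mapping.keys (c *\<^sub>R x) \<subseteq> Poly_Mapping.keys x"
    by (auto simp: in_keys_iff lookup_scaleR)
  then show "psi p (c *\<^sub>R x) = c *\<^sub>R psi p x"
    using psi_eq_sum[OF p, of "Poly_Mapping.keys x"] by (simp add: lookup_scaleR sum_distrib_left mult.assoc)
qed

text \<open>A grafting sum has finitely many terms, so the identity for finitely many variables,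
  valid for every \<open>N\<close>, passes to the limit.\<close>

lemma psi_gl_tree_mult:
  assumes p: "p \<in> Nabla"
  shows "psi p (gl_tree_mult s t) = psi p (F s) * psi p (F t)"
proof -
  obtain ts where ts: "plane t = PNode ts"
    by (cases "plane t")
  let ?c = "\<lambda>N. finite_char (map (dust_approx p N) [0..<2 * N])"
  let ?J = "{..<length (branch_list s)}" and ?b = "(!) (branch_list s)"
  have "(\<lambda>N. graft_sum (?c N) ts ?J ?b) \<longlonglongrightarrow> graft_sum (\<lambda>M. psi p (F (Node M))) ts ?J ?b"
    unfolding graft_sum_def using psi_tendsto[OF p, of "Node _"] by (intro tendsto_sum) simp
  moreover have "graft_sum (?c N) ts ?J ?b = ?c N (branches s) * ?c N (branches t)" for N
  proof -
    have "shapes ts = branches t"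
      using plane_eq_PNode[of "branches t"] ts by simp
    then show ?thesis
      using graft_multiplicative_finite_char[of "map (dust_approx p N) [0..<2 * N]"]
      unfolding graft_multiplicative_def by (metis finite_lessThan labels_nth mset_branch_list)
  qed
  ultimately have "graft_sum (\<lambda>M. psi p (F (Node M))) ts ?J ?b = psi p (F s) * psi p (F t)"
    using tendsto_mult[OF psi_tendsto[OF p, of s] psi_tendsto[OF p, of t]] LIMSEQ_unique by auto
  then show ?thesis
    using linear_gl_tree_mult[OF linear_psi[OF p] ts] by simp
qed

lemma psi_in_normalized_characters:
  assumes p: "p \<in> Nabla"
  shows "psi p \<in> normalized_characters"
proof -
  have lin: "linear (psi p)"
    by (rule linear_psi[OF p])
  have "psi p (x \<star> y) = psi p x * psi p y" for x y
    by (simp add: gl_mult_def linear_sum[OF lin] linear_cmul[OF lin] psi_gl_tree_mult[OF p]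
        linear_gl[OF lin, of x] linear_gl[OF lin, of y] sum_product algebra_simps)
  moreover have "tau = path_tree {#1#}"
    by (simp add: tau_eq path_tree_def)
  then have "psi p (F tau) = 1"
    using psi_path_tree_single[OF p, of 1] by simp
  ultimately show ?thesis
    using lin psi_F_nonneg[OF p]
    by (simp add: normalized_characters_def character_def normalized_def basis_positive_def)
qed

section \<open>Moments of Kingman's random partitions\<close>

text \<open>The falling factorial, taken over the reals so that its argument may be shifted without
  truncation; at a natural number it counts the ordered choices of \<open>k\<close> distinct
  elements.\<close>

primrec ff :: "real \<Rightarrow> nat \<Rightarrow> real" where
  "ff x 0 = 1"
| "ff x (Suc k) = ff x k * (x - real k)"

lemma ff_shift: "ff (x + 1) (Suc k) = (x + 1) * ff x k"
  by (induction k) (simp_all add: algebra_simps)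

text \<open>Ordered choices when one element is added: the new element is not chosen, or it takes
  one of the \<open>k\<close> places. For \<open>k = 0\<close> the truncated index is multiplied by
  0.\<close>

lemma ff_step: "ff (x + 1) k = ff x k + real k * ff x (k - 1)"
proof (cases k)
  case (Suc l)
  show ?thesis
    unfolding Suc ff_shift by (simp add: algebra_simps)
qed simp

lemma ff_eq_0: "n < k \<Longrightarrow> ff (real n) k = 0"
  by (induction k) (auto simp: less_Suc_eq)

lemma ff_nonneg: "0 \<le> ff (real n) k"
proof (induction k)
  case (Suc k)
  then show ?case
    by (cases "n < k") (simp_all add: ff_eq_0)
qed simp

lemma ff_zero: "ff 0 k = (if k = 0 then 1 else 0)"
  using ff_eq_0[of 0 k] by auto

lemma ff_le_power: "ff (real n) k \<le> real n ^ k"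
proof (induction k)
  case (Suc k)
  have "ff (real n) k * (real n - real k) \<le> real n ^ k * real n"
    using Suc ff_nonneg[of n k] by (cases "n < k") (auto simp: ff_eq_0 intro!: mult_mono)
  then show ?case
    by (simp add: mult.commute)
qed simp

text \<open>The extra factor \<open>n\<close> on the left stands in for an exponent
  \<open>k - 1\<close> on the right and keeps subtraction out of the induction.\<close>

lemma power_minus_ff: "real n * (real n ^ k - ff (real n) k) \<le> (real k)\<^sup>2 * real n ^ k"
proof (induction k)
  case (Suc k)
  have "real n * (real n ^ Suc k - ff (real n) (Suc k))
      = real n * (real n * (real n ^ k - ff (real n) k)) + real n * real k * ff (real n) k"
    by (simp add: algebra_simps)
  also have "\<dots> \<le> real n * ((real k)\<^sup>2 * real n ^ k) + real n * real k * real n ^ k"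
    using Suc ff_le_power[of n k] by (intro add_mono mult_left_mono) auto
  also have "\<dots> = ((real k)\<^sup>2 + real k) * real n ^ Suc k"
    by (simp add: algebra_simps)
  also have "\<dots> \<le> (real (Suc k))\<^sup>2 * real n ^ Suc k"
    by (intro mult_right_mono) (auto simp: power2_eq_square algebra_simps)
  finally show ?case .
qed simp

lemma ff_asymp: "(\<lambda>n. ff (real n - c) k / real n ^ k) \<longlonglongrightarrow> 1"
proof (induction k)
  case (Suc k)
  have "(\<lambda>n. 1 - (c + real k) * (1 / real n)) \<longlonglongrightarrow> 1 - (c + real k) * 0"
    by (intro tendsto_intros lim_1_over_n)
  then have "(\<lambda>n. (ff (real n - c) k / real n ^ k) * (1 - (c + real k) * (1 / real n))) \<longlonglongrightarrow> 1 * 1"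
    using Suc by (intro tendsto_mult) auto
  moreover have "eventually (\<lambda>n. (ff (real n - c) k / real n ^ k) * (1 - (c + real k) * (1 / real n))
      = ff (real n - c) (Suc k) / real n ^ Suc k) sequentially"
    using eventually_gt_at_top[of 0] by eventually_elim (simp add: field_simps)
  ultimately show ?case
    by (simp add: Lim_transform_eventually)
qed simp

text \<open>\<open>marked_sum a b H \<mu>\<close> enlarges one block of \<open>\<mu>\<close> by \<open>b\<close>, counting a block of size \<open>j\<close> once for each of the
  \<open>ff j a\<close> ways to mark \<open>a\<close> of its elements; for \<open>a = 0\<close> the block may also be the empty one.\<close>

definition marked_sum :: "nat \<Rightarrow> nat \<Rightarrow> (nat multiset \<Rightarrow> real) \<Rightarrow> nat multiset \<Rightarrow> real" where
  "marked_sum a b H \<mu> = (\<Sum>j\<in>#\<mu>. ff (real j) a * H (add_mset (j + b) (\<mu> - {#j#})))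
     + (if a = 0 then H (add_mset b \<mu>) else 0)"

text \<open>One step in the graph of partitions: a new element joins a block or opens a new one.
  Thus \<open>(grow ^^ n) G {#}\<close> is the sum of the values of \<open>G\<close> at the block
  sizes of all set partitions of an \<open>n\<close>-element set.\<close>

definition grow :: "(nat multiset \<Rightarrow> real) \<Rightarrow> nat multiset \<Rightarrow> real" where
  "grow = marked_sum 0 1"

lemma sum_mset_minus_add_mset:
  "(\<Sum>i\<in>#\<nu>. g i (add_mset c \<nu> - {#i#})) = (\<Sum>i\<in>#\<nu>. g i (add_mset c (\<nu> - {#i#})))"
  by (intro arg_cong[of _ _ sum_mset] image_mset_cong) (simp add: add_mset_minus_single)

lemma sum_mset_pairs_swap:
  "(\<Sum>j\<in>#\<mu>. \<Sum>i\<in>#\<mu> - {#j#}. g j i) = (\<Sum>j\<in>#\<mu>. \<Sum>i\<in>#\<mu> - {#j#}. g i j :: real)"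
proof (induction \<mu>)
  case (add x \<mu>)
  have "(\<Sum>j\<in>#add_mset x \<mu>. \<Sum>i\<in>#add_mset x \<mu> - {#j#}. h j i)
      = (\<Sum>i\<in>#\<mu>. h x i) + (\<Sum>j\<in>#\<mu>. h j x) + (\<Sum>j\<in>#\<mu>. \<Sum>i\<in>#\<mu> - {#j#}. h j i)" for h :: "_ \<Rightarrow> _ \<Rightarrow> real"
    using sum_mset_minus_add_mset[of "\<lambda>j M. \<Sum>i\<in>#M. h j i" x \<mu>] by (simp add: sum_mset.distrib)
  from this[of g] this[of "\<lambda>i j. g j i"] show ?case
    using add by simp
qed simp

lemma marked_sum_add_mset:
  "marked_sum a b H (add_mset c \<nu>) = ff (real c) a * H (add_mset (c + b) \<nu>)
    + (\<Sum>i\<in>#\<nu>. ff (real i) a * H (add_mset (i + b) (add_mset c (\<nu> - {#i#}))))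
    + (if a = 0 then H (add_mset b (add_mset c \<nu>)) else 0)"
  using sum_mset_minus_add_mset[of "\<lambda>i M. ff (real i) a * H (add_mset (i + b) M)" c \<nu>]
  by (simp add: marked_sum_def)

text \<open>Adding an element and marking a block commute as long as the new element is unmarked. If
  it carries one of the \<open>a\<close> marks, only \<open>a - 1\<close> marks remain for the old
  elements of its block, and the element itself is accounted for by enlarging with
  \<open>b + 1\<close>.\<close>

lemma grow_marked_sum:
  "grow (marked_sum a b H) \<mu> = marked_sum a b (grow H) \<mu> + real a * marked_sum (a - 1) (b + 1) H \<mu>"
proof -
  let ?r = "\<lambda>c j. H (add_mset c (\<mu> - {#j#}))"
  let ?p = "\<lambda>j i. ff (real i) a * H (add_mset (i + b) (add_mset (j + 1) (\<mu> - {#j#} - {#i#})))"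
  let ?z = "if a = 0 then 1 else 0 :: real"
  have "grow (marked_sum a b H) \<mu> =
      (\<Sum>j\<in>#\<mu>. ff (real j + 1) a * ?r (j + b + 1) j) + (\<Sum>j\<in>#\<mu>. \<Sum>i\<in>#\<mu> - {#j#}. ?p j i)
    + ?z * (\<Sum>j\<in>#\<mu>. H (add_mset b (add_mset (j + 1) (\<mu> - {#j#}))))
    + (ff 1 a * H (add_mset (b + 1) \<mu>)
      + (\<Sum>i\<in>#\<mu>. ff (real i) a * H (add_mset (i + b) (add_mset 1 (\<mu> - {#i#}))))
      + ?z * H (add_mset b (add_mset 1 \<mu>)))"
    unfolding grow_def marked_sum_def[of 0 1 _ \<mu>] marked_sum_add_mset
    by (simp add: sum_mset.distrib sum_mset_distrib_left add_ac)
  moreover have "marked_sum a b (grow H) \<mu> =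
      (\<Sum>j\<in>#\<mu>. ff (real j) a * ?r (j + b + 1) j) + (\<Sum>i\<in>#\<mu>. \<Sum>j\<in>#\<mu> - {#i#}. ?p j i)
    + (\<Sum>i\<in>#\<mu>. ff (real i) a * H (add_mset (i + b) (add_mset 1 (\<mu> - {#i#}))))
    + ?z * (H (add_mset (b + 1) \<mu>) + (\<Sum>j\<in>#\<mu>. H (add_mset b (add_mset (j + 1) (\<mu> - {#j#}))))
      + H (add_mset b (add_mset 1 \<mu>)))"
  proof -
    have "(\<Sum>i\<in>#\<mu>. ff (real i) a * (\<Sum>j\<in>#\<mu> - {#i#}. H (add_mset (Suc j) (add_mset (i + b) (\<mu> - {#i#} - {#j#})))))
        = (\<Sum>i\<in>#\<mu>. \<Sum>j\<in>#\<mu> - {#i#}. ?p j i)"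
      by (intro arg_cong[of _ _ sum_mset] image_mset_cong)
        (simp add: sum_mset_distrib_left add_mset_commute diff_right_commute)
    then show ?thesis
      unfolding grow_def marked_sum_def[of a b _ \<mu>] marked_sum_add_mset
      by (simp add: sum_mset.distrib sum_mset_distrib_left distrib_left add_ac add_mset_commute)
  qed
  moreover have "real a * marked_sum (a - 1) (b + 1) H \<mu> =
      (\<Sum>j\<in>#\<mu>. real a * ff (real j) (a - 1) * ?r (j + b + 1) j) + (if a = 1 then 1 else 0) * H (add_mset (b + 1) \<mu>)"
    unfolding marked_sum_def by (simp add: sum_mset_distrib_left algebra_simps)
  moreover have "(\<Sum>j\<in>#\<mu>. ff (real j + 1) a * ?r (j + b + 1) j) = (\<Sum>j\<in>#\<mu>. ff (real j) a * ?r (j + b + 1) j)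
      + (\<Sum>j\<in>#\<mu>. real a * ff (real j) (a - 1) * ?r (j + b + 1) j)"
    unfolding ff_step sum_mset.distrib[symmetric] by (simp add: distrib_right)
  \<comment> \<open>The block opened by the new element has a single element, which leaves room for
    no mark or for one.\<close>
  moreover have "ff 1 a = ?z + (if a = 1 then 1 else 0)"
    using ff_step[of 0 a] by (auto simp: ff_zero)
  moreover have "(\<Sum>j\<in>#\<mu>. \<Sum>i\<in>#\<mu> - {#j#}. ?p j i) = (\<Sum>i\<in>#\<mu>. \<Sum>j\<in>#\<mu> - {#i#}. ?p j i)"
    by (rule sum_mset_pairs_swap[where g = ?p])
  ultimately show ?thesis
    by (simp add: algebra_simps)
qed

lemma marked_sum_linear:
  "marked_sum a b (\<lambda>\<mu>. X \<mu> + c * Y \<mu>) = (\<lambda>\<mu>. marked_sum a b X \<mu> + c * marked_sum a b Y \<mu>)"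
  by (auto simp: fun_eq_iff marked_sum_def sum_mset.distrib sum_mset_distrib_left algebra_simps)

lemma grow_iter_linear:
  "(grow ^^ n) (\<lambda>\<mu>. X \<mu> + c * Y \<mu>) = (\<lambda>\<mu>. (grow ^^ n) X \<mu> + c * (grow ^^ n) Y \<mu>)"
  by (induction n) (simp_all add: grow_def marked_sum_linear)

lemma grow_iter_zero: "(grow ^^ n) (\<lambda>\<mu>. 0) = (\<lambda>\<mu>. 0)"
  by (induction n) (auto simp: grow_def marked_sum_def fun_eq_iff)

lemma grow_iter_sum:
  "finite S \<Longrightarrow> (grow ^^ n) (\<lambda>\<mu>. \<Sum>k\<in>S. X k \<mu>) \<nu> = (\<Sum>k\<in>S. (grow ^^ n) (X k) \<nu>)"
proof (induction S rule: finite_induct)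
  case (insert k S)
  then show ?case
    using grow_iter_linear[of n "X k" 1 "\<lambda>\<mu>. \<Sum>k\<in>S. X k \<mu>"] by simp
qed (simp add: grow_iter_zero)

lemma grow_iter_mono:
  assumes "\<And>\<mu>. int_partition \<mu> \<Longrightarrow> \<Sum>\<^sub># \<mu> = m + n \<Longrightarrow> X \<mu> \<le> Y \<mu>" "int_partition \<nu>" "\<Sum>\<^sub># \<nu> = m"
  shows "(grow ^^ n) X \<nu> \<le> (grow ^^ n) Y \<nu>"
  using assms
proof (induction n arbitrary: m \<nu>)
  case (Suc n)
  have *: "(grow ^^ n) X \<mu> \<le> (grow ^^ n) Y \<mu>" if "int_partition \<mu>" "\<Sum>\<^sub># \<mu> = Suc m" for \<mu>
    using Suc.prems(1) that by (intro Suc.IH[of "Suc m"]) auto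
  have "(grow ^^ n) X (add_mset (j + 1) (\<nu> - {#j#})) \<le> (grow ^^ n) Y (add_mset (j + 1) (\<nu> - {#j#}))"
    if "j \<in># \<nu>" for j
    using that Suc.prems(2,3) by (intro *) (auto simp: sum_mset.remove[of j \<nu>])
  moreover have "(grow ^^ n) X (add_mset 1 \<nu>) \<le> (grow ^^ n) Y (add_mset 1 \<nu>)"
    using Suc.prems(2,3) by (intro *) auto
  ultimately show ?case
    unfolding funpow.simps comp_def grow_def marked_sum_def
    by (auto intro!: add_mono sum_mset_mono)
qed auto

lemma grow_iter_cong:
  assumes "\<And>\<mu>. int_partition \<mu> \<Longrightarrow> X \<mu> = Y \<mu>" "int_partition \<nu>"
  shows "(grow ^^ n) X \<nu> = (grow ^^ n) Y \<nu>"
  using assms by (intro antisym grow_iter_mono) auto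

lemma grow_iter_marked_sum:
  "(grow ^^ Suc n) (marked_sum a b H) \<nu>
    = (grow ^^ n) (marked_sum a b (grow H)) \<nu> + real a * (grow ^^ n) (marked_sum (a - 1) (b + 1) H) \<nu>"
proof -
  have "grow (marked_sum a b H) = (\<lambda>\<mu>. marked_sum a b (grow H) \<mu> + real a * marked_sum (a - 1) (b + 1) H \<mu>)"
    using grow_marked_sum by blast
  then show ?thesis
    by (simp add: funpow_swap1 grow_iter_linear)
qed

text \<open>The marked elements can be chosen in \<open>ff n a\<close> ways; merged with the
  \<open>b\<close> additional elements they form the block \<open>{#a + b#}\<close>, to which the
  other \<open>n - a\<close> elements are added one at a time.\<close>

lemma grow_iter_marked_sum_empty:
  "(grow ^^ n) (marked_sum a b H) {#} = ff (real n) a * (grow ^^ (n - a)) H {#a + b#}"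
proof (induction n arbitrary: a b H)
  case 0
  then show ?case
    by (simp add: marked_sum_def ff_zero)
next
  case (Suc n)
  have step: "(grow ^^ Suc n) (marked_sum a b H) {#} = ff (real n) a * (grow ^^ Suc (n - a)) H {#a + b#}
      + real a * (ff (real n) (a - 1) * (grow ^^ (n - (a - 1))) H {#a - 1 + (b + 1)#})"
    unfolding grow_iter_marked_sum Suc by (simp add: funpow_swap1)
  show ?case
  proof (cases a)
    case 0
    then show ?thesis
      unfolding step by simp
  next
    case (Suc c)
    show ?thesis
    proof (cases "a \<le> n")
      case True
      then have *: "Suc (n - a) = n - c" "Suc n - a = n - c" "n - (a - 1) = n - c"
        using Suc by auto
      have "ff (real (Suc n)) a = ff (real n) a + real a * ff (real n) (a - 1)"
        using ff_step[of "real n" a] by (simp only: of_nat_Suc add.commute)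
      then show ?thesis
        unfolding step * using Suc by (simp add: algebra_simps)
    next
      case False
      \<comment> \<open>Truncation makes \<open>Suc (n - a)\<close> differ from
        \<open>Suc n - a\<close> here, but the term with this exponent has coefficient 0.\<close>
      then have zero: "ff (real n) a = 0"
        by (intro ff_eq_0) linarith
      have "ff (real (Suc n)) a = ff (real n) a + real a * ff (real n) (a - 1)"
        using ff_step[of "real n" a] by (simp only: of_nat_Suc add.commute)
      moreover have "n - (a - 1) = Suc n - a"
        using Suc by simp
      ultimately show ?thesis
        unfolding step zero using Suc by (simp only: mult.assoc) simp
    qed
  qed
qed

definition ff_power_sum :: "nat \<Rightarrow> nat multiset \<Rightarrow> real" where
  "ff_power_sum k \<mu> = (\<Sum>j\<in>#\<mu>. ff (real j) k)"

text \<open>Enlarging by 0 leaves the partition unchanged, so multiplication by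
  \<open>ff_power_sum k\<close> is a marking operator and its moments fall under the commutation
  rule. For \<open>k = 0\<close> the empty block would contribute as well.\<close>

lemma marked_sum_0:
  assumes "0 < k"
  shows "marked_sum k 0 H = (\<lambda>\<mu>. H \<mu> * ff_power_sum k \<mu>)"
proof
  fix \<mu>
  have "image_mset (\<lambda>j. ff (real j) k * H (add_mset (j + 0) (\<mu> - {#j#}))) \<mu> = image_mset (\<lambda>j. H \<mu> * ff (real j) k) \<mu>"
    by (intro image_mset_cong) simp
  then show "marked_sum k 0 H \<mu> = H \<mu> * ff_power_sum k \<mu>"
    using assms unfolding marked_sum_def ff_power_sum_def by (simp add: sum_mset_distrib_left)
qed

section \<open>Random partitions weighted by a multiplicative function\<close>

locale kingman =
  fixes h :: "nat multiset \<Rightarrow> real"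
  assumes stuffle: "stuffle h"
    and nonneg: "int_partition \<mu> \<Longrightarrow> 0 \<le> h \<mu>"
    and one: "h {#1#} = 1"
begin

lemma h_empty: "h {#} = 1"
  using stuffle by (simp add: stuffle_def)

lemma mult_single:
  "0 < b \<Longrightarrow> int_partition \<mu> \<Longrightarrow> marked_sum 0 b h \<mu> = h {#b#} * h \<mu>"
  using stuffle by (simp add: stuffle_def marked_sum_def)

text \<open>The product rule at \<open>k = 1\<close> is harmonicity on the graph of partitions.
  Hence the weights \<open>h\<close> of the set partitions of an \<open>n\<close>-element set sum to
  1.\<close>

lemma grow_h: "int_partition \<mu> \<Longrightarrow> grow h \<mu> = h \<mu>"
  using mult_single[of 1 \<mu>] one by (simp add: grow_def)

lemma grow_iter_h: "int_partition \<mu> \<Longrightarrow> (grow ^^ n) h \<mu> = h \<mu>"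
proof (induction n)
  case (Suc n)
  have "(grow ^^ Suc n) h \<mu> = (grow ^^ n) (grow h) \<mu>"
    by (simp add: funpow_swap1)
  also have "\<dots> = (grow ^^ n) h \<mu>"
    using Suc.prems by (intro grow_iter_cong grow_h)
  finally show ?case
    using Suc by simp
qed simp

lemma single_bounds:
  assumes "0 < k"
  shows "0 \<le> h {#k#}" "h {#k#} \<le> 1"
proof -
  show "0 \<le> h {#k#}"
    using assms by (intro nonneg) (simp add: int_partition_def)
  show "h {#k#} \<le> 1"
    using assms
  proof (induction k rule: nat_induct_non_zero)
    case (Suc k)
    have "h {#k#} = h {#Suc k#} + h {#1, k#}"
      using grow_h[of "{#k#}"] Suc by (simp add: grow_def marked_sum_def int_partition_def)
    moreover have "0 \<le> h {#1, k#}"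
      using Suc by (intro nonneg) (simp add: int_partition_def)
    ultimately show ?case
      using Suc by simp
  qed (use one in simp)
qed

text \<open>Start with a block of \<open>k\<close> old elements and add \<open>m\<close> new ones.
  Marks on new elements only can be placed in \<open>ff m a\<close> ways; each placement contributes
  \<open>h {#k#} * h {#a + b#}\<close>, since the product rule adds up the cases where the marked
  block contains the old elements or does not. The other \<open>ff (m + k) a - ff m a\<close>
  placements involve an old element and are worth between 0 and 1 each. The induction trades a mark
  for an increase of \<open>b\<close>.\<close>

lemma second_moment_aux:
  assumes k: "0 < k"
  shows "0 < a + b \<Longrightarrow> \<bar>(grow ^^ m) (marked_sum a b h) {#k#} - ff (real m) a * (h {#k#} * h {#a + b#})\<bar>
    \<le> ff (real (m + k)) a - ff (real m) a"
proof (induction m arbitrary: a b)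
  case 0
  show ?case
  proof (cases "a = 0")
    case True
    then show ?thesis
      using 0 k mult_single[of b "{#k#}"] by (simp add: int_partition_def)
  next
    case False
    have "\<bar>ff (real k) a * h {#k + b#}\<bar> \<le> ff (real k) a * 1"
      using k ff_nonneg[of k a] single_bounds[of "k + b"] by (simp add: abs_mult mult_left_le)
    then show ?thesis
      using False by (simp add: marked_sum_def ff_zero)
  qed
next
  case (Suc m)
  show ?case
  proof (cases a)
    case 0
    have "(grow ^^ Suc m) (marked_sum 0 b h) {#k#} = (grow ^^ Suc m) (\<lambda>\<mu>. 0 + h {#b#} * h \<mu>) {#k#}"
      using Suc.prems 0 k mult_single by (intro grow_iter_cong) (auto simp: int_partition_def)
    also have "\<dots> = h {#b#} * h {#k#}"
      unfolding grow_iter_linear grow_iter_zero using k by (subst grow_iter_h) (auto simp: int_partition_def)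
    finally show ?thesis
      using 0 by simp
  next
    case (Suc c)
    let ?q = "h {#k#} * h {#a + b#}"
    let ?X = "(grow ^^ m) (marked_sum a b h) {#k#}" and ?Y = "(grow ^^ m) (marked_sum c (b + 1) h) {#k#}"
    have "marked_sum a b (grow h) \<mu> = marked_sum a b h \<mu>" if "int_partition \<mu>" for \<mu>
    proof -
      have "image_mset (\<lambda>j. ff (real j) a * grow h (add_mset (j + b) (\<mu> - {#j#}))) \<mu>
          = image_mset (\<lambda>j. ff (real j) a * h (add_mset (j + b) (\<mu> - {#j#}))) \<mu>"
      proof (rule image_mset_cong)
        fix j assume "j \<in># \<mu>"
        then have "0 < j"
          using that by (auto simp: int_partition_def intro: gr0I)
        then show "ff (real j) a * grow h (add_mset (j + b) (\<mu> - {#j#})) = ff (real j) a * h (add_mset (j + b) (\<mu> - {#j#}))"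
          using that by (subst grow_h) auto
      qed
      then show ?thesis
        unfolding marked_sum_def[of a b] using Suc by simp
    qed
    then have "(grow ^^ m) (marked_sum a b (grow h)) {#k#} = ?X"
      using k by (intro grow_iter_cong) (auto simp: int_partition_def)
    then have eq: "(grow ^^ Suc m) (marked_sum a b h) {#k#} = ?X + real a * ?Y"
      unfolding grow_iter_marked_sum using Suc by simp
    have X: "\<bar>?X - ff (real m) a * ?q\<bar> \<le> ff (real (m + k)) a - ff (real m) a"
      using Suc.IH[of a b] Suc.prems by simp
    \<comment> \<open>One mark less and one added element keep \<open>c + (b + 1) = a + b\<close>,
      so the same product \<open>?q\<close> appears.\<close>
    have "\<bar>?Y - ff (real m) c * ?q\<bar> \<le> ff (real (m + k)) c - ff (real m) c"
      using Suc.IH[of c "b + 1"] Suc by simp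
    then have Y: "real a * \<bar>?Y - ff (real m) c * ?q\<bar> \<le> real a * (ff (real (m + k)) c - ff (real m) c)"
      by (intro mult_left_mono) auto
    have ff: "ff (real (Suc m)) a = ff (real m) a + real a * ff (real m) c"
      "ff (real (Suc m + k)) a = ff (real (m + k)) a + real a * ff (real (m + k)) c"
      using ff_step[of "real m" a] ff_step[of "real (m + k)" a] Suc by (simp_all add: add_ac)
    have "\<bar>?X + real a * ?Y - ff (real (Suc m)) a * ?q\<bar>
        = \<bar>(?X - ff (real m) a * ?q) + real a * (?Y - ff (real m) c * ?q)\<bar>"
      unfolding ff by (simp add: algebra_simps)
    also have "\<dots> \<le> \<bar>?X - ff (real m) a * ?q\<bar> + real a * \<bar>?Y - ff (real m) c * ?q\<bar>"
      using abs_triangle_ineq[of "?X - ff (real m) a * ?q" "real a * (?Y - ff (real m) c * ?q)"]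
      by (simp add: abs_mult)
    also have "\<dots> \<le> ff (real (Suc m + k)) a - ff (real (Suc m)) a"
      using X Y unfolding ff by (simp add: algebra_simps)
    finally show ?thesis
      unfolding eq .
  qed
qed

text \<open>The expectation of \<open>G\<close> at the block sizes of a random set partition of an
  \<open>n\<close>-element set, each set partition having as probability the value of
  \<open>h\<close> at its block sizes.\<close>

definition expect :: "nat \<Rightarrow> (nat multiset \<Rightarrow> real) \<Rightarrow> real" where
  "expect n G = (grow ^^ n) (\<lambda>\<mu>. h \<mu> * G \<mu>) {#}"

lemma first_moment: "0 < k \<Longrightarrow> expect n (ff_power_sum k) = ff (real n) k * h {#k#}"
  unfolding expect_def marked_sum_0[symmetric] grow_iter_marked_sum_empty
  by (subst grow_iter_h) (auto simp: int_partition_def)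

text \<open>Squaring \<open>ff_power_sum k\<close> applies \<open>marked_sum k 0\<close> twice. The
  outer one is resolved exactly and leaves \<open>n - k\<close> steps from the block
  \<open>{#k#}\<close>; for these, \<open>second_moment_aux\<close> bounds the deviation.\<close>

lemma second_moment:
  assumes "0 < k"
  shows "\<bar>expect n (\<lambda>\<mu>. (ff_power_sum k \<mu>)\<^sup>2) - ff (real n) k * (ff (real (n - k)) k * (h {#k#})\<^sup>2)\<bar>
    \<le> ff (real n) k * (ff (real n) k - ff (real (n - k)) k)"
proof (cases "k \<le> n")
  case True
  have "expect n (\<lambda>\<mu>. (ff_power_sum k \<mu>)\<^sup>2) = (grow ^^ n) (marked_sum k 0 (marked_sum k 0 h)) {#}"
    unfolding expect_def marked_sum_0[OF assms] by (simp add: power2_eq_square mult_ac)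
  also have "\<dots> = ff (real n) k * (grow ^^ (n - k)) (marked_sum k 0 h) {#k#}"
    unfolding grow_iter_marked_sum_empty by simp
  finally have eq: "expect n (\<lambda>\<mu>. (ff_power_sum k \<mu>)\<^sup>2) = ff (real n) k * (grow ^^ (n - k)) (marked_sum k 0 h) {#k#}" .
  have "ff (real n) k * \<bar>(grow ^^ (n - k)) (marked_sum k 0 h) {#k#} - ff (real (n - k)) k * (h {#k#})\<^sup>2\<bar>
      \<le> ff (real n) k * (ff (real n) k - ff (real (n - k)) k)"
    using second_moment_aux[OF assms, of k 0 "n - k"] assms True
    by (intro mult_left_mono ff_nonneg) (simp add: power2_eq_square)
  then show ?thesis
    unfolding eq by (simp add: abs_mult ff_nonneg right_diff_distrib[symmetric] flip: mult.assoc)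
      (simp add: abs_mult ff_nonneg right_diff_distrib[symmetric] mult.assoc)
next
  case False
  then have "ff (real n) k = 0"
    by (intro ff_eq_0) simp
  moreover have "expect n (\<lambda>\<mu>. (ff_power_sum k \<mu>)\<^sup>2) = (grow ^^ n) (marked_sum k 0 (marked_sum k 0 h)) {#}"
    unfolding expect_def marked_sum_0[OF assms] by (simp add: power2_eq_square mult_ac)
  ultimately show ?thesis
    unfolding grow_iter_marked_sum_empty by simp
qed

lemma expect_const: "expect n (\<lambda>\<mu>. c) = c"
  using grow_iter_linear[of n "\<lambda>\<mu>. 0" c h] grow_iter_h[of "{#}" n]
  by (simp add: expect_def grow_iter_zero int_partition_def h_empty mult.commute)

lemma expect_linear: "expect n (\<lambda>\<mu>. G \<mu> + c * G' \<mu>) = expect n G + c * expect n G'"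
  using grow_iter_linear[of n "\<lambda>\<mu>. h \<mu> * G \<mu>" c "\<lambda>\<mu>. h \<mu> * G' \<mu>"]
  by (simp add: expect_def algebra_simps)

lemma expect_sum: "finite S \<Longrightarrow> expect n (\<lambda>\<mu>. \<Sum>k\<in>S. G k \<mu>) = (\<Sum>k\<in>S. expect n (G k))"
  by (simp add: expect_def sum_distrib_left grow_iter_sum)

lemma expect_mono:
  assumes "\<And>\<mu>. int_partition \<mu> \<Longrightarrow> \<Sum>\<^sub># \<mu> = n \<Longrightarrow> G \<mu> \<le> G' \<mu>"
  shows "expect n G \<le> expect n G'"
  unfolding expect_def using assms nonneg
  by (intro grow_iter_mono[of 0]) (auto intro!: mult_left_mono simp: int_partition_def)

text \<open>Both \<open>ff n k\<close> and \<open>ff (n - k) k\<close> are asymptotic to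
  \<open>n ^ k\<close>. So, after scaling, the error in the second moment vanishes, and the second
  moment tends to the square of the limit of the mean.\<close>

lemma variance_tendsto_0:
  assumes k: "0 < k"
  shows "(\<lambda>n. expect n (\<lambda>\<mu>. (ff_power_sum k \<mu> / real n ^ k - h {#k#})\<^sup>2)) \<longlonglongrightarrow> 0"
proof -
  let ?q = "h {#k#}"
  let ?f = "\<lambda>n. ff (real n) k / real n ^ k" and ?g = "\<lambda>n. ff (real (n - k)) k / real n ^ k"
  let ?s = "\<lambda>n. expect n (\<lambda>\<mu>. (ff_power_sum k \<mu>)\<^sup>2) / real n ^ (2 * k)"
  have f: "?f \<longlonglongrightarrow> 1"
    using ff_asymp[of 0 k] by simp
  have g: "?g \<longlonglongrightarrow> 1"
  proof (rule Lim_transform_eventually[OF ff_asymp[of "real k" k]])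
    show "eventually (\<lambda>n. ff (real n - real k) k / real n ^ k = ?g n) sequentially"
      using eventually_ge_at_top[of k] by eventually_elim (simp add: of_nat_diff)
  qed
  have "eventually (\<lambda>n. norm (?s n - ?f n * ?g n * ?q\<^sup>2) \<le> ?f n * (?f n - ?g n)) sequentially"
    using eventually_gt_at_top[of 0]
  proof eventually_elim
    case (elim n)
    let ?p = "real n ^ k"
    have p: "0 < ?p" and pp: "real n ^ (2 * k) = ?p * ?p"
      using elim by (simp_all add: power_add mult_2)
    have "?s n - ?f n * ?g n * ?q\<^sup>2 =
        (expect n (\<lambda>\<mu>. (ff_power_sum k \<mu>)\<^sup>2) - ff (real n) k * (ff (real (n - k)) k * ?q\<^sup>2)) / (?p * ?p)"
      unfolding pp by (simp add: diff_divide_distrib)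
    moreover have "?f n * (?f n - ?g n) = (ff (real n) k * (ff (real n) k - ff (real (n - k)) k)) / (?p * ?p)"
      by (simp add: diff_divide_distrib[symmetric])
    ultimately show ?case
      using second_moment[OF k, of n] p by (simp add: divide_right_mono)
  qed
  moreover have "(\<lambda>n. ?f n * (?f n - ?g n)) \<longlonglongrightarrow> 1 * (1 - 1)"
    by (intro tendsto_intros f g)
  then have "(\<lambda>n. ?f n * (?f n - ?g n)) \<longlonglongrightarrow> 0"
    by simp
  ultimately have "(\<lambda>n. ?s n - ?f n * ?g n * ?q\<^sup>2) \<longlonglongrightarrow> 0"
    by (rule Lim_null_comparison)
  from tendsto_add[OF this tendsto_mult[OF tendsto_mult[OF f g] tendsto_const[of "?q\<^sup>2"]]]
  have s: "?s \<longlonglongrightarrow> ?q\<^sup>2"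
    by simp
  have "expect n (\<lambda>\<mu>. (ff_power_sum k \<mu> / real n ^ k - ?q)\<^sup>2) = ?s n - 2 * ?q * (?f n * ?q) + ?q\<^sup>2" for n
  proof -
    let ?a = "1 / real n ^ (2 * k)" and ?b = "- 2 * ?q / real n ^ k"
    have "(ff_power_sum k \<mu> / real n ^ k - ?q)\<^sup>2
        = (?q\<^sup>2 + ?a * (ff_power_sum k \<mu>)\<^sup>2) + ?b * ff_power_sum k \<mu>" for \<mu>
      unfolding power2_diff power_divide power_even_eq by simp
    then have "expect n (\<lambda>\<mu>. (ff_power_sum k \<mu> / real n ^ k - ?q)\<^sup>2)
        = expect n (\<lambda>\<mu>. (?q\<^sup>2 + ?a * (ff_power_sum k \<mu>)\<^sup>2) + ?b * ff_power_sum k \<mu>)"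
      by presburger
    also have "\<dots> = expect n (\<lambda>\<mu>. ?q\<^sup>2 + ?a * (ff_power_sum k \<mu>)\<^sup>2) + ?b * expect n (ff_power_sum k)"
      by (rule expect_linear)
    also have "expect n (\<lambda>\<mu>. ?q\<^sup>2 + ?a * (ff_power_sum k \<mu>)\<^sup>2)
        = expect n (\<lambda>\<mu>. ?q\<^sup>2) + ?a * expect n (\<lambda>\<mu>. (ff_power_sum k \<mu>)\<^sup>2)"
      by (rule expect_linear)
    finally show ?thesis
      unfolding first_moment[OF k] expect_const by simp
  qed
  moreover have "(\<lambda>n. ?s n - 2 * ?q * (?f n * ?q) + ?q\<^sup>2) \<longlonglongrightarrow> ?q\<^sup>2 - 2 * ?q * (1 * ?q) + ?q\<^sup>2"
    by (intro tendsto_intros f s)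
  ultimately show ?thesis
    by (simp add: power2_eq_square)
qed

text \<open>If all partitions of \<open>n\<close> had total squared error at least \<epsilon>, so
  would its expectation, which becomes small for large \<open>n\<close>.\<close>

lemma ex_approximating_partition:
  assumes "0 < \<epsilon>"
  shows "\<exists>n \<nu>. N < n \<and> int_partition \<nu> \<and> \<Sum>\<^sub># \<nu> = n
    \<and> (\<Sum>k=2..N. (ff_power_sum k \<nu> / real n ^ k - h {#k#})\<^sup>2) < \<epsilon>" (is ?goal)
proof (rule ccontr)
  assume no: "\<not> ?goal"
  let ?V = "\<lambda>n k \<mu>. (ff_power_sum k \<mu> / real n ^ k - h {#k#})\<^sup>2"
  have "(\<lambda>n. \<Sum>k=2..N. expect n (?V n k)) \<longlonglongrightarrow> (\<Sum>k=2..N. 0)"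
    by (intro tendsto_sum variance_tendsto_0) auto
  then have "eventually (\<lambda>n. (\<Sum>k=2..N. expect n (?V n k)) < \<epsilon>) sequentially"
    by (rule order_tendstoD(2)) (use assms in simp)
  then have "eventually (\<lambda>n. (\<Sum>k=2..N. expect n (?V n k)) < \<epsilon> \<and> N < n) sequentially"
    using eventually_gt_at_top[of N] by eventually_elim simp
  from eventually_happens'[OF sequentially_bot this]
  obtain n where "(\<Sum>k=2..N. expect n (?V n k)) < \<epsilon> \<and> N < n" ..
  then have n: "(\<Sum>k=2..N. expect n (?V n k)) < \<epsilon>" "N < n"
    by simp_all
  have "expect n (\<lambda>\<mu>. \<epsilon>) \<le> expect n (\<lambda>\<mu>. \<Sum>k=2..N. ?V n k \<mu>)"
  proof (rule expect_mono)
    fix \<mu> assume \<mu>: "int_partition \<mu>" "\<Sum>\<^sub># \<mu> = n"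
    show "\<epsilon> \<le> (\<Sum>k=2..N. ?V n k \<mu>)"
    proof (rule ccontr)
      assume "\<not> \<epsilon> \<le> (\<Sum>k=2..N. ?V n k \<mu>)"
      then have less: "(\<Sum>k=2..N. ?V n k \<mu>) < \<epsilon>"
        by simp
      have ?goal
        by (rule exI[of _ n], rule exI[of _ \<mu>]) (intro conjI n(2) \<mu> less)
      then show False
        using no by contradiction
    qed
  qed
  also have "\<dots> = (\<Sum>k=2..N. expect n (?V n k))"
    by (rule expect_sum) simp
  finally show False
    using n(1) unfolding expect_const by simp
qed

end

section \<open>The Kingman simplex\<close>

lemma tendsto_coordinate:
  fixes x :: "nat \<Rightarrow> nat \<Rightarrow> real"
  assumes "x \<longlonglongrightarrow> l"
  shows "(\<lambda>n. x n i) \<longlonglongrightarrow> l i"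
proof -
  have "isCont (\<lambda>f::nat \<Rightarrow> real. f i) l"
    using continuous_on_product_coordinates[of i] continuous_on_eq_continuous_at open_UNIV by blast
  then show ?thesis
    using assms by (rule isCont_tendsto_compose)
qed

lemma Nabla_le_inverse:
  assumes "p \<in> Nabla"
  shows "p i \<le> inverse (real (Suc i))"
proof -
  note p = NablaD[OF assms]
  have "real (Suc i) * p i = (\<Sum>j\<le>i. p i)"
    by simp
  also have "\<dots> \<le> (\<Sum>j\<le>i. p j)"
    using p(1) by (intro sum_mono) (auto simp: antimono_def)
  also have "\<dots> \<le> suminf p"
    using p by (intro sum_le_suminf) auto
  finally have "real (Suc i) * p i \<le> 1"
    using p(4) by simp
  then show ?thesis
    by (simp add: field_simps)
qed

text \<open>The decreasing order and total mass at most 1 bound entry \<open>i\<close> by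
  \<open>1 / (i + 1)\<close>. For \<open>k \<ge> 2\<close> the squares of these bounds form a
  summable majorant independent of \<open>n\<close>, which allows limit and sum to be
  exchanged.\<close>

lemma Nabla_power_sum_tendsto:
  assumes x: "\<And>n. x n \<in> Nabla" and lim: "\<And>i. (\<lambda>n::nat. x n i) \<longlonglongrightarrow> l i" and k: "2 \<le> k"
  shows "(\<lambda>n. suminf (\<lambda>i. x n i ^ k)) \<longlonglongrightarrow> suminf (\<lambda>i. l i ^ k)"
proof -
  let ?M = "\<lambda>i. inverse (real (Suc i) ^ 2)"
  have "summable ?M"
    using inverse_power_summable[where 'a = real, OF order_refl] summable_iff_shift[of "\<lambda>i. inverse (real i ^ 2)" 1] by simp
  moreover have bound: "norm (x n i ^ k) \<le> ?M i" for n i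
  proof -
    note p = NablaD[OF x[of n]]
    have "x n i ^ k \<le> x n i ^ 2"
      using p k by (intro power_decreasing) auto
    also have "\<dots> \<le> inverse (real (Suc i)) ^ 2"
      using p Nabla_le_inverse[OF x[of n], of i] by (intro power_mono) auto
    finally show ?thesis
      using p(2)[of i] by (simp add: power_inverse)
  qed
  ultimately show ?thesis
    using tannerys_theorem[of "\<lambda>i n. x n i ^ k" "\<lambda>i. l i ^ k" sequentially ?M] lim
    by (simp add: tendsto_power case_prod_unfold)
qed

lemma Nabla_limit:
  assumes x: "\<And>n. x n \<in> Nabla" and lim: "\<And>i. (\<lambda>n::nat. x n i) \<longlonglongrightarrow> l i"
  shows "l \<in> Nabla"
proof -
  have anti: "l j \<le> l i" if "i \<le> j" for i j
  proof (rule LIMSEQ_le[OF lim lim], intro exI allI impI)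
    show "x n j \<le> x n i" for n
      using NablaD(1)[OF x] that by (auto simp: antimono_def)
  qed
  have nonneg: "0 \<le> l i" for i
    by (rule LIMSEQ_le_const[OF lim]) (use NablaD(2)[OF x] in blast)
  have le: "(\<Sum>i<m. l i) \<le> 1" for m
  proof (rule LIMSEQ_le_const2)
    show "(\<lambda>n. \<Sum>i<m. x n i) \<longlonglongrightarrow> (\<Sum>i<m. l i)"
      by (intro tendsto_sum lim)
    have "(\<Sum>i<m. x n i) \<le> 1" for n
    proof -
      note p = NablaD[OF x[of n]]
      have "(\<Sum>i<m. x n i) \<le> suminf (x n)"
        using p by (intro sum_le_suminf) auto
      then show ?thesis
        using p(4) by linarith
    qed
    then show "\<exists>N. \<forall>n\<ge>N. (\<Sum>i<m. x n i) \<le> 1"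
      by blast
  qed
  have "summable l"
    using nonneg le by (rule summableI_nonneg_bounded)
  then show ?thesis
    using anti nonneg suminf_le_const[OF _ le] by (auto simp: Nabla_def antimono_def)
qed

lemma compact_Nabla: "compact Nabla"
proof -
  let ?C = "PiE UNIV (\<lambda>_::nat. {0..1::real})"
  have "compactin (product_topology (\<lambda>i. euclidean) UNIV) ?C"
    by (simp add: compactin_PiE)
  then have "compact ?C"
    by (simp add: euclidean_product_topology)
  moreover have "closed Nabla"
    unfolding closed_sequential_limits
  proof (intro allI impI)
    fix x l assume xl: "(\<forall>n. x n \<in> Nabla) \<and> x \<longlonglongrightarrow> l"
    have "x n \<in> Nabla" for n
      using xl by simp
    moreover have "(\<lambda>n. x n i) \<longlonglongrightarrow> l i" for i
      using xl by (intro tendsto_coordinate) simp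
    ultimately show "l \<in> Nabla"
      by (rule Nabla_limit)
  qed
  ultimately have "compact (?C \<inter> Nabla)"
    by (rule compact_Int_closed)
  moreover have "Nabla \<subseteq> ?C"
  proof
    fix p assume "p \<in> Nabla"
    from NablaD(2,5)[OF this] show "p \<in> ?C"
      by (simp add: PiE_def)
  qed
  then have "?C \<inter> Nabla = Nabla"
    by blast
  ultimately show ?thesis
    by simp
qed

section \<open>Partitions as points of the simplex\<close>

definition partition_point :: "nat multiset \<Rightarrow> nat \<Rightarrow> real" where
  "partition_point \<nu> i =
     (if i < size \<nu> then real (rev (sorted_list_of_multiset \<nu>) ! i) / real (\<Sum>\<^sub># \<nu>) else 0)"

lemma length_sorted_list_of_multiset: "length (sorted_list_of_multiset \<nu>) = size \<nu>"
  by (metis mset_sorted_list_of_multiset size_mset)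

lemma suminf_partition_point:
  assumes "0 < k"
  shows "summable (\<lambda>i. partition_point \<nu> i ^ k)"
    and "suminf (\<lambda>i. partition_point \<nu> i ^ k) = (\<Sum>j\<in>#\<nu>. (real j / real (\<Sum>\<^sub># \<nu>)) ^ k)"
proof -
  let ?xs = "rev (sorted_list_of_multiset \<nu>)"
  let ?g = "\<lambda>j. (real j / real (\<Sum>\<^sub># \<nu>)) ^ k"
  have zero: "partition_point \<nu> i ^ k = 0" if "i \<notin> {..<size \<nu>}" for i
    using that assms by (simp add: partition_point_def)
  show "summable (\<lambda>i. partition_point \<nu> i ^ k)"
    by (rule summable_finite[of "{..<size \<nu>}"]) (use zero in auto)
  have "suminf (\<lambda>i. partition_point \<nu> i ^ k) = (\<Sum>i<size \<nu>. partition_point \<nu> i ^ k)"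
    by (rule suminf_finite) (use zero in auto)
  also have "\<dots> = (\<Sum>i<length ?xs. ?g (?xs ! i))"
    by (intro sum.cong) (auto simp: partition_point_def length_sorted_list_of_multiset)
  also have "\<dots> = sum_list (map ?g ?xs)"
    by (simp add: sum_list_sum_nth atLeast0LessThan)
  also have "\<dots> = \<Sum>\<^sub># (mset (map ?g ?xs))"
    by (rule sum_mset_sum_list[symmetric])
  finally show "suminf (\<lambda>i. partition_point \<nu> i ^ k) = (\<Sum>j\<in>#\<nu>. ?g j)"
    by simp
qed

lemma real_sum_mset: "real (\<Sum>\<^sub># \<nu>) = (\<Sum>j\<in>#\<nu>. real j)"
  by (induction \<nu>) auto

lemma partition_point_in_Nabla: "partition_point \<nu> \<in> Nabla"
proof -
  let ?xs = "rev (sorted_list_of_multiset \<nu>)"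
  have nonneg: "0 \<le> partition_point \<nu> i" for i
    unfolding partition_point_def by (simp only: divide_nonneg_nonneg of_nat_0_le_iff if_split order_refl simp_thms)
  have "partition_point \<nu> j \<le> partition_point \<nu> i" if "i \<le> j" for i j
  proof (cases "j < size \<nu>")
    case True
    then have "?xs ! j \<le> ?xs ! i"
      using that by (intro sorted_rev_nth_mono) (auto simp: length_sorted_list_of_multiset)
    moreover have "partition_point \<nu> j = real (?xs ! j) / real (\<Sum>\<^sub># \<nu>)"
      "partition_point \<nu> i = real (?xs ! i) / real (\<Sum>\<^sub># \<nu>)"
      using True that by (simp_all add: partition_point_def)
    ultimately show ?thesis
      by (simp only: divide_right_mono of_nat_le_iff of_nat_0_le_iff)
  next
    case False
    then have "partition_point \<nu> j = 0"
      by (simp add: partition_point_def)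
    then show ?thesis
      using nonneg by simp
  qed
  moreover have "summable (partition_point \<nu>)"
    using suminf_partition_point(1)[of 1 \<nu>] by simp
  moreover have "suminf (partition_point \<nu>) \<le> 1"
  proof -
    have "suminf (partition_point \<nu>) = (\<Sum>j\<in>#\<nu>. real j * (1 / real (\<Sum>\<^sub># \<nu>)))"
      using suminf_partition_point(2)[of 1 \<nu>] by simp
    also have "\<dots> = real (\<Sum>\<^sub># \<nu>) * (1 / real (\<Sum>\<^sub># \<nu>))"
      unfolding sum_mset_distrib_right[symmetric] real_sum_mset ..
    also have "\<dots> \<le> 1"
      by simp
    finally show ?thesis .
  qed
  ultimately show ?thesis
    using nonneg by (simp add: Nabla_def antimono_def)
qed

text \<open>One factor \<open>j\<close> is kept separate and only the others are bounded through
  \<open>n\<close>: summed over the parts it yields \<open>n\<close>, so the total error is of order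
  \<open>n ^ (k - 1)\<close>.\<close>

lemma power_minus_ff_le:
  assumes "j \<le> n" "2 \<le> k" "0 < j"
  shows "\<bar>real j ^ k - ff (real j) k\<bar> \<le> real j * ((real k)\<^sup>2 * real n ^ (k - 2))"
proof -
  obtain l where l: "k = Suc (Suc l)"
    using assms(2) by (metis add_2_eq_Suc le_Suc_ex)
  have "real j * (real j ^ k - ff (real j) k) \<le> real j * ((real k)\<^sup>2 * (real j * real j ^ l))"
    using power_minus_ff[of j k] by (simp add: l mult_ac)
  then have "real j ^ k - ff (real j) k \<le> (real k)\<^sup>2 * (real j * real j ^ l)"
    using assms(3) by simp
  also have "\<dots> \<le> (real k)\<^sup>2 * (real j * real n ^ l)"
    using assms(1) by (intro mult_left_mono power_mono) auto
  finally show ?thesis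
    using ff_le_power[of j k] by (simp add: l mult_ac)
qed

lemma abs_sum_mset_le: "\<bar>\<Sum>j\<in>#\<nu>. g j :: real\<bar> \<le> (\<Sum>j\<in>#\<nu>. \<bar>g j\<bar>)"
proof (induction \<nu>)
  case (add j \<nu>)
  then show ?case
    using abs_triangle_ineq[of "g j" "\<Sum>j\<in>#\<nu>. g j"] by simp
qed simp

lemma power_sum_approx:
  assumes \<nu>: "int_partition \<nu>" and n: "\<Sum>\<^sub># \<nu> = n" "0 < n" and k: "2 \<le> k"
  shows "\<bar>(\<Sum>j\<in>#\<nu>. (real j / real n) ^ k) - ff_power_sum k \<nu> / real n ^ k\<bar> \<le> (real k)\<^sup>2 / real n"
proof -
  let ?c = "(real k)\<^sup>2 * real n ^ (k - 2)"
  have "(\<Sum>j\<in>#\<nu>. \<bar>real j ^ k - ff (real j) k\<bar>) \<le> (\<Sum>j\<in>#\<nu>. real j * ?c)"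
  proof (rule sum_mset_mono)
    fix j assume j: "j \<in># \<nu>"
    have "j \<le> n"
      using sum_mset.remove[OF j] n(1) by simp
    moreover have "0 < j"
      using j \<nu> by (auto simp: int_partition_def intro: gr0I)
    ultimately show "\<bar>real j ^ k - ff (real j) k\<bar> \<le> real j * ?c"
      using k by (intro power_minus_ff_le)
  qed
  also have "\<dots> = real n * ?c"
    unfolding sum_mset_distrib_right[symmetric] real_sum_mset[symmetric] n(1) ..
  finally have le: "\<bar>\<Sum>j\<in>#\<nu>. real j ^ k - ff (real j) k\<bar> \<le> real n * ?c"
    using abs_sum_mset_le[of "\<lambda>j. real j ^ k - ff (real j) k" \<nu>] by linarith
  obtain l where l: "k = Suc (Suc l)"
    using k by (metis add_2_eq_Suc le_Suc_ex)
  have "(\<Sum>j\<in>#\<nu>. (real j / real n) ^ k) = (\<Sum>j\<in>#\<nu>. real j ^ k) / real n ^ k"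
    unfolding power_divide unfolding divide_inverse sum_mset_distrib_right ..
  moreover have "(\<Sum>j\<in>#\<nu>. real j ^ k - ff (real j) k) = (\<Sum>j\<in>#\<nu>. real j ^ k) - ff_power_sum k \<nu>"
    unfolding ff_power_sum_def by (induction \<nu>) auto
  ultimately have "(\<Sum>j\<in>#\<nu>. (real j / real n) ^ k) - ff_power_sum k \<nu> / real n ^ k
      = (\<Sum>j\<in>#\<nu>. real j ^ k - ff (real j) k) / real n ^ k"
    by (simp add: diff_divide_distrib)
  then have "\<bar>(\<Sum>j\<in>#\<nu>. (real j / real n) ^ k) - ff_power_sum k \<nu> / real n ^ k\<bar> \<le> (real n * ?c) / real n ^ k"
    using le n(2) by (simp add: divide_right_mono)
  also have "\<dots> = (real k)\<^sup>2 / real n"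
    using n(2) by (simp add: l)
  finally show ?thesis .
qed

context kingman
begin

lemma ex_Nabla_power_sums: "\<exists>p\<in>Nabla. \<forall>k\<ge>2. h {#k#} = suminf (\<lambda>i. p i ^ k)"
proof -
  let ?V = "\<lambda>k \<nu>. (ff_power_sum k \<nu> / real (\<Sum>\<^sub># \<nu>) ^ k - h {#k#})\<^sup>2"
  \<comment> \<open>Stage \<open>N\<close> treats all exponents from 2 to \<open>N\<close> with
    error \<open>1 / (N + 1)\<close>; a fixed \<open>k\<close> is therefore controlled from stage
    \<open>k\<close> on, and one sequence of partitions serves all \<open>k\<close>.\<close>
  have "\<forall>N. \<exists>\<nu>. N < \<Sum>\<^sub># \<nu> \<and> int_partition \<nu> \<and> (\<Sum>k=2..N. ?V k \<nu>) < 1 / real (Suc N)"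
  proof
    fix N
    have "0 < 1 / real (Suc N)"
      by simp
    from ex_approximating_partition[OF this, of N] obtain n \<nu>
      where "N < n \<and> int_partition \<nu> \<and> \<Sum>\<^sub># \<nu> = n
        \<and> (\<Sum>k=2..N. (ff_power_sum k \<nu> / real n ^ k - h {#k#})\<^sup>2) < 1 / real (Suc N)"
      by (elim exE)
    then show "\<exists>\<nu>. N < \<Sum>\<^sub># \<nu> \<and> int_partition \<nu> \<and> (\<Sum>k=2..N. ?V k \<nu>) < 1 / real (Suc N)"
      by (intro exI[of _ \<nu>]) simp
  qed
  from choice[OF this] obtain \<nu> where
    \<nu>: "\<forall>N. N < \<Sum>\<^sub># (\<nu> N) \<and> int_partition (\<nu> N) \<and> (\<Sum>k=2..N. ?V k (\<nu> N)) < 1 / real (Suc N)" ..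
  have lim: "(\<lambda>N. suminf (\<lambda>i. partition_point (\<nu> N) i ^ k)) \<longlonglongrightarrow> h {#k#}" if k: "2 \<le> k" for k
  proof -
    let ?n = "\<lambda>N. \<Sum>\<^sub># (\<nu> N)"
    let ?f = "\<lambda>N. ff_power_sum k (\<nu> N) / real (?n N) ^ k"
    let ?s = "\<lambda>N. suminf (\<lambda>i. partition_point (\<nu> N) i ^ k)"
    have inv: "(\<lambda>N. 1 / real (Suc N)) \<longlonglongrightarrow> 0"
      by (rule LIMSEQ_Suc[OF lim_1_over_n])
    have "eventually (\<lambda>N. norm ((?f N - h {#k#})\<^sup>2) \<le> 1 / real (Suc N)) sequentially"
      using eventually_ge_at_top[of k]
    proof eventually_elim
      case (elim N)
      have "?V k (\<nu> N) \<le> (\<Sum>k=2..N. ?V k (\<nu> N))"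
        by (rule member_le_sum) (use k elim in auto)
      then show ?case
        using \<nu>[THEN spec, of N] by simp
    qed
    then have "(\<lambda>N. (?f N - h {#k#})\<^sup>2) \<longlonglongrightarrow> 0"
      using inv by (rule Lim_null_comparison)
    from tendsto_real_sqrt[OF this] have "(\<lambda>N. \<bar>?f N - h {#k#}\<bar>) \<longlonglongrightarrow> 0"
      by simp
    then have f: "(\<lambda>N. ?f N - h {#k#}) \<longlonglongrightarrow> 0"
      by (rule tendsto_rabs_zero_cancel)
    have "norm (?s N - ?f N) \<le> (real k)\<^sup>2 * (1 / real (Suc N))" for N
    proof -
      have N: "N < ?n N" "int_partition (\<nu> N)"
        using \<nu>[THEN spec, of N] by simp_all
      have "\<bar>?s N - ?f N\<bar> \<le> (real k)\<^sup>2 / real (?n N)"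
        using power_sum_approx[OF N(2) refl _ k] N(1) k suminf_partition_point(2)[of k "\<nu> N"] by simp
      also have "\<dots> \<le> (real k)\<^sup>2 / real (Suc N)"
      proof -
        have "(real k)\<^sup>2 / real m \<le> (real k)\<^sup>2 / real (Suc N)" if "N < m" for m
          using that by (intro divide_left_mono) auto
        then show ?thesis
          using N(1) .
      qed
      finally show ?thesis
        by simp
    qed
    then have "eventually (\<lambda>N. norm (?s N - ?f N) \<le> (real k)\<^sup>2 * (1 / real (Suc N))) sequentially"
      by (rule always_eventually[OF allI])
    moreover have "(\<lambda>N. (real k)\<^sup>2 * (1 / real (Suc N))) \<longlonglongrightarrow> 0"
      using tendsto_mult_right_zero[OF inv] .
    ultimately have "(\<lambda>N. ?s N - ?f N) \<longlonglongrightarrow> 0"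
      by (rule Lim_null_comparison)
    from tendsto_add[OF this f] have "(\<lambda>N. ?s N - h {#k#}) \<longlonglongrightarrow> 0"
      by simp
    then show ?thesis
      by (simp add: LIM_zero_iff)
  qed
  have "\<forall>N. partition_point (\<nu> N) \<in> Nabla"
    using partition_point_in_Nabla by simp
  then obtain p r where p: "p \<in> Nabla" "strict_mono (r :: nat \<Rightarrow> nat)" "((\<lambda>N. partition_point (\<nu> N)) \<circ> r) \<longlonglongrightarrow> p"
    by (rule seq_compactE[OF compact_imp_seq_compact[OF compact_Nabla]])
  have "h {#k#} = suminf (\<lambda>i. p i ^ k)" if k: "2 \<le> k" for k
  proof (rule LIMSEQ_unique)
    show "(\<lambda>N. suminf (\<lambda>i. partition_point (\<nu> (r N)) i ^ k)) \<longlonglongrightarrow> h {#k#}"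
      using LIMSEQ_subseq_LIMSEQ[OF lim[OF k] p(2)] by (simp add: comp_def)
    show "(\<lambda>N. suminf (\<lambda>i. partition_point (\<nu> (r N)) i ^ k)) \<longlonglongrightarrow> suminf (\<lambda>i. p i ^ k)"
    proof (rule Nabla_power_sum_tendsto[OF partition_point_in_Nabla _ k])
      show "(\<lambda>N. partition_point (\<nu> (r N)) i) \<longlonglongrightarrow> p i" for i
        using tendsto_coordinate[OF p(3)] by (simp add: comp_def)
    qed
  qed
  then show ?thesis
    using p(1) by blast
qed

end

section \<open>Uniqueness of the parameter\<close>

lemma power_dominated:
  fixes a b C :: real
  assumes "0 \<le> b" "b < a"
  shows "\<exists>l. C * b ^ l < a ^ (l + 2)"
proof (rule ccontr)
  assume "\<not> ?thesis"
  then have le: "a ^ (l + 2) \<le> C * b ^ l" for l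
    using not_less by blast
  have "(b / a) ^ l * C \<ge> a\<^sup>2" for l
    using le[of l] assms by (simp add: power_divide field_simps power_add power2_eq_square)
  moreover have "(\<lambda>l. (b / a) ^ l * C) \<longlonglongrightarrow> 0 * C"
    using assms by (intro tendsto_mult tendsto_const LIMSEQ_realpow_zero) auto
  ultimately have "a\<^sup>2 \<le> 0 * C"
    by (intro LIMSEQ_le_const[of "\<lambda>l. (b / a) ^ l * C" "0 * C"]) auto
  then show False
    using assms by simp
qed

text \<open>High powers isolate the first entry in which two points differ.\<close>

lemma Nabla_power_sums_le:
  assumes p: "p \<in> Nabla" and p': "p' \<in> Nabla"
    and eq: "\<And>k. 2 \<le> k \<Longrightarrow> suminf (\<lambda>i. p i ^ k) = suminf (\<lambda>i. p' i ^ k)"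
    and below: "\<And>i. i < m \<Longrightarrow> p i = p' i"
  shows "p m \<le> p' m"
proof (rule ccontr)
  assume "\<not> p m \<le> p' m"
  then have less: "p' m < p m"
    by simp
  let ?C = "suminf (\<lambda>i. p' (i + m) ^ 2)"
  note P = NablaD[OF p] and P' = NablaD[OF p']
  have sm: "summable (\<lambda>i. p (i + m) ^ k)" "summable (\<lambda>i. p' (i + m) ^ k)" if "0 < k" for k
    using summable_Nabla_power[OF p that] summable_Nabla_power[OF p' that]
      summable_iff_shift[of "\<lambda>i. p i ^ k" m] summable_iff_shift[of "\<lambda>i. p' i ^ k" m] by simp_all
  have "p m ^ (l + 2) \<le> ?C * p' m ^ l" for l
  proof -
    let ?k = "l + 2"
    have "p m ^ ?k = (\<Sum>i<1. p (i + m) ^ ?k)"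
      by simp
    also have "\<dots> \<le> suminf (\<lambda>i. p (i + m) ^ ?k)"
      using sm(1)[of ?k] P(2) by (intro sum_le_suminf) auto
    also have "\<dots> = suminf (\<lambda>i. p i ^ ?k) - (\<Sum>i<m. p i ^ ?k)"
      by (rule suminf_minus_initial_segment) (rule summable_Nabla_power[OF p], simp)
    also have "\<dots> = suminf (\<lambda>i. p' i ^ ?k) - (\<Sum>i<m. p' i ^ ?k)"
      using eq[of ?k] below by simp
    also have "\<dots> = suminf (\<lambda>i. p' (i + m) ^ ?k)"
      by (rule suminf_minus_initial_segment[symmetric]) (rule summable_Nabla_power[OF p'], simp)
    \<comment> \<open>Two factors of each power are kept for a series whose sum \<open>?C\<close>
      does not depend on \<open>l\<close>; the other \<open>l\<close> are bounded by the leading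
      entry \<open>p' m\<close>.\<close>
    also have "\<dots> \<le> suminf (\<lambda>i. p' (i + m) ^ 2 * p' m ^ l)"
    proof (rule suminf_le)
      fix i
      have "p' (i + m) ^ l \<le> p' m ^ l"
        using P'(1,2) by (intro power_mono) (auto simp: antimono_def)
      then have "p' (i + m) ^ 2 * p' (i + m) ^ l \<le> p' (i + m) ^ 2 * p' m ^ l"
        by (intro mult_left_mono) auto
      moreover have "p' (i + m) ^ ?k = p' (i + m) ^ 2 * p' (i + m) ^ l"
        by (simp add: power2_eq_square)
      ultimately show "p' (i + m) ^ ?k \<le> p' (i + m) ^ 2 * p' m ^ l"
        by argo
    next
      show "summable (\<lambda>i. p' (i + m) ^ ?k)"
        by (rule sm(2)) simp
      show "summable (\<lambda>i. p' (i + m) ^ 2 * p' m ^ l)"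
        by (rule summable_mult2[OF sm(2)]) simp
    qed
    also have "\<dots> = ?C * p' m ^ l"
      by (rule suminf_mult2[symmetric]) (rule sm(2), simp)
    finally show ?thesis .
  qed
  then show False
    using power_dominated[OF P'(2) less, of ?C] by (auto simp: not_less[symmetric])
qed

lemma Nabla_eqI:
  assumes p: "p \<in> Nabla" and p': "p' \<in> Nabla"
    and eq: "\<And>k. 2 \<le> k \<Longrightarrow> suminf (\<lambda>i. p i ^ k) = suminf (\<lambda>i. p' i ^ k)"
  shows "p = p'"
proof
  fix m
  show "p m = p' m"
  proof (induction m rule: less_induct)
    case (less m)
    show ?case
    proof (rule antisym)
      show "p m \<le> p' m"
        by (rule Nabla_power_sums_le[OF p p' eq less])
      show "p' m \<le> p m"
        by (rule Nabla_power_sums_le[OF p' p eq[symmetric] less[symmetric]])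
    qed
  qed
qed

lemma psi_determines_point:
  assumes p: "p \<in> Nabla" and p': "p' \<in> Nabla" and eq: "\<And>t. psi p (F t) = psi p' (F t)"
  shows "p = p'"
proof (rule Nabla_eqI[OF p p'])
  fix k :: nat assume "2 \<le> k"
  then show "suminf (\<lambda>i. p i ^ k) = suminf (\<lambda>i. p' i ^ k)"
    using eq[of "path_tree {#k#}"] psi_path_tree_single[OF p, of k] psi_path_tree_single[OF p', of k] by simp
qed

lemma linear_eqI_F:
  fixes \<psi> \<psi>' :: "gl \<Rightarrow> real"
  assumes "linear \<psi>" "linear \<psi>'" "\<And>t. \<psi> (F t) = \<psi>' (F t)"
  shows "\<psi> = \<psi>'"
proof
  show "\<psi> x = \<psi>' x" for x
    unfolding linear_gl[OF assms(1), of x] linear_gl[OF assms(2), of x] assms(3) ..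
qed

section \<open>Arbitrary basis-positive characters\<close>

lemma linear_counit: "linear counit"
  by (rule linearI) (simp_all add: counit_def lookup_add lookup_scaleR)

lemma counit_F: "counit (F t) = (if t = bullet then 1 else 0)"
  by (simp add: counit_def F_def lookup_single when_def)

lemma tau_eq_path_tree: "tau = path_tree {#1#}"
  by (simp add: tau_eq path_tree_def)

text \<open>The value at \<open>F bullet\<close> is idempotent, and if it is 0, then multiplication
  by the unit annihilates all values.\<close>

lemma character_bullet:
  assumes "character \<psi>" "\<psi> \<noteq> (\<lambda>x. 0)"
  shows "\<psi> (F bullet) = 1"
proof (rule ccontr)
  assume no: "\<psi> (F bullet) \<noteq> 1"
  have "\<psi> (F t) = 0" for t
  proof -
    have "\<psi> (F bullet) = 0"
      using character_bullet_mult[OF assms(1), of bullet] no by simp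
    then show ?thesis
      using character_bullet_mult[OF assms(1), of t] by simp
  qed
  moreover have "linear \<psi>"
    using assms(1) by (simp add: character_def)
  ultimately have "\<psi> = (\<lambda>x. 0)"
    by (intro linear_eqI_F) (simp_all add: linear_zero)
  then show False
    using assms(2) by simp
qed

text \<open>The product rule at \<open>k = 1\<close> says that the values at all partitions obtained
  from \<nu> by adding 1 to a part or as a new part sum to 0, so each of them is 0. Every nonempty
  partition arises in this way, by lowering one of its parts by 1.\<close>

lemma stuffle_eq_0:
  assumes h: "stuffle h" and nonneg: "\<And>\<mu>. int_partition \<mu> \<Longrightarrow> 0 \<le> h \<mu>" and one: "h {#1#} = 0"
    and \<mu>: "int_partition \<mu>" "\<mu> \<noteq> {#}"
  shows "h \<mu> = 0"
proof -
  have sum0: "h (add_mset 1 \<nu>) + (\<Sum>j\<in>#\<nu>. h (add_mset (j + 1) (\<nu> - {#j#}))) = 0" if "int_partition \<nu>" for \<nu>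
  proof -
    have "h {#1#} * h \<nu> = h (add_mset 1 \<nu>) + (\<Sum>j\<in>#\<nu>. h (add_mset (j + 1) (\<nu> - {#j#})))"
      using h that by (simp add: stuffle_def)
    then show ?thesis
      using one by simp
  qed
  have ge: "0 \<le> (\<Sum>j\<in>#M. h (add_mset (j + 1) (\<nu> - {#j#})))" if "int_partition \<nu>" for M \<nu>
    using that by (intro sum_mset_nonneg_real nonneg) simp
  obtain k \<rho> where \<rho>: "\<mu> = add_mset k \<rho>"
    using \<mu>(2) by (cases \<mu>) auto
  have k: "0 < k" "int_partition \<rho>"
    using \<mu>(1) \<rho> by simp_all
  show ?thesis
  proof (cases "k = 1")
    case True
    then show ?thesis
      using sum0[OF k(2)] ge[OF k(2), of \<rho>] nonneg[OF \<mu>(1)] \<rho> by simp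
  next
    case False
    define j where "j = k - 1"
    then have j: "k = j + 1" "0 < j"
      using k(1) False by simp_all
    let ?\<nu> = "add_mset j \<rho>"
    have \<nu>: "int_partition ?\<nu>"
      using j k by simp
    have "(\<Sum>i\<in>#?\<nu>. h (add_mset (i + 1) (?\<nu> - {#i#})))
        = h \<mu> + (\<Sum>i\<in>#\<rho>. h (add_mset (i + 1) (?\<nu> - {#i#})))"
      using j(1) \<rho> by simp
    moreover have "0 \<le> h (add_mset 1 ?\<nu>)"
      using \<nu> by (intro nonneg) simp
    ultimately show ?thesis
      using sum0[OF \<nu>] ge[OF \<nu>, of \<rho>] nonneg[OF \<mu>(1)] by linarith
  qed
qed

lemma character_tau_pos:
  assumes \<psi>: "character \<psi>" "basis_positive \<psi>" and nz: "\<psi> \<noteq> (\<lambda>x. 0)" and nc: "\<psi> \<noteq> counit"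
  shows "0 < \<psi> (F tau)"
proof (rule ccontr)
  assume "\<not> 0 < \<psi> (F tau)"
  moreover have nonneg: "0 \<le> \<psi> (F t)" for t
    using \<psi>(2) by (simp add: basis_positive_def)
  ultimately have tau0: "\<psi> (F (path_tree {#1#})) = 0"
    unfolding tau_eq_path_tree[symmetric] by (meson antisym not_less)
  have bullet1: "\<psi> (F bullet) = 1"
    using \<psi>(1) nz by (rule character_bullet)
  have "\<psi> (F t) = counit (F t)" for t
  proof (cases "path_forest t")
    case False
    moreover have "path_forest bullet"
      by (simp add: bullet_def path_forest_Node)
    ultimately show ?thesis
      using character_vanishes[OF \<psi>] by (auto simp: counit_F)
  next
    case True
    then obtain \<mu> where \<mu>: "int_partition \<mu>" "t = path_tree \<mu>"
      by (auto simp: path_forest_iff)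
    show ?thesis
    proof (cases "\<mu> = {#}")
      case True
      then have "t = bullet"
        using \<mu> by (simp add: path_tree_def bullet_def)
      then show ?thesis
        using bullet1 by (simp add: counit_F)
    next
      case False
      then have "t \<noteq> bullet"
        using \<mu> by (simp add: path_tree_def bullet_def)
      moreover have "\<psi> (F (path_tree \<mu>)) = 0"
        by (rule stuffle_eq_0[OF stuffle_character[OF \<psi> bullet1] nonneg tau0 \<mu>(1) False])
      ultimately show ?thesis
        using \<mu>(2) by (simp add: counit_F)
    qed
  qed
  moreover have "linear \<psi>"
    using \<psi>(1) by (simp add: character_def)
  ultimately have "\<psi> = counit"
    by (intro linear_eqI_F linear_counit)
  then show False
    using nc by simp
qed

text \<open>All partitions in the product rule have the same sum, so the powers of \<open>c\<close>
  cancel.\<close>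

lemma stuffle_scale:
  assumes "stuffle h" "c \<noteq> 0"
  shows "stuffle (\<lambda>\<mu>. h \<mu> / c ^ \<Sum>\<^sub># \<mu>)"
proof -
  have "h {#k#} / c ^ k * (h \<mu> / c ^ \<Sum>\<^sub># \<mu>) = h (add_mset k \<mu>) / c ^ \<Sum>\<^sub># (add_mset k \<mu>)
      + (\<Sum>j\<in>#\<mu>. h (add_mset (j + k) (\<mu> - {#j#})) / c ^ \<Sum>\<^sub># (add_mset (j + k) (\<mu> - {#j#})))"
    if "0 < k" "int_partition \<mu>" for k \<mu>
  proof -
    let ?d = "c ^ (k + \<Sum>\<^sub># \<mu>)"
    have "image_mset (\<lambda>j. h (add_mset (j + k) (\<mu> - {#j#})) / c ^ \<Sum>\<^sub># (add_mset (j + k) (\<mu> - {#j#}))) \<mu>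
        = image_mset (\<lambda>j. h (add_mset (j + k) (\<mu> - {#j#})) * (1 / ?d)) \<mu>"
    proof (rule image_mset_cong)
      fix j assume "j \<in># \<mu>"
      from sum_mset.remove[OF this] have e: "\<Sum>\<^sub># (add_mset (j + k) (\<mu> - {#j#})) = k + \<Sum>\<^sub># \<mu>"
        by simp
      show "h (add_mset (j + k) (\<mu> - {#j#})) / c ^ \<Sum>\<^sub># (add_mset (j + k) (\<mu> - {#j#}))
          = h (add_mset (j + k) (\<mu> - {#j#})) * (1 / ?d)"
        unfolding e by simp
    qed
    then have "(\<Sum>j\<in>#\<mu>. h (add_mset (j + k) (\<mu> - {#j#})) / c ^ \<Sum>\<^sub># (add_mset (j + k) (\<mu> - {#j#})))
        = (\<Sum>j\<in>#\<mu>. h (add_mset (j + k) (\<mu> - {#j#}))) * (1 / ?d)"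
      by (simp only: sum_mset_distrib_right)
    moreover have "h {#k#} * h \<mu> = h (add_mset k \<mu>) + (\<Sum>j\<in>#\<mu>. h (add_mset (j + k) (\<mu> - {#j#})))"
      using assms(1) that by (simp add: stuffle_def)
    ultimately show ?thesis
      by (simp add: power_add add_divide_distrib[symmetric])
  qed
  then show ?thesis
    using assms(1) by (simp add: stuffle_def)
qed

lemma nverts_path_tree:
  assumes "int_partition \<mu>"
  shows "nverts (path_tree \<mu>) = Suc (\<Sum>\<^sub># \<mu>)"
proof -
  have "image_mset (nverts \<circ> chain) \<mu> = image_mset id \<mu>"
    using assms by (intro image_mset_cong) (auto simp: int_partition_def intro!: nverts_chain gr0I)
  then show ?thesis
    by (simp add: path_tree_def multiset.map_comp)
qed

lemma character_form:
  assumes \<psi>: "character \<psi>" "basis_positive \<psi>" "\<psi> \<noteq> (\<lambda>x. 0)" "\<psi> \<noteq> counit"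
  shows "\<exists>p\<in>Nabla. \<forall>t. \<psi> (F t) = \<psi> (F tau) ^ (nverts t - 1) * psi p (F t)"
proof -
  let ?c = "\<psi> (F tau)"
  \<comment> \<open>The sum of \<mu> is the degree of \<open>path_tree \<mu>\<close>; the division
    makes the value at \<open>{#1#}\<close> equal to 1.\<close>
  let ?h = "\<lambda>\<mu>. \<psi> (F (path_tree \<mu>)) / ?c ^ \<Sum>\<^sub># \<mu>"
  have c: "0 < ?c"
    using \<psi> by (rule character_tau_pos)
  have st: "stuffle ?h"
    using stuffle_character[OF \<psi>(1,2) character_bullet[OF \<psi>(1,3)]] c by (intro stuffle_scale) auto
  interpret kingman ?h
  proof
    show "stuffle ?h"
      by (rule st)
    show "0 \<le> ?h \<mu>" for \<mu>
      using c \<psi>(2) by (simp add: basis_positive_def)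
    show "?h {#1#} = 1"
      using c unfolding tau_eq_path_tree by simp
  qed
  obtain p where p: "p \<in> Nabla" and ps: "\<forall>k\<ge>2. ?h {#k#} = suminf (\<lambda>i. p i ^ k)"
    using ex_Nabla_power_sums by (elim bexE)
  have eq: "?h \<mu> = chi p (aug_monomial_sym \<mu>)" if "int_partition \<mu>" for \<mu>
  proof (rule stuffle_unique[OF st stuffle_chi[OF p] _ that])
    fix k :: nat assume k: "0 < k"
    show "?h {#k#} = chi p (aug_monomial_sym {#k#})"
    proof (cases "k = 1")
      case True
      then show ?thesis
        using one p by (simp add: aug_monomial_sym_single chi_power_sum)
    next
      case False
      then have "2 \<le> k"
        using k by simp
      then show ?thesis
        using ps k False p by (simp add: aug_monomial_sym_single chi_power_sum)
    qed
  qed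
  have "\<psi> (F t) = ?c ^ (nverts t - 1) * psi p (F t)" for t
  proof (cases "path_forest t")
    case False
    then show ?thesis
      using character_vanishes[OF \<psi>(1,2)] psi_not_path_forest[OF p] by simp
  next
    case True
    then obtain \<mu> where \<mu>: "int_partition \<mu>" "t = path_tree \<mu>"
      by (auto simp: path_forest_iff)
    then show ?thesis
      using eq[OF \<mu>(1)] c by (simp add: nverts_path_tree psi_path_tree field_simps)
  qed
  then show ?thesis
    using p by blast
qed

lemma normalized_characters_eq: "normalized_characters = psi ` Nabla"
proof
  show "psi ` Nabla \<subseteq> normalized_characters"
    using psi_in_normalized_characters by blast
  show "normalized_characters \<subseteq> psi ` Nabla"
  proof
    fix \<psi> assume "\<psi> \<in> normalized_characters"
    then have \<psi>: "character \<psi>" "basis_positive \<psi>" and one: "\<psi> (F tau) = 1"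
      by (simp_all add: normalized_characters_def normalized_def)
    have "counit (F tau) = 0"
      by (simp add: counit_F tau_eq) (simp add: bullet_def)
    then have ne: "\<psi> \<noteq> (\<lambda>x. 0)" "\<psi> \<noteq> counit"
      using one by auto
    obtain p where p: "p \<in> Nabla" "\<forall>t. \<psi> (F t) = \<psi> (F tau) ^ (nverts t - 1) * psi p (F t)"
      using character_form[OF \<psi> ne] by (elim bexE)
    have "\<psi> = psi p"
    proof (rule linear_eqI_F)
      show "linear \<psi>"
        using \<psi>(1) by (simp add: character_def)
      show "linear (psi p)"
        by (rule linear_psi[OF p(1)])
      show "\<psi> (F t) = psi p (F t)" for t
        using p(2)[THEN spec, of t] one by simp
    qed
    then show "\<psi> \<in> psi ` Nabla"
      using p(1) by blast
  qed
qed

section \<open>The homeomorphism\<close>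

lemma inj_on_psi: "inj_on psi Nabla"
  by (rule inj_onI) (rule psi_determines_point, auto)

text \<open>By the stuffle recursion it is enough to follow the power sums: for \<open>k = 1\<close>
  the value is constantly 1, and for \<open>k \<ge> 2\<close> the power sum is continuous on
  \<open>Nabla\<close>.\<close>

lemma continuous_on_psi_F: "continuous_on Nabla (\<lambda>p. psi p (F t))"
  unfolding continuous_on_sequentially
proof (intro allI ballI impI)
  fix x p assume p: "p \<in> Nabla" and x: "(\<forall>n. x n \<in> Nabla) \<and> x \<longlonglongrightarrow> p"
  have xN: "x n \<in> Nabla" for n
    using x by simp
  have "(\<lambda>n. psi (x n) (F t)) \<longlonglongrightarrow> psi p (F t)"
  proof (cases "path_forest t")
    case False
    then show ?thesis
      using psi_not_path_forest[OF p] psi_not_path_forest[OF xN] by simp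
  next
    case True
    then obtain \<mu> where \<mu>: "int_partition \<mu>" "t = path_tree \<mu>"
      by (auto simp: path_forest_iff)
    have "(\<lambda>n. chi (x n) (aug_monomial_sym \<mu>)) \<longlonglongrightarrow> chi p (aug_monomial_sym \<mu>)"
    proof (rule stuffle_tendsto[OF stuffle_chi[OF xN] stuffle_chi[OF p] _ \<mu>(1)])
      fix k :: nat assume k: "0 < k"
      show "(\<lambda>n. chi (x n) (aug_monomial_sym {#k#})) \<longlonglongrightarrow> chi p (aug_monomial_sym {#k#})"
      proof (cases "k = 1")
        case True
        then show ?thesis
          using p xN by (simp add: aug_monomial_sym_single chi_power_sum)
      next
        case False
        then have "2 \<le> k"
          using k by simp
        then have "(\<lambda>n. suminf (\<lambda>i. x n i ^ k)) \<longlonglongrightarrow> suminf (\<lambda>i. p i ^ k)"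
          using x tendsto_coordinate by (intro Nabla_power_sum_tendsto xN) auto
        then show ?thesis
          using p xN k False by (simp add: aug_monomial_sym_single chi_power_sum)
      qed
    qed
    then show ?thesis
      using \<mu> by (simp add: psi_path_tree)
  qed
  then show "((\<lambda>p. psi p (F t)) \<circ> x) \<longlonglongrightarrow> psi p (F t)"
    by (simp add: comp_def)
qed

lemma topspace_characters_topology: "topspace characters_topology = normalized_characters"
  by (simp add: characters_topology_def topspace_pullback_topology)

text \<open>The pulled-back topology inherits separation because a linear functional is determined
  by its values on the basis.\<close>

lemma Hausdorff_characters_topology: "Hausdorff_space characters_topology"
proof (rule Hausdorff_space_injective_preimage)
  have "Hausdorff_space (product_topology (\<lambda>_::rtree. euclidean :: real topology) UNIV)"
    by (simp add: Hausdorff_space_product_topology)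
  then show "Hausdorff_space (euclidean :: (rtree \<Rightarrow> real) topology)"
    by (simp only: euclidean_product_topology)
  have "continuous_map (euclidean :: (rtree \<Rightarrow> real) topology) euclidean id"
    by (rule continuous_map_id)
  then have "continuous_map characters_topology euclidean (id \<circ> (\<lambda>\<psi> t. \<psi> (F t)))"
    unfolding characters_topology_def by (rule continuous_map_pullback)
  then show "continuous_map characters_topology euclidean (\<lambda>\<psi> t. \<psi> (F t))"
    by simp
  show "inj_on (\<lambda>\<psi> t. \<psi> (F t)) (topspace characters_topology)"
    unfolding topspace_characters_topology
  proof (rule inj_onI)
    fix \<psi> \<psi>' assume "\<psi> \<in> normalized_characters" "\<psi>' \<in> normalized_characters"
      and eq: "(\<lambda>t. \<psi> (F t)) = (\<lambda>t. \<psi>' (F t))"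
    then have "linear \<psi>" "linear \<psi>'"
      by (simp_all add: normalized_characters_def character_def)
    then show "\<psi> = \<psi>'"
      using fun_cong[OF eq] by (rule linear_eqI_F)
  qed
qed

text \<open>A continuous bijection from a compact space onto a Hausdorff space is a
  homeomorphism.\<close>

lemma homeomorphic_map_psi: "homeomorphic_map (top_of_set Nabla) characters_topology psi"
proof (rule continuous_imp_homeomorphic_map)
  have "continuous_on Nabla (\<lambda>p t. psi p (F t))"
    by (intro continuous_on_coordinatewise_then_product continuous_on_psi_F)
  then have "continuous_map (top_of_set Nabla) euclidean ((\<lambda>\<psi> t. \<psi> (F t)) \<circ> psi)"
    by (simp add: comp_def)
  then show "continuous_map (top_of_set Nabla) characters_topology psi"
    unfolding characters_topology_def
    by (rule continuous_map_pullback') (use psi_in_normalized_characters in auto)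
  show "compact_space (top_of_set Nabla)"
    using compact_Nabla by (intro compact_space_subtopology) simp
  show "Hausdorff_space characters_topology"
    by (rule Hausdorff_characters_topology)
  show "psi ` topspace (top_of_set Nabla) = topspace characters_topology"
    by (simp add: topspace_characters_topology normalized_characters_eq)
  show "inj_on psi (topspace (top_of_set Nabla))"
    using inj_on_psi by simp
qed

text \<open>The tree \<open>tau\<close> has degree 1 and \<open>psi p' (F tau) = 1\<close>, so the
  value at \<open>tau\<close> recovers \<open>c'\<close>; dividing by its powers leaves the values
  of \<open>psi p'\<close>, which determine the point.\<close>

lemma character_form_unique:
  assumes "p \<in> Nabla" "p' \<in> Nabla" "0 < c'"
    and c: "\<forall>t. \<psi> (F t) = \<psi> (F tau) ^ (nverts t - 1) * psi p (F t)" "0 < \<psi> (F tau)"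
    and c': "\<forall>t. \<psi> (F t) = c' ^ (nverts t - 1) * psi p' (F t)"
  shows "c' = \<psi> (F tau) \<and> p' = p"
proof -
  have "psi p' (F tau) = 1"
    using psi_path_tree_single[OF assms(2), of 1] by (simp add: tau_eq_path_tree)
  moreover have "nverts tau = 2"
    by (rule nverts_chain) simp
  ultimately have eq: "c' = \<psi> (F tau)"
    using c'[THEN spec, of tau] by simp
  have "psi p' (F t) = psi p (F t)" for t
  proof -
    have "c' ^ (nverts t - 1) * psi p' (F t) = c' ^ (nverts t - 1) * psi p (F t)"
      using c(1)[THEN spec, of t] c'[THEN spec, of t] eq by simp
    then show ?thesis
      using assms(3) by simp
  qed
  then have "p' = p"
    using assms(1,2) by (intro psi_determines_point)
  then show ?thesis
    using eq by simp
qed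

theorem theoremA:
  shows
    "(\<forall>\<psi>. character \<psi> \<and> basis_positive \<psi> \<longrightarrow> (\<forall>x\<in>I_pf. \<psi> x = 0))
   \<and> normalized_characters = psi ` Nabla
   \<and> (\<forall>p\<in>Nabla.
        (\<forall>\<mu>. int_partition \<mu> \<longrightarrow> psi p (F (path_tree \<mu>)) = chi p (aug_monomial_sym \<mu>))
      \<and> (\<forall>t. \<not> path_forest t \<longrightarrow> psi p (F t) = 0))
   \<and> inj_on psi Nabla
   \<and> homeomorphic_map (top_of_set Nabla) characters_topology psi
   \<and> (\<forall>\<psi>. character \<psi> \<and> basis_positive \<psi> \<and> \<psi> \<noteq> (\<lambda>x. 0) \<and> \<psi> \<noteq> counit \<longrightarrow>
        (\<exists>c p. c = \<psi> (F tau) \<and> 0 < c \<and> p \<in> Nabla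
           \<and> (\<forall>t. \<psi> (F t) = c ^ (nverts t - 1) * psi p (F t))
           \<and> (\<forall>c' p'. 0 < c' \<and> p' \<in> Nabla
                \<and> (\<forall>t. \<psi> (F t) = c' ^ (nverts t - 1) * psi p' (F t))
                \<longrightarrow> c' = c \<and> p' = p)))"
proof (intro conjI)
  show "\<forall>\<psi>. character \<psi> \<and> basis_positive \<psi> \<longrightarrow> (\<forall>x\<in>I_pf. \<psi> x = 0)"
    by (intro allI impI ballI) (elim conjE, rule character_vanishes_I_pf)
  show "normalized_characters = psi ` Nabla"
    by (rule normalized_characters_eq)
  show "\<forall>p\<in>Nabla. (\<forall>\<mu>. int_partition \<mu> \<longrightarrow> psi p (F (path_tree \<mu>)) = chi p (aug_monomial_sym \<mu>))
      \<and> (\<forall>t. \<not> path_forest t \<longrightarrow> psi p (F t) = 0)"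
    by (intro ballI conjI allI impI psi_path_tree psi_not_path_forest)
  show "inj_on psi Nabla"
    by (rule inj_on_psi)
  show "homeomorphic_map (top_of_set Nabla) characters_topology psi"
    by (rule homeomorphic_map_psi)
  show "\<forall>\<psi>. character \<psi> \<and> basis_positive \<psi> \<and> \<psi> \<noteq> (\<lambda>x. 0) \<and> \<psi> \<noteq> counit \<longrightarrow>
        (\<exists>c p. c = \<psi> (F tau) \<and> 0 < c \<and> p \<in> Nabla
           \<and> (\<forall>t. \<psi> (F t) = c ^ (nverts t - 1) * psi p (F t))
           \<and> (\<forall>c' p'. 0 < c' \<and> p' \<in> Nabla
                \<and> (\<forall>t. \<psi> (F t) = c' ^ (nverts t - 1) * psi p' (F t))
                \<longrightarrow> c' = c \<and> p' = p))"
  proof (intro allI impI, elim conjE)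
    fix \<psi> assume \<psi>: "character \<psi>" "basis_positive \<psi>" "\<psi> \<noteq> (\<lambda>x. 0)" "\<psi> \<noteq> counit"
    have pos: "0 < \<psi> (F tau)"
      using \<psi> by (rule character_tau_pos)
    obtain p where p: "p \<in> Nabla" "\<forall>t. \<psi> (F t) = \<psi> (F tau) ^ (nverts t - 1) * psi p (F t)"
      using character_form[OF \<psi>] by (elim bexE)
    have "\<forall>c' p'. 0 < c' \<and> p' \<in> Nabla \<and> (\<forall>t. \<psi> (F t) = c' ^ (nverts t - 1) * psi p' (F t))
        \<longrightarrow> c' = \<psi> (F tau) \<and> p' = p"
    proof (intro allI impI, elim conjE)
      fix c' p' assume "0 < c'" "p' \<in> Nabla" "\<forall>t. \<psi> (F t) = c' ^ (nverts t - 1) * psi p' (F t)"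
      then show "c' = \<psi> (F tau) \<and> p' = p"
        by (intro character_form_unique[OF p(1) _ _ p(2) pos])
    qed
    then show "\<exists>c p. c = \<psi> (F tau) \<and> 0 < c \<and> p \<in> Nabla
           \<and> (\<forall>t. \<psi> (F t) = c ^ (nverts t - 1) * psi p (F t))
           \<and> (\<forall>c' p'. 0 < c' \<and> p' \<in> Nabla
                \<and> (\<forall>t. \<psi> (F t) = c' ^ (nverts t - 1) * psi p' (F t))
                \<longrightarrow> c' = c \<and> p' = p)"
      by (intro exI[of _ "\<psi> (F tau)"] exI[of _ p] conjI refl pos p)
  qed
qed

end
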